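(* Let $n>0$ be a real number. Then for any $p\in[1,2)\cup(2,+\infty)$ if $n\le 2$, and for any $p\in[1,2)\cup(2,2^*]$ with $2^*=\frac{2n}{n-2}$ if $n>2$, we have $$\|\rho f'\|_2^2\ \ge\ \frac{n}{p-2}\left(\|f\|_p^2-\|f\|_2^2\right)\qquad\forall\, f\in \mathrm H^1([-1,1],d\nu_n).$$ Moreover, corresponding to the case $p=2$, for any $n>0$ we have $$\|\rho f'\|_2^2\ \ge\ \frac n2\int_{-1}^1 f^2\log\left(\frac{f^2}{\|f\|_2^2}\right)d\nu_n\qquad\forall\, f\in \mathrm H^1([-1,1],d\nu_n).$$ The constants $\frac{n}{p-2}$ and $\frac n2$ are sharp: for each admissible $n$ and $p$, the first inequality fails for some $f\in \mathrm H^1([-1,1],d\nu_n)$ if $n$ is replaced by a larger constant in the factor $\frac{n}{p-2}$, and the second inequality fails for some $f$ if $\frac n2$ is replaced by a larger constant.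
   Context: For a real parameter $n>0$ and $z\in[-1,1]$, set $\rho=\rho(z)=\sqrt{1-z^2}$ and define the probability measure on $[-1,1]$ $$d\nu_n(z):=Z_n^{-1}\,\rho^{n-2}\,dz,\qquad Z_n:=\frac{\sqrt\pi\,\Gamma(\frac n2)}{\Gamma(\frac{n+1}2)}.$$ Functions are real-valued. For $q\ge1$, $\|f\|_q=\left(\int_{-1}^1|f|^q\,d\nu_n\right)^{1/q}$. The space $\mathrm H^1([-1,1],d\nu_n)$ is the set of functions $f\in \mathrm L^2([-1,1],d\nu_n)$ with (weak) derivative $f'$ such that $\|\rho f'\|_2^2+\|f\|_2^2<\infty$. In the logarithmic inequality the integrand $f^2\log(f^2/\|f\|_2^2)$ is understood as $0$ where $f=0$ (so the inequality is trivial for $f\equiv 0$). *)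

theory Defs
  imports "HOL-Analysis.Analysis"
begin

definition rho :: "real \<Rightarrow> real" where
  "rho z = sqrt (1 - z\<^sup>2)"

definition Zn :: "real \<Rightarrow> real" where
  "Zn n = sqrt pi * Gamma (n / 2) / Gamma ((n + 1) / 2)"

text \<open>The space of \<open>nu n\<close> is \<open>{-1..1}\<close>. At the endpoints, a null set, the density is \<open>0\<close>
  because \<open>0 powr a = 0\<close>.\<close>

definition nu :: "real \<Rightarrow> real measure" where
  "nu n = density (restrict_space lborel {-1..1}) (\<lambda>z. ennreal (rho z powr (n - 2) / Zn n))"

definition in_Lq :: "real \<Rightarrow> real \<Rightarrow> (real \<Rightarrow> real) \<Rightarrow> bool" where
  "in_Lq n q f \<longleftrightarrow>
     f \<in> borel_measurable (nu n) \<and> integrable (nu n) (\<lambda>z. \<bar>f z\<bar> powr q)"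

text \<open>Meaningful only under \<open>in_Lq n q f\<close>: the Bochner integral of a non-integrable function
  is \<open>0\<close>.\<close>

definition Lq_norm :: "real \<Rightarrow> real \<Rightarrow> (real \<Rightarrow> real) \<Rightarrow> real" where
  "Lq_norm n q f = (\<integral>z. \<bar>f z\<bar> powr q \<partial>(nu n)) powr (1 / q)"

definition test_function :: "(real \<Rightarrow> real) \<Rightarrow> bool" where
  "test_function \<phi> \<longleftrightarrow>
     (\<forall>k x. ((deriv ^^ k) \<phi>) differentiable (at x)) \<and>
     (\<exists>K. compact K \<and> K \<subseteq> {-1<..<1} \<and> (\<forall>x. x \<notin> K \<longrightarrow> \<phi> x = 0))"

definition locally_integrable :: "(real \<Rightarrow> real) \<Rightarrow> bool" where
  "locally_integrable f \<longleftrightarrow>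
     (\<forall>K. compact K \<and> K \<subseteq> {-1<..<1} \<longrightarrow> set_integrable lborel K f)"

definition has_weak_deriv :: "(real \<Rightarrow> real) \<Rightarrow> (real \<Rightarrow> real) \<Rightarrow> bool" where
  "has_weak_deriv f f' \<longleftrightarrow>
     locally_integrable f \<and> locally_integrable f' \<and>
     (\<forall>\<phi>. test_function \<phi> \<longrightarrow>
        (LBINT x:{-1<..<1}. f x * deriv \<phi> x) = - (LBINT x:{-1<..<1}. f' x * \<phi> x))"

text \<open>A function \<open>f\<close> belongs to the space \<open>H\<^sup>1([-1,1], d\<nu>\<^sub>n)\<close> iff \<open>in_H1 n f f'\<close> holds for
  some \<open>f'\<close>, which is then its weak derivative. It is carried along explicitly since it is
  determined only almost everywhere.\<close>

definition in_H1 :: "real \<Rightarrow> (real \<Rightarrow> real) \<Rightarrow> (real \<Rightarrow> real) \<Rightarrow> bool" where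
  "in_H1 n f f' \<longleftrightarrow>
     in_Lq n 2 f \<and> has_weak_deriv f f' \<and> in_Lq n 2 (\<lambda>z. rho z * f' z)"

text \<open>Since \<open>ln 0 = 0\<close> and \<open>x / 0 = 0\<close>, this is \<open>0\<close> wherever \<open>f z = 0\<close>, and everywhere if
  \<open>f\<close> has norm \<open>0\<close>.\<close>

definition entropy_integrand :: "real \<Rightarrow> (real \<Rightarrow> real) \<Rightarrow> real \<Rightarrow> real" where
  "entropy_integrand n f z = (f z)\<^sup>2 * ln ((f z)\<^sup>2 / (Lq_norm n 2 f)\<^sup>2)"

end

theory Submission
  imports Defs "HOL-Complex_Analysis.Great_Picard"
begin

text \<open>
  For \<open>p > 1\<close>, \<open>p \<noteq> 2\<close>, restrict the problem to \<open>[-r, r]\<close> with \<open>r < 1\<close>, normalize the measure there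
  and put \<open>k = n / (p - 2)\<close>. On this interval every exponent is subcritical, and
  the functional \<open>g \<mapsto> \<integral> (1 - z\<^sup>2) g'\<^sup>2 + k \<integral> g\<^sub>+\<^sup>2 + \<integral> g\<^sub>-\<^sup>2 - e (\<integral> g)\<^sub>+\<^sup>2\<close>, with \<open>g\<close> of class \<open>C\<^sup>1\<close> and
  \<open>\<integral> g\<^sub>+\<^sup>p = 1\<close>, has a minimizer \<open>f\<close> that solves a Neumann problem. The perturbation by \<open>e > 0\<close> makes \<open>f\<close>
  positive by the minimum principle, also for \<open>p < 2\<close>, where dead cores could otherwise occur.
  Multiplying the Euler-Lagrange equation by the expression known from the nonlinear carre du champ
  method shows that \<open>f\<close> is constant; the boundary terms vanish by the Neumann condition,
  and the term from the perturbation has the favourable sign. The constant \<open>n\<close> in the Bochner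
  identity does not depend on \<open>r\<close>, so letting \<open>e \<rightarrow> 0\<close>, approximating a Sobolev function by Steklov
  averages and letting \<open>r \<rightarrow> 1\<close> gives the inequality. The cases \<open>p = 1\<close> and
  \<open>p = 2\<close> follow by \<open>p \<rightarrow> 1\<close> and \<open>p \<rightarrow> 2\<close>, and the functions \<open>1 + \<epsilon> z\<close> with \<open>\<epsilon> \<rightarrow> 0\<close> show sharpness.
\<close>

section \<open>The variational problem on a compact interval\<close>

text \<open>At the critical exponent there is no compactness on [-1, 1], and the weight degenerates
  at the end points. On [-r, r] it lies between positive constants, so bounded energy means
  equi-Hoelder and a minimizing sequence converges uniformly for every exponent. The constant n
  survives the truncation because the Bochner identity is pointwise: the relation k (p - 2) = n
  cancels exactly the terms in f'^2 that carry no factor 1 / f. What remains is a perfect square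
  containing f'' plus a multiple of n + 2 - (n - 2) (p - 1), which vanishes at the critical
  exponent. The perturbation leaves behind f'^2 / f with a strictly positive coefficient even there,
  so f' = 0 follows without a discussion of the equality case.

  Sharpness rests on linearization at constants: z is an eigenfunction of L with eigenvalue n, and
  to second order in \<epsilon> each inequality, applied to 1 + \<epsilon> z, becomes the spectral
  gap inequality for z, which is an equality.\<close>

lemma continuous_on_pos_powr:
  fixes f :: "'a::topological_space \<Rightarrow> real"
  assumes "continuous_on S f" "r > 0"
  shows "continuous_on S (\<lambda>x. max (f x) 0 powr r)"
  using assms by (intro continuous_on_powr' continuous_intros) auto

lemma has_real_derivative_pos_powr:
  assumes "1 < r"
  shows "((\<lambda>x::real. max x 0 powr r) has_real_derivative r * max x 0 powr (r - 1)) (at x)"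
proof (cases x "0::real" rule: linorder_cases)
  case greater
  have "((\<lambda>x. x powr r) has_real_derivative r * x powr (r - 1)) (at x)"
    using greater by (rule has_real_derivative_powr)
  then have "((\<lambda>x::real. max x 0 powr r) has_real_derivative r * x powr (r - 1)) (at x)"
    by (rule has_field_derivative_transform_within_open[where S = "{0<..}"]) (use greater in auto)
  then show ?thesis using greater by simp
next
  case less
  have "((\<lambda>x::real. 0) has_real_derivative 0) (at x)" by simp
  then have "((\<lambda>x::real. max x 0 powr r) has_real_derivative 0) (at x)"
    by (rule has_field_derivative_transform_within_open[where S = "{..<0}"]) (use less in auto)
  then show ?thesis using less by simp
next
  case equal
  have "continuous_on UNIV (\<lambda>h::real. max h 0 powr (r - 1))"
    using assms by (intro continuous_on_pos_powr continuous_intros) auto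
  then have "(\<lambda>h::real. max h 0 powr (r - 1)) \<midarrow>0\<rightarrow> max 0 0 powr (r - 1)"
    unfolding continuous_on_def by blast
  then have "(\<lambda>h::real. max h 0 powr (r - 1)) \<midarrow>0\<rightarrow> 0"
    by simp
  moreover have "max h 0 powr (r - 1) = (max (0 + h) 0 powr r - max 0 0 powr r) / h" if "h \<noteq> 0" for h :: real
    using that by (cases "h > 0") (auto simp: powr_diff)
  ultimately have "(\<lambda>h::real. (max (0 + h) 0 powr r - max 0 0 powr r) / h) \<midarrow>0\<rightarrow> 0"
    by (subst LIM_equal[where g = "\<lambda>h::real. max h 0 powr (r - 1)"]) auto
  then show ?thesis using equal by (simp add: DERIV_def)
qed

lemma has_real_derivative_pos_square:
  "((\<lambda>x::real. (max x 0)\<^sup>2) has_real_derivative 2 * max x 0) (at x)"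
proof -
  have "max x 0 powr 2 = (max x 0)\<^sup>2" for x :: real
    by (cases "x > 0") (auto simp: max_def)
  moreover have "max x 0 powr (2 - 1) = max x 0" by simp
  ultimately show ?thesis
    using has_real_derivative_pos_powr[of 2 x] by simp
qed

lemma has_real_derivative_neg_square:
  "((\<lambda>x::real. (max (- x) 0)\<^sup>2) has_real_derivative - 2 * max (- x) 0) (at x)"
  using DERIV_chain'[OF DERIV_minus[OF DERIV_ident] has_real_derivative_pos_square[of "- x"]]
  by simp

section \<open>Functions of class C^1 up to the end points, with one-sided derivatives there\<close>

definition C1_on :: "real \<Rightarrow> real \<Rightarrow> (real \<Rightarrow> real) \<Rightarrow> (real \<Rightarrow> real) \<Rightarrow> bool" where
  "C1_on a b g g' \<longleftrightarrow> continuous_on {a..b} g' \<and>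
     (\<forall>x\<in>{a..b}. (g has_real_derivative g' x) (at x within {a..b}))"

lemma C1_on_continuous: "C1_on a b g g' \<Longrightarrow> continuous_on {a..b} g"
  unfolding C1_on_def continuous_on_eq_continuous_within by (blast intro: DERIV_continuous)

lemma C1_on_cont_deriv: "C1_on a b g g' \<Longrightarrow> continuous_on {a..b} g'"
  unfolding C1_on_def by simp

lemma C1_on_integral:
  assumes "C1_on a b g g'" "a \<le> x" "x \<le> y" "y \<le> b"
  shows "(g' has_integral (g y - g x)) {x..y}"
proof (rule fundamental_theorem_of_calculus)
  fix t assume "t \<in> {x..y}"
  then have "(g has_real_derivative g' t) (at t within {a..b})"
    using assms unfolding C1_on_def by auto
  then show "(g has_vector_derivative g' t) (at t within {x..y})"
    unfolding has_real_derivative_iff_has_vector_derivative[symmetric]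
    by (rule DERIV_subset) (use assms in auto)
qed (use assms in auto)

lemma C1_on_const: "C1_on a b (\<lambda>_. c) (\<lambda>_. 0)"
  unfolding C1_on_def by auto

lemma C1_on_cmult:
  assumes "C1_on a b g g'"
  shows "C1_on a b (\<lambda>x. c * g x) (\<lambda>x. c * g' x)"
  using assms unfolding C1_on_def by (simp add: DERIV_cmult continuous_on_mult_left)

lemma C1_on_add:
  assumes "C1_on a b g g'" "C1_on a b h h'"
  shows "C1_on a b (\<lambda>x. g x + h x) (\<lambda>x. g' x + h' x)"
  using assms unfolding C1_on_def by (simp add: DERIV_add continuous_on_add)

lemma C1_on_mult:
  assumes "C1_on a b g g'" "C1_on a b h h'"
  shows "C1_on a b (\<lambda>x. g x * h x) (\<lambda>x. g x * h' x + g' x * h x)"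
  unfolding C1_on_def
proof (intro conjI ballI)
  show "continuous_on {a..b} (\<lambda>x. g x * h' x + g' x * h x)"
    by (intro continuous_on_add continuous_on_mult C1_on_continuous[OF assms(1)]
      C1_on_continuous[OF assms(2)] C1_on_cont_deriv[OF assms(1)] C1_on_cont_deriv[OF assms(2)])
  fix x assume "x \<in> {a..b}"
  then show "((\<lambda>x. g x * h x) has_real_derivative g x * h' x + g' x * h x) (at x within {a..b})"
    using assms unfolding C1_on_def by (intro DERIV_mult') auto
qed

lemma C1_on_indefinite_integral:
  assumes "continuous_on {a..b} h"
  shows "C1_on a b (\<lambda>x. c + integral {a..x} h) h"
  unfolding C1_on_def
proof (intro conjI ballI)
  fix x assume x: "x \<in> {a..b}"
  show "((\<lambda>x. c + integral {a..x} h) has_real_derivative h x) (at x within {a..b})"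
    using DERIV_add[OF DERIV_const integral_has_real_derivative[OF assms x], of c] by simp
qed fact

lemma C1_on_by_parts:
  assumes "C1_on a b g g'" "C1_on a b h h'" "a \<le> b"
  shows "integral {a..b} (\<lambda>x. g' x * h x) = g b * h b - g a * h a - integral {a..b} (\<lambda>x. g x * h' x)"
proof -
  note c = assms(1)[THEN C1_on_continuous] assms(2)[THEN C1_on_continuous]
    assms(1)[THEN C1_on_cont_deriv] assms(2)[THEN C1_on_cont_deriv]
  have "((\<lambda>x. g x * h' x + g' x * h x) has_integral (g b * h b - g a * h a)) {a..b}"
    by (rule C1_on_integral[OF C1_on_mult[OF assms(1,2)]]) (use assms in auto)
  then have "integral {a..b} (\<lambda>x. g x * h' x + g' x * h x) = g b * h b - g a * h a"
    by (rule integral_unique)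
  moreover have "(\<lambda>x. g' x * h x) integrable_on {a..b}" "(\<lambda>x. g x * h' x) integrable_on {a..b}"
    by (intro integrable_continuous_interval continuous_on_mult c)+
  ultimately show ?thesis
    by (simp add: integral_add)
qed

text \<open>P weighs the derivative and w the function. They are independent here;
  \<open>ultraspherical_functional\<close> ties them by \<open>P x = (1 - x\<^sup>2) * w x\<close>.
  Unit mass of w puts the constant 1 on the constraint sphere.\<close>

locale weighted_interval =
  fixes a b :: real and P w :: "real \<Rightarrow> real"
  assumes ab: "a < b"
    and cP: "continuous_on {a..b} P" and cw: "continuous_on {a..b} w"
    and P_pos: "\<And>x. x \<in> {a..b} \<Longrightarrow> 0 < P x" and w_pos: "\<And>x. x \<in> {a..b} \<Longrightarrow> 0 < w x"
    and w_int: "integral {a..b} w = 1"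
begin

lemma integrable_w:
  "continuous_on {a..b} h \<Longrightarrow> (\<lambda>x. w x * h x) integrable_on {a..b}"
  by (intro integrable_continuous_interval continuous_intros cw)

lemma integral_w_mono:
  assumes "continuous_on {a..b} g" "continuous_on {a..b} h" "\<And>x. x \<in> {a..b} \<Longrightarrow> g x \<le> h x"
  shows "integral {a..b} (\<lambda>x. w x * g x) \<le> integral {a..b} (\<lambda>x. w x * h x)"
  using assms w_pos by (intro integral_le integrable_w mult_left_mono) (auto intro: less_imp_le)

lemma integral_w_const: "integral {a..b} (\<lambda>x. w x * c) = c"
  using w_int by simp

lemma integral_w_nonneg:
  assumes "\<And>x. x \<in> {a..b} \<Longrightarrow> 0 \<le> g x" "continuous_on {a..b} g"
  shows "0 \<le> integral {a..b} (\<lambda>x. w x * g x)"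
  using integral_w_mono[of "\<lambda>_. 0" g] assms by simp

definition energy :: "(real \<Rightarrow> real) \<Rightarrow> real" where
  "energy g' = integral {a..b} (\<lambda>x. P x * (g' x)\<^sup>2)"

lemma energy_nonneg:
  assumes "continuous_on {a..b} g'"
  shows "0 \<le> energy g'"
  unfolding energy_def using P_pos
  by (intro integral_nonneg integrable_continuous_interval continuous_intros cP assms)
     (auto intro!: mult_nonneg_nonneg intro: less_imp_le)

text \<open>Cauchy-Schwarz, obtained from the integral of \<open>(g' - c)\<^sup>2\<close> with c the
  mean slope between the two points. As P has a positive minimum on the compact interval, the energy
  controls the Hoelder-1/2 modulus with one constant for all g.\<close>

lemma oscillation_bound:
  obtains C where "C > 0"
    "\<And>g g' x y. C1_on a b g g' \<Longrightarrow> x \<in> {a..b} \<Longrightarrow> y \<in> {a..b} \<Longrightarrow> (g x - g y)\<^sup>2 \<le> C * \<bar>x - y\<bar> * energy g'"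
proof -
  obtain z where z: "z \<in> {a..b}" "\<And>x. x \<in> {a..b} \<Longrightarrow> P z \<le> P x"
    using continuous_attains_inf[of "{a..b}" P] cP ab by auto
  have *: "(g x - g y)\<^sup>2 \<le> (1 / P z) * \<bar>x - y\<bar> * energy g'"
    if g: "C1_on a b g g'" and xy: "x \<in> {a..b}" "y \<in> {a..b}" "x < y" for g g' x y
  proof -
    define c where "c = (g y - g x) / (y - x)"
    have cg: "continuous_on {a..b} g'" using g by (rule C1_on_cont_deriv)
    have cgxy: "continuous_on {x..y} g'" by (rule continuous_on_subset[OF cg]) (use xy in auto)
    have i1: "(g' has_integral (g y - g x)) {x..y}"
      by (rule C1_on_integral[OF g]) (use xy in auto)
    have i2: "((\<lambda>t. (g' t)\<^sup>2) has_integral (integral {x..y} (\<lambda>t. (g' t)\<^sup>2))) {x..y}"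
      by (intro integrable_integral integrable_continuous_interval continuous_intros cgxy)
    have i3: "((\<lambda>t. (g' t)\<^sup>2 - (2 * c) * g' t + c\<^sup>2) has_integral
        (integral {x..y} (\<lambda>t. (g' t)\<^sup>2) - (2 * c) * (g y - g x) + c\<^sup>2 * (y - x))) {x..y}"
      using has_integral_add[OF has_integral_diff[OF i2 has_integral_mult_right[OF i1, of "2 * c"]]
        has_integral_const_real[of "c\<^sup>2" x y]] xy by (simp add: mult.commute)
    have "0 \<le> integral {x..y} (\<lambda>t. (g' t)\<^sup>2) - (2 * c) * (g y - g x) + c\<^sup>2 * (y - x)"
    proof (rule has_integral_nonneg[OF i3])
      fix t have "(g' t)\<^sup>2 - (2 * c) * g' t + c\<^sup>2 = (g' t - c)\<^sup>2" by (simp add: power2_eq_square algebra_simps)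
      then show "0 \<le> (g' t)\<^sup>2 - (2 * c) * g' t + c\<^sup>2" by simp
    qed
    moreover have "g y - g x = c * (y - x)" using xy by (simp add: c_def)
    ultimately have "c\<^sup>2 * (y - x) \<le> integral {x..y} (\<lambda>t. (g' t)\<^sup>2)"
      by (simp add: power2_eq_square algebra_simps)
    then have "c\<^sup>2 * (y - x) * (y - x) \<le> integral {x..y} (\<lambda>t. (g' t)\<^sup>2) * (y - x)"
      using xy by (intro mult_right_mono) auto
    moreover have "(g x - g y)\<^sup>2 = c\<^sup>2 * (y - x) * (y - x)"
      unfolding power2_commute[of "g x"] \<open>g y - g x = c * (y - x)\<close> by (simp add: power2_eq_square)
    ultimately have A: "(g x - g y)\<^sup>2 \<le> integral {x..y} (\<lambda>t. (g' t)\<^sup>2) * (y - x)" by simp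
    have "integral {x..y} (\<lambda>t. (g' t)\<^sup>2) \<le> integral {a..b} (\<lambda>t. (g' t)\<^sup>2)"
      by (rule integral_subset_le) (use xy in \<open>auto intro!: integrable_continuous_interval continuous_intros cg cgxy\<close>)
    also have "\<dots> \<le> integral {a..b} (\<lambda>t. (1 / P z) * (P t * (g' t)\<^sup>2))"
    proof (rule integral_le)
      fix t assume t: "t \<in> {a..b}"
      have "1 \<le> P t / P z" using z(2)[OF t] P_pos[OF z(1)] by simp
      then have "1 * (g' t)\<^sup>2 \<le> P t / P z * (g' t)\<^sup>2" by (rule mult_right_mono) simp
      then show "(g' t)\<^sup>2 \<le> (1 / P z) * (P t * (g' t)\<^sup>2)" by simp
    qed (intro integrable_continuous_interval continuous_intros cg cP)+
    also have "\<dots> = (1 / P z) * energy g'" unfolding energy_def by simp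
    finally have "integral {x..y} (\<lambda>t. (g' t)\<^sup>2) * (y - x) \<le> (1 / P z) * energy g' * (y - x)"
      using xy by (intro mult_right_mono) auto
    with A show ?thesis using xy by (simp add: algebra_simps)
  qed
  show ?thesis
  proof
    show "1 / P z > 0" using P_pos[OF z(1)] by simp
    fix g g' x y assume g: "C1_on a b g g'" "x \<in> {a..b}" "y \<in> {a..b}"
    then show "(g x - g y)\<^sup>2 \<le> (1 / P z) * \<bar>x - y\<bar> * energy g'"
      using *[of g g' x y] *[of g g' y x]
      by (cases x y rule: linorder_cases) (auto simp: power2_commute abs_minus_commute)
  qed
qed

lemma integral_w_compose_tendsto:
  fixes h :: "real \<Rightarrow> real"
  assumes "\<And>j. continuous_on {a..b} (g j)" "\<And>j x. x \<in> {a..b} \<Longrightarrow> \<bar>g j x\<bar> \<le> M"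
    "\<And>x. x \<in> {a..b} \<Longrightarrow> (\<lambda>j. g j x) \<longlonglongrightarrow> f x" "continuous_on UNIV h"
  shows "(\<lambda>j. integral {a..b} (\<lambda>x. w x * h (g j x))) \<longlonglongrightarrow> integral {a..b} (\<lambda>x. w x * h (f x))"
proof -
  have "compact (h ` {-M..M})"
    by (intro compact_continuous_image continuous_on_subset[OF assms(4)]) auto
  then obtain K where K: "\<And>y. y \<in> {-M..M} \<Longrightarrow> \<bar>h y\<bar> \<le> K"
    using compact_imp_bounded[of "h ` {-M..M}"] unfolding bounded_iff
    by (metis image_eqI real_norm_def)
  show ?thesis
  proof (rule dominated_convergence(2)[where h = "\<lambda>x. w x * K"])
    fix j show "(\<lambda>x. w x * h (g j x)) integrable_on {a..b}"
      by (intro integrable_w continuous_on_compose2[OF assms(4) assms(1)]) auto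
  next
    show "(\<lambda>x. w x * K) integrable_on {a..b}" by (intro integrable_w continuous_intros)
  next
    fix j x assume x: "x \<in> {a..b}"
    have "\<bar>h (g j x)\<bar> \<le> K" using assms(2)[OF x, of j] by (intro K) auto
    then show "norm (w x * h (g j x)) \<le> w x * K"
      using w_pos[OF x] by (simp add: abs_mult)
  next
    fix x assume x: "x \<in> {a..b}"
    have "isCont h (f x)" using assms(4) by (simp add: continuous_on_eq_continuous_at)
    then show "(\<lambda>j. w x * h (g j x)) \<longlonglongrightarrow> w x * h (f x)"
      by (intro tendsto_mult tendsto_const isCont_tendsto_compose[OF _ assms(3)[OF x]])
  qed
qed

lemma integral_w_perturbation_derivative:
  fixes h h' :: "real \<Rightarrow> real"
  assumes f: "continuous_on {a..b} f" "continuous_on {a..b} \<phi>"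
    and h: "\<And>y. (h has_real_derivative h' y) (at y)" "continuous_on UNIV h'"
  shows "((\<lambda>t. integral {a..b} (\<lambda>x. w x * h (f x + t * \<phi> x))) has_real_derivative
           integral {a..b} (\<lambda>x. w x * (h' (f x) * \<phi> x))) (at 0)"
proof -
  have ch: "continuous_on UNIV h" using h(1) by (auto simp: continuous_on_eq_continuous_at intro: DERIV_isCont)
  have "((\<lambda>t. integral (cbox a b) (\<lambda>x. w x * h (f x + t * \<phi> x))) has_real_derivative
           integral (cbox a b) (\<lambda>x. w x * (h' (f x + 0 * \<phi> x) * \<phi> x))) (at 0 within UNIV)"
  proof (rule leibniz_rule_field_derivative)
    fix t x :: real
    show "((\<lambda>t. w x * h (f x + t * \<phi> x)) has_real_derivative w x * (h' (f x + t * \<phi> x) * \<phi> x)) (at t within UNIV)"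
      by (auto intro!: derivative_eq_intros DERIV_chain'[OF _ h(1)])
  next
    fix t :: real
    show "(\<lambda>x. w x * h (f x + t * \<phi> x)) integrable_on cbox a b"
      unfolding cbox_interval
      by (intro integrable_w continuous_on_compose2[OF ch] continuous_intros f) auto
  next
    have s: "snd ` (UNIV \<times> {a..b}) \<subseteq> {a..b}" by auto
    note cs = continuous_on_compose2[OF _ continuous_on_snd[OF continuous_on_id] s]
    have "continuous_on (UNIV \<times> {a..b}) (\<lambda>z. w (snd z) * (h' (f (snd z) + fst z * \<phi> (snd z)) * \<phi> (snd z)))"
      by (intro continuous_intros continuous_on_compose2[OF h(2)] cs[OF f(1)] cs[OF f(2)] cs[OF cw]) auto
    then show "continuous_on (UNIV \<times> cbox a b) (\<lambda>(t, x). w x * (h' (f x + t * \<phi> x) * \<phi> x))"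
      by (simp add: case_prod_beta)
  qed auto
  then show ?thesis by simp
qed

end

text \<open>In the application k = n / (p - 2) is negative for p < 2. Then the quadratic term pulls
  the functional down and has to be estimated by \<open>pmass\<close> and the energy, which works
  for p \<le> 2; \<open>kp\<close> records this.\<close>

locale interpolation_functional = weighted_interval +
  fixes k p e :: real
  assumes p_gt: "1 < p" and e_pos: "0 < e" and kp: "0 \<le> k \<or> p \<le> 2"
begin

text \<open>The negative part has the coefficient 1 instead of k, since negative values must be
  penalized also when k < 0. Cutting the mean off at 0 gives the perturbation a definite sign in the
  Euler-Lagrange equation, and the square of a positive part is still differentiable.\<close>

definition lower_part :: "(real \<Rightarrow> real) \<Rightarrow> real" where
  "lower_part g = k * integral {a..b} (\<lambda>x. w x * (max (g x) 0)\<^sup>2)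
     + integral {a..b} (\<lambda>x. w x * (max (- g x) 0)\<^sup>2)
     - e * (max (integral {a..b} (\<lambda>x. w x * g x)) 0)\<^sup>2"

definition pmass :: "(real \<Rightarrow> real) \<Rightarrow> real" where
  "pmass g = integral {a..b} (\<lambda>x. w x * max (g x) 0 powr p)"

definition functional :: "(real \<Rightarrow> real) \<Rightarrow> (real \<Rightarrow> real) \<Rightarrow> real" where
  "functional g g' = energy g' + lower_part g"

definition values_on_sphere :: "real set" where
  "values_on_sphere = {functional g g' |g g'. C1_on a b g g' \<and> pmass g = 1}"

lemma integral_w_cmult: "integral {a..b} (\<lambda>x. w x * (c * h x)) = c * integral {a..b} (\<lambda>x. w x * h x)"
proof -
  have "(\<lambda>x. w x * (c * h x)) = (\<lambda>x. c * (w x * h x))" by (simp add: mult.left_commute)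
  then show ?thesis by simp
qed

lemma continuous_on_pos_powr_p:
  "continuous_on {a..b} g \<Longrightarrow> continuous_on {a..b} (\<lambda>x. max (g x) 0 powr p)"
  using p_gt by (intro continuous_on_pos_powr) auto

text \<open>The weight has mass one, so the constraint prevents g from staying on one side of 1; the
  numbers 1/2 and 2 are any two values around 1. These points turn the oscillation bound into a sup
  bound.\<close>

lemma sphere_upper_lower_point:
  assumes g: "continuous_on {a..b} g" and N: "pmass g = 1"
  shows "\<exists>x\<in>{a..b}. 1/2 \<le> g x" "\<exists>x\<in>{a..b}. g x \<le> 2"
proof -
  show "\<exists>x\<in>{a..b}. 1/2 \<le> g x"
  proof (rule ccontr)
    assume "\<not> ?thesis"
    then have *: "\<And>x. x \<in> {a..b} \<Longrightarrow> max (g x) 0 \<le> 1/2" by force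
    have "pmass g \<le> integral {a..b} (\<lambda>x. w x * (1/2) powr p)"
      unfolding pmass_def using * p_gt
      by (intro integral_w_mono continuous_on_pos_powr_p g continuous_intros powr_mono2) auto
    also have "\<dots> = (1/2) powr p" by (rule integral_w_const)
    also have "\<dots> < 1 powr p" using p_gt by (intro powr_less_mono2) auto
    finally show False using N by simp
  qed
  show "\<exists>x\<in>{a..b}. g x \<le> 2"
  proof (rule ccontr)
    assume "\<not> ?thesis"
    then have *: "\<And>x. x \<in> {a..b} \<Longrightarrow> 2 \<le> max (g x) 0" by force
    have "1 powr p < 2 powr p" using p_gt by (intro powr_less_mono2) auto
    also have "\<dots> = integral {a..b} (\<lambda>x. w x * 2 powr p)" by (rule integral_w_const[symmetric])
    also have "\<dots> \<le> pmass g"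
      unfolding pmass_def using * p_gt
      by (intro integral_w_mono continuous_on_pos_powr_p g continuous_intros powr_mono2) auto
    finally show False using N by simp
  qed
qed

text \<open>Coercivity, together with the estimates required for Arzela-Ascoli. Half of the energy
  is spent when k < 0: there the quadratic term is at most of the order of the sup bound, thus of
  the square root of the energy, and is absorbed.\<close>

lemma sphere_bounds:
  obtains C K where "C > 0"
    "\<And>g g'. C1_on a b g g' \<Longrightarrow> pmass g = 1 \<Longrightarrow> energy g' / 2 - K \<le> functional g g'"
    "\<And>g g' x. C1_on a b g g' \<Longrightarrow> pmass g = 1 \<Longrightarrow> x \<in> {a..b} \<Longrightarrow> \<bar>g x\<bar> \<le> 2 + sqrt (C * energy g')"
    "\<And>g g' x y. C1_on a b g g' \<Longrightarrow> x \<in> {a..b} \<Longrightarrow> y \<in> {a..b} \<Longrightarrow> (g x - g y)\<^sup>2 \<le> C * \<bar>x - y\<bar> * energy g'"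
proof -
  obtain C where C: "C > 0"
    "\<And>g g' x y. C1_on a b g g' \<Longrightarrow> x \<in> {a..b} \<Longrightarrow> y \<in> {a..b} \<Longrightarrow> (g x - g y)\<^sup>2 \<le> C * \<bar>x - y\<bar> * energy g'"
    using oscillation_bound by blast
  \<comment> \<open>One constant for both estimates: it dominates
    \<open>C * \<bar>x - y\<bar>\<close> on the interval and, thanks to the + 1, also C
    itself.\<close>
  define D where "D = C * (b - a + 1)"
  have D: "D > 0" "C \<le> D" using C(1) ab by (auto simp: D_def)
  have En: "0 \<le> energy g'" if "C1_on a b g g'" for g g'
    using energy_nonneg C1_on_cont_deriv[OF that] by blast
  have osc: "\<bar>g x - g y\<bar> \<le> sqrt (D * energy g')"
    if g: "C1_on a b g g'" "x \<in> {a..b}" "y \<in> {a..b}" for g g' x y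
  proof (rule real_le_rsqrt)
    have "\<bar>x - y\<bar> \<le> b - a + 1" using g by auto
    then have "C * \<bar>x - y\<bar> * energy g' \<le> D * energy g'"
      unfolding D_def using C(1) En[OF g(1)] by (intro mult_right_mono mult_left_mono) auto
    then show "\<bar>g x - g y\<bar>\<^sup>2 \<le> D * energy g'" using C(2)[OF g] by simp
  qed
  have bnd: "\<bar>g x\<bar> \<le> 2 + sqrt (D * energy g')"
    if g: "C1_on a b g g'" "pmass g = 1" "x \<in> {a..b}" for g g' x
  proof -
    obtain y z where "y \<in> {a..b}" "1/2 \<le> g y" "z \<in> {a..b}" "g z \<le> 2"
      using sphere_upper_lower_point[OF C1_on_continuous[OF g(1)] g(2)] by blast
    then show ?thesis using osc[OF g(1) g(3), of y] osc[OF g(1) g(3), of z] by linarith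
  qed
  \<comment> \<open>The summands with k come from \<open>\<bar>k\<bar> * (2 + S)\<close> after
    Young's inequality. The summand \<open>4 * e\<close> comes from a mean of at most 2, which
    follows from \<open>g x \<le> 1 + max (g x) 0 powr p\<close>.\<close>
  define K where "K = 2 * \<bar>k\<bar> + 4 * e + k\<^sup>2 * D / 2"
  have low: "energy g' / 2 - K \<le> functional g g'" if g: "C1_on a b g g'" "pmass g = 1" for g g'
  proof -
    note cg = C1_on_continuous[OF g(1)]
    define S where "S = sqrt (D * energy g')"
    have S0: "0 \<le> S" using D En[OF g(1)] by (simp add: S_def)
    have A: "- \<bar>k\<bar> * (2 + S) \<le> k * integral {a..b} (\<lambda>x. w x * (max (g x) 0)\<^sup>2)"
    proof (cases "0 \<le> k")
      case True
      have "0 \<le> integral {a..b} (\<lambda>x. w x * (max (g x) 0)\<^sup>2)"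
        by (intro integral_w_nonneg continuous_intros cg) auto
      then have "0 \<le> k * integral {a..b} (\<lambda>x. w x * (max (g x) 0)\<^sup>2)" using True by simp
      moreover have "0 \<le> \<bar>k\<bar> * (2 + S)" using S0 by simp
      ultimately show ?thesis by linarith
    next
      case False
      then have p2: "p \<le> 2" using kp by auto
      have "integral {a..b} (\<lambda>x. w x * (max (g x) 0)\<^sup>2)
        \<le> integral {a..b} (\<lambda>x. w x * ((2 + S) * max (g x) 0 powr p))"
      proof (rule integral_w_mono)
        fix x assume x: "x \<in> {a..b}"
        show "(max (g x) 0)\<^sup>2 \<le> (2 + S) * max (g x) 0 powr p"
        proof (cases "0 < g x")
          case True
          have "(max (g x) 0)\<^sup>2 = g x powr 2" using True by (simp add: powr_numeral)
          also have "\<dots> = g x powr (2 - p) * g x powr p" by (simp add: powr_add[symmetric])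
          also have "\<dots> \<le> (2 + S) * g x powr p"
          proof (rule mult_right_mono)
            have "g x powr (2 - p) \<le> (2 + S) powr (2 - p)"
              using bnd[OF g x] True p2 by (intro powr_mono2) (auto simp: S_def)
            also have "\<dots> \<le> (2 + S) powr 1" using p_gt S0 by (intro powr_mono) auto
            finally show "g x powr (2 - p) \<le> 2 + S" using S0 by simp
          qed simp
          finally show ?thesis using True by simp
        qed auto
      qed (intro continuous_intros cg continuous_on_pos_powr_p)+
      also have "\<dots> = (2 + S) * pmass g"
        unfolding pmass_def
        using integral_mult_right[of "{a..b}" "2 + S" "\<lambda>x. w x * max (g x) 0 powr p"]
        by (simp add: mult.left_commute mult.assoc)
      finally have "integral {a..b} (\<lambda>x. w x * (max (g x) 0)\<^sup>2) \<le> 2 + S" using g(2) by simp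
      then show ?thesis using False by (simp add: mult_left_mono_neg)
    qed
    have B: "0 \<le> integral {a..b} (\<lambda>x. w x * (max (- g x) 0)\<^sup>2)"
      by (intro integral_w_nonneg continuous_intros cg) auto
    have "integral {a..b} (\<lambda>x. w x * g x) \<le> integral {a..b} (\<lambda>x. w x * (1 + max (g x) 0 powr p))"
    proof (rule integral_w_mono)
      fix x
      show "g x \<le> 1 + max (g x) 0 powr p"
      proof (cases "1 \<le> g x")
        case True
        then have "g x powr 1 \<le> g x powr p" using p_gt by (intro powr_mono) auto
        then show ?thesis using True by simp
      qed (use powr_ge_zero[of "max (g x) 0" p] in linarith)
    qed (intro continuous_intros cg continuous_on_pos_powr_p)+
    also have "\<dots> = 1 + pmass g"
      unfolding pmass_def using w_int
        integral_add[OF integrable_continuous_interval[OF cw] integrable_w[OF continuous_on_pos_powr_p[OF cg]]]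
      by (simp add: distrib_left)
    finally have "max (integral {a..b} (\<lambda>x. w x * g x)) 0 \<le> 2" using g(2) by simp
    then have "(max (integral {a..b} (\<lambda>x. w x * g x)) 0)\<^sup>2 \<le> 2\<^sup>2" by (intro power_mono) auto
    then have m: "e * (max (integral {a..b} (\<lambda>x. w x * g x)) 0)\<^sup>2 \<le> e * 4"
      using e_pos by (intro mult_left_mono) auto
    have "S\<^sup>2 = D * energy g'" using D En[OF g(1)] by (simp add: S_def)
    \<comment> \<open>Young's inequality for \<open>\<bar>k\<bar> * S\<close>, scaled so that
      \<open>S\<^sup>2 / D\<close> is exactly the energy.\<close>
    moreover have "0 \<le> (S / sqrt D - \<bar>k\<bar> * sqrt D)\<^sup>2" by simp
    moreover have "(S / sqrt D - \<bar>k\<bar> * sqrt D)\<^sup>2 = S\<^sup>2 / D - 2 * \<bar>k\<bar> * S + k\<^sup>2 * D"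
      using D by (simp add: power2_diff power_divide power_mult_distrib)
    ultimately have "2 * (\<bar>k\<bar> * S) \<le> energy g' + k\<^sup>2 * D" using D by simp
    moreover have "- \<bar>k\<bar> * (2 + S) = - 2 * \<bar>k\<bar> - \<bar>k\<bar> * S" by (simp add: algebra_simps)
    ultimately show ?thesis using A B m unfolding functional_def lower_part_def K_def by linarith
  qed
  have osc2: "(g x - g y)\<^sup>2 \<le> D * \<bar>x - y\<bar> * energy g'"
    if g: "C1_on a b g g'" "x \<in> {a..b}" "y \<in> {a..b}" for g g' x y
  proof -
    have "C * \<bar>x - y\<bar> * energy g' \<le> D * \<bar>x - y\<bar> * energy g'"
      using D En[OF g(1)] by (intro mult_right_mono) auto
    then show ?thesis using C(2)[OF g] by linarith
  qed
  show ?thesis by (rule that[of D K]) (fact D(1) low bnd osc2)+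
qed

lemma values_on_sphere_nonempty: "values_on_sphere \<noteq> {}"
proof -
  have "pmass (\<lambda>_. 1) = 1" unfolding pmass_def using w_int by simp
  then show ?thesis unfolding values_on_sphere_def using C1_on_const[of a b 1] by blast
qed

lemma values_on_sphere_bdd: "bdd_below values_on_sphere"
proof -
  show ?thesis
  proof (rule sphere_bounds)
    fix C K
    assume K: "\<And>g g'. C1_on a b g g' \<Longrightarrow> pmass g = 1 \<Longrightarrow> energy g' / 2 - K \<le> functional g g'"
    show ?thesis
    proof (rule bdd_belowI)
      fix y assume "y \<in> values_on_sphere"
      then obtain g g' where g: "C1_on a b g g'" "pmass g = 1" "y = functional g g'"
        unfolding values_on_sphere_def by blast
      show "- K \<le> y" using K[OF g(1,2)] energy_nonneg[OF C1_on_cont_deriv[OF g(1)]] g(3) by simp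
    qed
  qed
qed

text \<open>Every term is homogeneous of degree 2 under positive scaling, so g can be rescaled to
  the sphere. The resulting inequality holds without the constraint, and variations need no
  correction to stay on the sphere.\<close>

lemma functional_ge_Inf:
  assumes g: "C1_on a b g g'" and N: "0 < pmass g"
  shows "Inf values_on_sphere * pmass g powr (2 / p) \<le> functional g g'"
proof -
  define s where "s = pmass g powr (- 1 / p)"
  have s: "s > 0" using N by (simp add: s_def)
  have mx: "max (s * y) 0 = s * max y 0" for y using s by (auto simp: max_def mult_le_0_iff zero_le_mult_iff)
  have "pmass (\<lambda>x. s * g x) = s powr p * pmass g"
    unfolding pmass_def mx using s
    by (simp add: powr_mult integral_w_cmult)
  also have "s powr p = pmass g powr (-1)" using p_gt unfolding s_def by (simp add: powr_powr)
  also have "pmass g powr (-1) * pmass g = 1" using N by (simp add: powr_minus)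
  finally have N1: "pmass (\<lambda>x. s * g x) = 1" .
  have "lower_part (\<lambda>x. s * g x) = s\<^sup>2 * lower_part g"
    unfolding lower_part_def minus_mult_right mx power_mult_distrib integral_w_cmult
    by (simp add: power_mult_distrib algebra_simps)
  moreover have "energy (\<lambda>x. s * g' x) = s\<^sup>2 * energy g'"
    unfolding energy_def power_mult_distrib mult.left_commute[of _ "s\<^sup>2"] by simp
  ultimately have "functional (\<lambda>x. s * g x) (\<lambda>x. s * g' x) = s\<^sup>2 * functional g g'"
    unfolding functional_def by (simp add: distrib_left)
  moreover have "functional (\<lambda>x. s * g x) (\<lambda>x. s * g' x) \<in> values_on_sphere"
    unfolding values_on_sphere_def using C1_on_cmult[OF g, of s] N1 by blast
  ultimately have "Inf values_on_sphere \<le> s\<^sup>2 * functional g g'"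
    using values_on_sphere_bdd cInf_lower by metis
  moreover have "s\<^sup>2 * pmass g powr (2 / p) = 1"
  proof -
    have "s\<^sup>2 = s powr 2" using s by (simp add: powr_numeral)
    also have "\<dots> = pmass g powr (- 2 / p)" unfolding s_def by (simp add: powr_powr)
    finally show ?thesis using N by (simp add: powr_add[symmetric])
  qed
  ultimately have "Inf values_on_sphere * pmass g powr (2 / p) \<le> (s\<^sup>2 * functional g g') * pmass g powr (2 / p)"
    by (intro mult_right_mono) auto
  also have "\<dots> = (s\<^sup>2 * pmass g powr (2 / p)) * functional g g'" by (simp only: mult_ac)
  finally show ?thesis using \<open>s\<^sup>2 * pmass g powr (2 / p) = 1\<close> by simp
qed

text \<open>Half the first variation of \<open>lower_part\<close> minus the infimum times
  \<open>pmass powr (2 / p)\<close>, taken at \<open>pmass f = 1\<close> and divided by w. The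
  infimum plays the part of the Lagrange multiplier.\<close>

definition euler_term :: "(real \<Rightarrow> real) \<Rightarrow> real \<Rightarrow> real" where
  "euler_term f x = k * max (f x) 0 - max (- f x) 0
     - Inf values_on_sphere * max (f x) 0 powr (p - 1) - e * max (integral {a..b} (\<lambda>x. w x * f x)) 0"

text \<open>Coercivity bounds the energies, hence the sequence is bounded and equi-Hoelder, and
  Arzela-Ascoli applies. Nothing is said about the limit of the derivatives; the next existence
  proof is arranged to avoid them.\<close>

lemma minimizing_sequence:
  obtains g g' f R where "\<And>j::nat. C1_on a b (g j) (g' j)" "\<And>j. pmass (g j) = 1"
    "(\<lambda>j. functional (g j) (g' j)) \<longlonglongrightarrow> Inf values_on_sphere"
    "\<And>j x. x \<in> {a..b} \<Longrightarrow> \<bar>g j x\<bar> \<le> R"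
    "continuous_on {a..b} f" "\<And>x. x \<in> {a..b} \<Longrightarrow> (\<lambda>j. g j x) \<longlonglongrightarrow> f x"
proof (rule sphere_bounds)
  fix C K
  assume C: "C > 0"
    and K: "\<And>g g'. C1_on a b g g' \<Longrightarrow> pmass g = 1 \<Longrightarrow> energy g' / 2 - K \<le> functional g g'"
    and bnd: "\<And>g g' x. C1_on a b g g' \<Longrightarrow> pmass g = 1 \<Longrightarrow> x \<in> {a..b} \<Longrightarrow> \<bar>g x\<bar> \<le> 2 + sqrt (C * energy g')"
    and osc: "\<And>g g' x y. C1_on a b g g' \<Longrightarrow> x \<in> {a..b} \<Longrightarrow> y \<in> {a..b} \<Longrightarrow> (g x - g y)\<^sup>2 \<le> C * \<bar>x - y\<bar> * energy g'"
  let ?I = "Inf values_on_sphere"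
  have "\<exists>g g'. C1_on a b g g' \<and> pmass g = 1 \<and> functional g g' < ?I + 1 / (real j + 1)" for j :: nat
  proof -
    have "?I < ?I + 1 / (real j + 1)" by simp
    then obtain y where "y \<in> values_on_sphere" "y < ?I + 1 / (real j + 1)"
      using cInf_lessD[OF values_on_sphere_nonempty] by blast
    then show ?thesis unfolding values_on_sphere_def by blast
  qed
  then obtain g g' where g: "\<And>j::nat. C1_on a b (g j) (g' j)" "\<And>j. pmass (g j) = 1"
      "\<And>j. functional (g j) (g' j) < ?I + 1 / (real j + 1)"
    by metis
  have ge: "?I \<le> functional (g j) (g' j)" for j
    using g values_on_sphere_bdd by (intro cInf_lower) (auto simp: values_on_sphere_def)
  define M where "M = 2 * (?I + 1 + K)"
  have En0: "0 \<le> energy (g' j)" for j using energy_nonneg[OF C1_on_cont_deriv[OF g(1)]] .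
  have En: "energy (g' j) \<le> M" for j
  proof -
    have "functional (g j) (g' j) < ?I + 1 / (real j + 1)" by (rule g(3))
    also have "\<dots> \<le> ?I + 1" by simp
    finally have "functional (g j) (g' j) < ?I + 1" .
    then have "energy (g' j) / 2 - K < ?I + 1" using K[OF g(1,2), of j] by linarith
    then show ?thesis unfolding M_def by (simp add: field_simps)
  qed
  have M0: "0 \<le> M" using En[of 0] En0[of 0] by linarith
  define R where "R = 2 + sqrt (C * M)"
  have R: "\<bar>g j x\<bar> \<le> R" if "x \<in> {a..b}" for j x
  proof -
    have "sqrt (C * energy (g' j)) \<le> sqrt (C * M)" using C En[of j] by simp
    then show ?thesis using bnd[OF g(1,2) that, of j] unfolding R_def by linarith
  qed
  have equi: "\<exists>d>0. \<forall>n y. y \<in> {a..b} \<and> norm (x - y) < d \<longrightarrow> norm (g n x - g n y) < \<epsilon>"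
    if x: "x \<in> {a..b}" "0 < \<epsilon>" for x \<epsilon>
  proof (intro exI conjI allI impI)
    \<comment> \<open>The + 1 keeps the denominator positive when M = 0.\<close>
    have CM: "0 < C * M + 1" using C M0 by (intro add_nonneg_pos mult_nonneg_nonneg) auto
    show "0 < \<epsilon>\<^sup>2 / (C * M + 1)" using CM x by simp
    fix n y assume y: "y \<in> {a..b} \<and> norm (x - y) < \<epsilon>\<^sup>2 / (C * M + 1)"
    have "(g n x - g n y)\<^sup>2 \<le> C * \<bar>x - y\<bar> * energy (g' n)" using osc[OF g(1)] x y by auto
    also have "\<dots> \<le> C * \<bar>x - y\<bar> * M" using C En[of n] by (intro mult_left_mono) auto
    also have "\<dots> \<le> (C * M + 1) * \<bar>x - y\<bar>" by (simp add: algebra_simps)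
    also have "\<dots> < \<epsilon>\<^sup>2" using y CM by (simp add: field_simps)
    finally have "(norm (g n x - g n y))\<^sup>2 < \<epsilon>\<^sup>2" by simp
    from power2_less_imp_less[OF this less_imp_le[OF x(2)]]
    show "norm (g n x - g n y) < \<epsilon>" .
  qed
  have R': "norm (g n x) \<le> R" if "x \<in> {a..b}" for n x using R[OF that] by simp
  show thesis
  proof (rule Arzela_Ascoli[of "{a..b}" g R, OF compact_Icc R' equi])
    fix f r
    assume f: "continuous_on {a..b} f" and r: "strict_mono (r :: nat \<Rightarrow> nat)"
      and u: "\<And>\<epsilon>. 0 < \<epsilon> \<Longrightarrow> \<exists>N. \<forall>n x. n \<ge> N \<and> x \<in> {a..b} \<longrightarrow> norm (g (r n) x - f x) < \<epsilon>"
    show thesis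
    proof (rule that[of "\<lambda>j. g (r j)" "\<lambda>j. g' (r j)" R f])
      show "(\<lambda>j. functional (g (r j)) (g' (r j))) \<longlonglongrightarrow> ?I"
      proof (rule tendsto_sandwich[where f = "\<lambda>_. ?I" and h = "\<lambda>j. ?I + 1 / (real (r j) + 1)"])
        show "\<forall>\<^sub>F j in sequentially. functional (g (r j)) (g' (r j)) \<le> ?I + 1 / (real (r j) + 1)"
          by (intro always_eventually allI less_imp_le g(3))
        have "(\<lambda>j. ?I + 1 / (real j + 1)) \<longlonglongrightarrow> ?I + 0"
          using LIMSEQ_inverse_real_of_nat by (intro tendsto_intros) (simp add: inverse_eq_divide add.commute)
        from LIMSEQ_subseq_LIMSEQ[OF this r]
        show "(\<lambda>j. ?I + 1 / (real (r j) + 1)) \<longlonglongrightarrow> ?I" by (simp add: o_def)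
      qed (simp_all add: ge)
      fix x assume "x \<in> {a..b}"
      then show "(\<lambda>j. g (r j) x) \<longlonglongrightarrow> f x" unfolding LIMSEQ_iff using u by blast
    qed (use g R f in auto)
  qed auto
qed

lemma quadratic_perturbation_derivative:
  fixes A1 A2 A3 A4 :: "real \<Rightarrow> real"
  assumes "(A1 has_real_derivative d1) (at 0)" "(A2 has_real_derivative d2) (at 0)"
    "(A3 has_real_derivative d3) (at 0)" "(A4 has_real_derivative d4) (at 0)"
  shows "((\<lambda>t. c0 + 2 * t * l + t\<^sup>2 * E + (k1 * A1 t + A2 t - k3 * A3 t) - k4 * A4 t)
    has_real_derivative (2 * l + (k1 * d1 + d2 - k3 * d3) - k4 * d4)) (at 0)"
proof -
  have "((\<lambda>t. c0 + 2 * t * l + t\<^sup>2 * E) has_real_derivative 2 * l) (at 0)"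
    by (auto intro!: derivative_eq_intros)
  from DERIV_diff[OF DERIV_add[OF this DERIV_diff[OF DERIV_add[OF DERIV_cmult[OF assms(1)] assms(2)]
      DERIV_cmult[OF assms(3)]]] DERIV_cmult[OF assms(4)]]
  show ?thesis .
qed

text \<open>The limit f is only known to be continuous, so the variation is performed on the
  minimizing sequence. Test functions are chosen with flux P \<phi>' = \<psi> of class C^1: the
  cross term \<open>P * g' * \<phi>' = g' * \<psi>\<close> is then integrated by parts, only values
  of g remain, and the limit can be taken. The identity obtained is the very weak form of (P f')' =
  w \<open>euler_term f\<close>.\<close>

lemma minimizer_exists:
  obtains f where "continuous_on {a..b} f" "pmass f = 1" "lower_part f \<le> Inf values_on_sphere"
    "\<And>\<psi> \<psi>' \<phi>. C1_on a b \<psi> \<psi>' \<Longrightarrow> C1_on a b \<phi> (\<lambda>x. \<psi> x / P x) \<Longrightarrow>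
       f b * \<psi> b - f a * \<psi> a - integral {a..b} (\<lambda>x. f x * \<psi>' x)
         + integral {a..b} (\<lambda>x. w x * (euler_term f x * \<phi> x)) = 0"
proof (rule minimizing_sequence)
  fix g g' f R
  let ?I = "Inf values_on_sphere"
  assume g: "\<And>j::nat. C1_on a b (g j) (g' j)" "\<And>j. pmass (g j) = 1"
    and lim: "(\<lambda>j. functional (g j) (g' j)) \<longlonglongrightarrow> ?I"
    and R: "\<And>j x. x \<in> {a..b} \<Longrightarrow> \<bar>g j x\<bar> \<le> R"
    and cf: "continuous_on {a..b} f" and gf: "\<And>x. x \<in> {a..b} \<Longrightarrow> (\<lambda>j. g j x) \<longlonglongrightarrow> f x"
  note cg = C1_on_continuous[OF g(1)] and cg' = C1_on_cont_deriv[OF g(1)]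
  define H where "H \<phi> t x = f x + t * \<phi> x" for \<phi> t x
  define D where "D j \<phi> t x = g j x + t * \<phi> x" for j \<phi> t x
  have conv: "(\<lambda>j. integral {a..b} (\<lambda>x. w x * h (D j \<phi> t x))) \<longlonglongrightarrow> integral {a..b} (\<lambda>x. w x * h (H \<phi> t x))"
    if \<phi>: "continuous_on {a..b} \<phi>" and h: "continuous_on UNIV h" for h :: "real \<Rightarrow> real" and \<phi> t
  proof -
    obtain B where B: "\<And>x. x \<in> {a..b} \<Longrightarrow> \<bar>\<phi> x\<bar> \<le> B"
    proof -
      have "bounded (\<phi> ` {a..b})"
        by (intro compact_imp_bounded compact_continuous_image \<phi> compact_Icc)
      then obtain B where "\<forall>y\<in>\<phi> ` {a..b}. norm y \<le> B" unfolding bounded_iff by blast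
      then show thesis by (intro that[of B]) auto
    qed
    show ?thesis
    proof (rule integral_w_compose_tendsto[OF _ _ _ h])
      show "continuous_on {a..b} (D j \<phi> t)" for j
        unfolding D_def by (intro continuous_intros cg \<phi>)
      show "\<bar>D j \<phi> t x\<bar> \<le> R + \<bar>t\<bar> * B" if "x \<in> {a..b}" for j x
      proof -
        have "\<bar>t * \<phi> x\<bar> \<le> \<bar>t\<bar> * B" unfolding abs_mult using B[OF that] by (intro mult_left_mono) auto
        then show ?thesis unfolding D_def using R[OF that, of j] by linarith
      qed
      show "(\<lambda>j. D j \<phi> t x) \<longlonglongrightarrow> H \<phi> t x" if "x \<in> {a..b}" for x
        unfolding D_def H_def by (intro tendsto_intros gf that)
    qed
  qed
  have hs: "continuous_on UNIV (\<lambda>y::real. (max y 0)\<^sup>2)" "continuous_on UNIV (\<lambda>y::real. (max (- y) 0)\<^sup>2)"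
    "continuous_on UNIV (\<lambda>y::real. y)" "continuous_on UNIV (\<lambda>y::real. max y 0 powr p)"
    using p_gt by (intro continuous_intros continuous_on_pos_powr; simp)+
  have low: "(\<lambda>j. lower_part (D j \<phi> t)) \<longlonglongrightarrow> lower_part (H \<phi> t)"
    if \<phi>: "continuous_on {a..b} \<phi>" for \<phi> t
    unfolding lower_part_def
    by (intro tendsto_intros conv[OF \<phi> hs(1)] conv[OF \<phi> hs(2)] conv[OF \<phi> hs(3)])
  have pm: "(\<lambda>j. pmass (D j \<phi> t)) \<longlonglongrightarrow> pmass (H \<phi> t)"
    if \<phi>: "continuous_on {a..b} \<phi>" for \<phi> t
    unfolding pmass_def by (intro conv[OF \<phi> hs(4)])
  have D0: "D j (\<lambda>_. 0) 0 = g j" and H0: "H \<phi> 0 = f" for j \<phi> by (auto simp: D_def H_def)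
  have Nf: "pmass f = 1"
    using pm[OF continuous_on_const, of 0 0] by (simp add: D0 H0 g(2) LIMSEQ_const_iff)
  have low0: "(\<lambda>j. lower_part (g j)) \<longlonglongrightarrow> lower_part f"
    using low[OF continuous_on_const, of 0 0] by (simp add: D0 H0)
  \<comment> \<open>The limit of the energies is known although f has no energy yet; its
    nonnegativity replaces lower semicontinuity.\<close>
  have En: "(\<lambda>j. energy (g' j)) \<longlonglongrightarrow> ?I - lower_part f"
    using tendsto_diff[OF lim low0] by (simp add: functional_def)
  have e0: "lower_part f \<le> ?I"
    using LIMSEQ_le_const[OF En, of 0] energy_nonneg[OF cg'] by fastforce
  show thesis
  proof (rule that[OF cf Nf e0])
    fix \<psi> \<psi>' \<phi> assume \<psi>: "C1_on a b \<psi> \<psi>'" and \<phi>: "C1_on a b \<phi> (\<lambda>x. \<psi> x / P x)"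
    define l where "l = f b * \<psi> b - f a * \<psi> a - integral {a..b} (\<lambda>x. f x * \<psi>' x)"
    define E2 where "E2 = energy (\<lambda>x. \<psi> x / P x)"
    note c\<phi> = C1_on_continuous[OF \<phi>] and c\<psi> = C1_on_continuous[OF \<psi>] and c\<psi>' = C1_on_cont_deriv[OF \<psi>]
      and c\<phi>' = C1_on_cont_deriv[OF \<phi>]
    have eD: "energy (\<lambda>x. g' j x + t * (\<psi> x / P x)) =
        energy (g' j) + 2 * t * (g j b * \<psi> b - g j a * \<psi> a - integral {a..b} (\<lambda>x. g j x * \<psi>' x)) + t\<^sup>2 * E2"
      for j t
    proof -
      have "P x * (g' j x + t * (\<psi> x / P x))\<^sup>2
        = P x * (g' j x)\<^sup>2 + (2 * t) * (g' j x * \<psi> x) + t\<^sup>2 * (P x * (\<psi> x / P x)\<^sup>2)" if "x \<in> {a..b}" for x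
        using P_pos[OF that] by (simp add: power2_eq_square field_simps)
      then have "energy (\<lambda>x. g' j x + t * (\<psi> x / P x)) = integral {a..b} (\<lambda>x.
          P x * (g' j x)\<^sup>2 + (2 * t) * (g' j x * \<psi> x) + t\<^sup>2 * (P x * (\<psi> x / P x)\<^sup>2))"
        unfolding energy_def by (intro integral_cong) auto
      also have "\<dots> = integral {a..b} (\<lambda>x. P x * (g' j x)\<^sup>2) + integral {a..b} (\<lambda>x. (2 * t) * (g' j x * \<psi> x))
           + integral {a..b} (\<lambda>x. t\<^sup>2 * (P x * (\<psi> x / P x)\<^sup>2))"
      proof -
        have "(\<lambda>x. P x * (g' j x)\<^sup>2) integrable_on {a..b}"
          "(\<lambda>x. (2 * t) * (g' j x * \<psi> x)) integrable_on {a..b}"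
          "(\<lambda>x. t\<^sup>2 * (P x * (\<psi> x / P x)\<^sup>2)) integrable_on {a..b}"
          by (intro integrable_continuous_interval continuous_on_mult continuous_on_power
              continuous_on_const cP cg' c\<psi> c\<phi>')+
        note i = this
        show ?thesis unfolding integral_add[OF integrable_add[OF i(1,2)] i(3)] integral_add[OF i(1,2)] ..
      qed
      also have "\<dots> = energy (g' j) + 2 * t * integral {a..b} (\<lambda>x. g' j x * \<psi> x) + t\<^sup>2 * E2"
        unfolding energy_def E2_def integral_mult_right ..
      also have "integral {a..b} (\<lambda>x. g' j x * \<psi> x) = g j b * \<psi> b - g j a * \<psi> a - integral {a..b} (\<lambda>x. g j x * \<psi>' x)"
        using C1_on_by_parts[OF g(1) \<psi>] ab by simp
      finally show ?thesis .
    qed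
    have ll: "(\<lambda>j. g j b * \<psi> b - g j a * \<psi> a - integral {a..b} (\<lambda>x. g j x * \<psi>' x)) \<longlonglongrightarrow> l"
    proof -
      have "(\<lambda>j. integral {a..b} (\<lambda>x. g j x * \<psi>' x)) \<longlonglongrightarrow> integral {a..b} (\<lambda>x. f x * \<psi>' x)"
      proof (rule dominated_convergence(2)[where h = "\<lambda>x. R * \<bar>\<psi>' x\<bar>"])
        show "(\<lambda>x. g j x * \<psi>' x) integrable_on {a..b}" for j
          by (intro integrable_continuous_interval continuous_on_mult cg c\<psi>')
        show "(\<lambda>x. R * \<bar>\<psi>' x\<bar>) integrable_on {a..b}"
          by (intro integrable_continuous_interval continuous_intros c\<psi>')
        show "norm (g j x * \<psi>' x) \<le> R * \<bar>\<psi>' x\<bar>" if "x \<in> {a..b}" for j x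
          unfolding real_norm_def abs_mult using R[OF that] by (intro mult_right_mono) auto
        show "(\<lambda>j. g j x * \<psi>' x) \<longlonglongrightarrow> f x * \<psi>' x" if "x \<in> {a..b}" for x
          by (intro tendsto_intros gf that)
      qed
      from tendsto_diff[OF tendsto_diff[OF tendsto_mult[OF gf tendsto_const] tendsto_mult[OF gf tendsto_const]] this]
      show ?thesis unfolding l_def using ab by simp
    qed
    \<comment> \<open>The limit of functional minus infimum times \<open>pmass powr (2 / p)\<close>
      along the perturbed sequence. It is nonnegative for small t by
      \<open>functional_ge_Inf\<close> and vanishes at 0, so its derivative at 0 is zero.\<close>
    define q where "q t = (?I - lower_part f) + 2 * t * l + t\<^sup>2 * E2 + lower_part (H \<phi> t) - ?I * pmass (H \<phi> t) powr (2 / p)" for t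
    have q0: "q 0 = 0" unfolding q_def H0 Nf by simp
    have qpos: "0 \<le> q t" if t: "0 < pmass (H \<phi> t)" for t
    proof -
      have 1: "(\<lambda>j. functional (D j \<phi> t) (\<lambda>x. g' j x + t * (\<psi> x / P x)) - ?I * pmass (D j \<phi> t) powr (2 / p)) \<longlonglongrightarrow> q t"
        unfolding functional_def eD q_def
        by (intro tendsto_diff tendsto_add tendsto_mult tendsto_const En ll low[OF c\<phi>]
            tendsto_powr[OF pm[OF c\<phi>] tendsto_const]) (use t in simp)
      have "\<forall>\<^sub>F j in sequentially. 0 < pmass (D j \<phi> t)"
        using pm[OF c\<phi>, of t] t by (rule order_tendstoD)
      then have "\<forall>\<^sub>F j in sequentially. 0 \<le> functional (D j \<phi> t) (\<lambda>x. g' j x + t * (\<psi> x / P x)) - ?I * pmass (D j \<phi> t) powr (2 / p)"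
      proof eventually_elim
        case (elim j)
        have "C1_on a b (D j \<phi> t) (\<lambda>x. g' j x + t * (\<psi> x / P x))"
          unfolding D_def by (intro C1_on_add g C1_on_cmult \<phi>)
        then show ?case using functional_ge_Inf[OF _ elim] by simp
      qed
      then show ?thesis using tendsto_lowerbound[OF 1] by simp
    qed
    define d1 where "d1 = integral {a..b} (\<lambda>x. w x * (2 * max (f x) 0 * \<phi> x))"
    define d2 where "d2 = integral {a..b} (\<lambda>x. w x * (- 2 * max (- f x) 0 * \<phi> x))"
    define d3 where "d3 = integral {a..b} (\<lambda>x. w x * (1 * \<phi> x))"
    define d4 where "d4 = integral {a..b} (\<lambda>x. w x * (p * max (f x) 0 powr (p - 1) * \<phi> x))"
    define m where "m = max (integral {a..b} (\<lambda>x. w x * f x)) 0"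
    have D1: "((\<lambda>t. integral {a..b} (\<lambda>x. w x * (max (H \<phi> t x) 0)\<^sup>2)) has_real_derivative d1) (at 0)"
      unfolding H_def d1_def
      by (rule integral_w_perturbation_derivative[OF cf c\<phi> has_real_derivative_pos_square]) (intro continuous_intros)
    have D2: "((\<lambda>t. integral {a..b} (\<lambda>x. w x * (max (- H \<phi> t x) 0)\<^sup>2)) has_real_derivative d2) (at 0)"
      unfolding H_def d2_def
      by (rule integral_w_perturbation_derivative[OF cf c\<phi> has_real_derivative_neg_square]) (intro continuous_intros)
    have D3: "((\<lambda>t. integral {a..b} (\<lambda>x. w x * H \<phi> t x)) has_real_derivative d3) (at 0)"
      unfolding H_def d3_def
      by (rule integral_w_perturbation_derivative[OF cf c\<phi> DERIV_ident]) (intro continuous_intros)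
    have D4: "((\<lambda>t. pmass (H \<phi> t)) has_real_derivative d4) (at 0)"
      unfolding H_def d4_def pmass_def using p_gt
      by (intro integral_w_perturbation_derivative[OF cf c\<phi> has_real_derivative_pos_powr]
            continuous_intros continuous_on_pos_powr) auto
    have D3': "((\<lambda>t. (max (integral {a..b} (\<lambda>x. w x * H \<phi> t x)) 0)\<^sup>2) has_real_derivative 2 * m * d3) (at 0)"
      using DERIV_chain'[OF D3 has_real_derivative_pos_square] unfolding m_def H0 by (simp add: mult_ac)
    have D4': "((\<lambda>t. pmass (H \<phi> t) powr (2 / p)) has_real_derivative (2 / p) * d4) (at 0)"
      using DERIV_chain'[OF D4 has_real_derivative_powr[of _ "2 / p"]] unfolding H0 Nf by simp
    have "(q has_real_derivative (2 * l + (k * d1 + d2 - e * (2 * m * d3)) - ?I * ((2 / p) * d4))) (at 0)"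
      unfolding q_def lower_part_def by (rule quadratic_perturbation_derivative[OF D1 D2 D3' D4'])
    moreover have "eventually (\<lambda>t. 0 < pmass (H \<phi> t)) (nhds 0)"
    proof -
      have "isCont (\<lambda>t. pmass (H \<phi> t)) 0" using D4 by (rule DERIV_isCont)
      then have "(\<lambda>t. pmass (H \<phi> t)) \<midarrow>0\<rightarrow> 1" unfolding isCont_def H0 Nf .
      then have "eventually (\<lambda>t. 0 < pmass (H \<phi> t)) (at 0)" by (rule order_tendstoD) simp
      then show ?thesis by (simp add: eventually_nhds_conv_at H0 Nf)
    qed
    then obtain d where "d > 0" "\<And>t. dist t 0 < d \<Longrightarrow> 0 < pmass (H \<phi> t)"
      unfolding eventually_nhds_metric by blast
    ultimately have eq0: "2 * l + (k * d1 + d2 - e * (2 * m * d3)) - ?I * ((2 / p) * d4) = 0"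
      using qpos q0 by (intro DERIV_local_min[of q _ 0 d]) (simp_all add: dist_real_def)
    have "integral {a..b} (\<lambda>x. w x * (euler_term f x * \<phi> x)) =
       (k / 2) * d1 + (1 / 2) * d2 - (?I / p) * d4 - (e * m) * d3"
    proof -
      have "w x * (euler_term f x * \<phi> x) = (k / 2) * (w x * (2 * max (f x) 0 * \<phi> x)) + (1 / 2) * (w x * (- 2 * max (- f x) 0 * \<phi> x))
          - (?I / p) * (w x * (p * max (f x) 0 powr (p - 1) * \<phi> x)) - (e * m) * (w x * (1 * \<phi> x))" for x
        unfolding euler_term_def m_def[symmetric] using p_gt by (simp add: algebra_simps)
      then have "integral {a..b} (\<lambda>x. w x * (euler_term f x * \<phi> x)) = integral {a..b} (\<lambda>x. 
          (k / 2) * (w x * (2 * max (f x) 0 * \<phi> x)) + (1 / 2) * (w x * (- 2 * max (- f x) 0 * \<phi> x))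
          - (?I / p) * (w x * (p * max (f x) 0 powr (p - 1) * \<phi> x)) - (e * m) * (w x * (1 * \<phi> x)))"
        by simp
      also have "\<dots> = integral {a..b} (\<lambda>x. (k / 2) * (w x * (2 * max (f x) 0 * \<phi> x)))
          + integral {a..b} (\<lambda>x. (1 / 2) * (w x * (- 2 * max (- f x) 0 * \<phi> x)))
          - integral {a..b} (\<lambda>x. (?I / p) * (w x * (p * max (f x) 0 powr (p - 1) * \<phi> x)))
          - integral {a..b} (\<lambda>x. (e * m) * (w x * (1 * \<phi> x)))"
      proof -
        have c: "continuous_on {a..b} (\<lambda>x. max (f x) 0 powr (p - 1))"
          using p_gt by (intro continuous_on_pos_powr cf) auto
        have "(\<lambda>x. (k / 2) * (w x * (2 * max (f x) 0 * \<phi> x))) integrable_on {a..b}"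
          "(\<lambda>x. (1 / 2) * (w x * (- 2 * max (- f x) 0 * \<phi> x))) integrable_on {a..b}"
          "(\<lambda>x. (?I / p) * (w x * (p * max (f x) 0 powr (p - 1) * \<phi> x))) integrable_on {a..b}"
          "(\<lambda>x. (e * m) * (w x * (1 * \<phi> x))) integrable_on {a..b}"
          by (intro integrable_continuous_interval continuous_on_mult continuous_on_const cw c\<phi> continuous_on_max
              continuous_on_minus cf c)+
        note i = this
        show ?thesis
          unfolding integral_diff[OF integrable_diff[OF integrable_add[OF i(1,2)] i(3)] i(4)]
            integral_diff[OF integrable_add[OF i(1,2)] i(3)] integral_add[OF i(1,2)] ..
      qed
      finally show ?thesis unfolding d1_def d2_def d3_def d4_def integral_mult_right .
    qed
    then have "l + integral {a..b} (\<lambda>x. w x * (euler_term f x * \<phi> x))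
        = (2 * l + (k * d1 + d2 - e * (2 * m * d3)) - ?I * ((2 / p) * d4)) / 2"
      by (simp only:) (simp add: algebra_simps add_divide_distrib diff_divide_distrib)
    then show "f b * \<psi> b - f a * \<psi> a - integral {a..b} (\<lambda>x. f x * \<psi>' x)
         + integral {a..b} (\<lambda>x. w x * (euler_term f x * \<phi> x)) = 0"
      unfolding l_def[symmetric] eq0 by simp
  qed
qed

end

section \<open>Regularity, Neumann condition and positivity of the minimizer\<close>

lemma C1_on_interior:
  assumes "C1_on a b g g'" "a < x" "x < b"
  shows "(g has_real_derivative g' x) (at x)"
proof -
  have "(g has_real_derivative g' x) (at x within {a..b})"
    using assms unfolding C1_on_def by auto
  moreover have "at x within {a..b} = at x" using assms by (intro at_within_interior) auto
  ultimately show ?thesis by simp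
qed

lemma C1_on_decreasing:
  assumes "C1_on a b g g'" "a \<le> x" "x < y" "y \<le> b" "\<And>t. x < t \<Longrightarrow> t < y \<Longrightarrow> g' t < 0"
  shows "g y < g x"
proof (rule DERIV_neg_imp_decreasing_open[OF assms(3)])
  fix t assume t: "x < t" "t < y"
  then have "(g has_real_derivative g' t) (at t)"
    using assms(2,4) by (intro C1_on_interior[OF assms(1)]) auto
  then show "\<exists>d. (g has_real_derivative d) (at t) \<and> d < 0" using assms(5)[OF t] by blast
next
  show "continuous_on {x..y} g"
    by (rule continuous_on_subset[OF C1_on_continuous[OF assms(1)]]) (use assms in auto)
qed

lemma C1_on_cong:
  assumes "C1_on a b g g'" "\<And>x. x \<in> {a..b} \<Longrightarrow> g x = h x"
  shows "C1_on a b h g'"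
  unfolding C1_on_def
proof (intro conjI ballI)
  fix x assume x: "x \<in> {a..b}"
  then have "(g has_real_derivative g' x) (at x within {a..b})" using assms unfolding C1_on_def by auto
  then show "(h has_real_derivative g' x) (at x within {a..b})"
    by (rule has_field_derivative_transform_within[where d = 1]) (use x assms(2) in auto)
qed (use assms in \<open>simp add: C1_on_def\<close>)

lemma C1_on_uminus: "C1_on a b g g' \<Longrightarrow> C1_on a b (\<lambda>x. - g x) (\<lambda>x. - g' x)"
  using C1_on_cmult[of a b g g' "-1"] by simp

context weighted_interval
begin

text \<open>du Bois-Reymond: the test function is the primitive of \<open>D\<close> minus its mean.\<close>

lemma constant_if_annihilates_derivatives:
  assumes D: "continuous_on {a..b} D"
    and orth: "\<And>\<psi> \<psi>'. C1_on a b \<psi> \<psi>' \<Longrightarrow> \<psi> a = 0 \<Longrightarrow> \<psi> b = 0 \<Longrightarrow> integral {a..b} (\<lambda>x. D x * \<psi>' x) = 0"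
  obtains c where "\<And>x. x \<in> {a..b} \<Longrightarrow> D x = c"
proof -
  define c where "c = integral {a..b} D / (b - a)"
  have cD: "continuous_on {a..b} (\<lambda>x. D x - c)" by (intro continuous_intros D)
  define \<psi> where "\<psi> x = 0 + integral {a..x} (\<lambda>x. D x - c)" for x
  have \<psi>: "C1_on a b \<psi> (\<lambda>x. D x - c)"
    unfolding \<psi>_def by (rule C1_on_indefinite_integral[OF cD])
  have iD: "D integrable_on {a..b}" "(\<lambda>x. c) integrable_on {a..b}"
    "(\<lambda>x. D x * (D x - c)) integrable_on {a..b}" "(\<lambda>x. c * (D x - c)) integrable_on {a..b}"
    by (intro integrable_continuous_interval continuous_intros D)+
  have 0: "\<psi> a = 0" "\<psi> b = 0"
    unfolding \<psi>_def using ab iD by (simp_all add: integral_diff c_def)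
  then have z: "integral {a..b} (\<lambda>x. D x - c) = 0" unfolding \<psi>_def by simp
  have "integral {a..b} (\<lambda>x. (D x - c)\<^sup>2) = integral {a..b} (\<lambda>x. D x * (D x - c) - c * (D x - c))"
    by (simp add: power2_eq_square left_diff_distrib)
  also have "\<dots> = integral {a..b} (\<lambda>x. D x * (D x - c)) - integral {a..b} (\<lambda>x. c * (D x - c))"
    by (rule integral_diff[OF iD(3,4)])
  also have "\<dots> = 0" using orth[OF \<psi> 0] z by simp
  finally have "(\<forall>x\<in>{a..b}. (D x - c)\<^sup>2 = 0)"
    using integral_eq_0_iff[OF continuous_on_power[OF cD] ab] by simp
  then show thesis by (intro that[of c]) auto
qed

end

context interpolation_functional
begin

lemma continuous_on_euler_term:
  assumes "continuous_on {a..b} f"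
  shows "continuous_on {a..b} (euler_term f)"
  unfolding euler_term_def[abs_def] using p_gt
  by (intro continuous_intros continuous_on_pos_powr assms) auto

text \<open>A minimum principle in terms of the flux H = P f', valid up to the boundary. H vanishes
  at z, by criticality inside and by the Neumann condition at the ends. If the Euler term were
  negative near z, H would decrease strictly there, f' would have a strict sign next to z, and f
  would fall below its minimum.\<close>

lemma minimum_point_euler_term:
  assumes f: "C1_on a b f f'" and H: "C1_on a b H (\<lambda>x. w x * euler_term f x)"
    and f': "\<And>x. x \<in> {a..b} \<Longrightarrow> f' x = H x / P x" and H0: "H a = 0" "H b = 0"
    and z: "z \<in> {a..b}" and zmin: "\<And>x. x \<in> {a..b} \<Longrightarrow> f z \<le> f x"
  shows "0 \<le> euler_term f z"
proof (rule ccontr)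
  assume neg: "\<not> 0 \<le> euler_term f z"
  obtain d where d: "d > 0" "\<And>x. x \<in> {a..b} \<Longrightarrow> \<bar>x - z\<bar> < d \<Longrightarrow> euler_term f x < 0"
  proof -
    have "continuous_on {a..b} (euler_term f)" by (rule continuous_on_euler_term[OF C1_on_continuous[OF f]])
    then obtain d where "d > 0" "\<forall>x\<in>{a..b}. dist x z < d \<longrightarrow> dist (euler_term f x) (euler_term f z) < - euler_term f z"
      using neg z unfolding continuous_on_iff by (metis neg_0_less_iff_less not_le)
    then show thesis by (intro that[of d]) (auto simp: dist_real_def)
  qed
  have wneg: "w x * euler_term f x < 0" if "x \<in> {a..b}" "\<bar>x - z\<bar> < d" for x
    using d(2)[OF that] w_pos[OF that(1)] by (simp add: mult_pos_neg)
  show False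
  \<comment> \<open>To the right of z the flux becomes negative, which also covers z = a. Only z = b
    has to be treated from the left.\<close>
  proof (cases "z < b")
    case True
    have Hz: "H z = 0"
    proof (cases "z = a")
      case False
      then have z': "a < z" "z < b" using z True by auto
      have "f' z = 0"
      proof (rule DERIV_local_min[OF C1_on_interior[OF f z']])
        show "0 < min (z - a) (b - z)" using z' by simp
        show "\<forall>y. \<bar>z - y\<bar> < min (z - a) (b - z) \<longrightarrow> f z \<le> f y"
          using zmin by (auto simp: abs_less_iff)
      qed
      then show ?thesis using f'[OF z] P_pos[OF z] by simp
    qed (use H0 in simp)
    define y where "y = min b (z + d / 2)"
    have y: "z < y" "y \<le> b" "y \<le> z + d / 2" using True d by (auto simp: y_def)
    have "H t < 0" if "z < t" "t < y" for t
      using C1_on_decreasing[OF H, of z t] wneg Hz z y that d(1) by force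
    then have "f' t < 0" if "z < t" "t < y" for t
      using f'[of t] P_pos[of t] z y that by (simp add: divide_neg_pos)
    then have "f y < f z" using z y by (intro C1_on_decreasing[OF f]) auto
    then show False using zmin[of y] z y by simp
  next
    case False
    then have zb: "z = b" using z by simp
    define y where "y = max a (b - d / 2)"
    have y: "y < b" "a \<le> y" "b - d / 2 \<le> y" using ab d by (auto simp: y_def)
    have "0 < H t" if "y < t" "t < b" for t
      using C1_on_decreasing[OF H, of t b] wneg H0 zb y that d(1) by force
    then have "0 < f' t" if "y < t" "t < b" for t
      using f'[of t] P_pos[of t] y that by simp
    then have "- f b < - f y" using y by (intro C1_on_decreasing[OF C1_on_uminus[OF f]]) auto
    then show False using zmin[of y] zb y by simp
  qed
qed

text \<open>With H the primitive of w \<open>euler_term f\<close>, two integrations by parts show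
  that f minus the primitive of H / P is orthogonal to all derivatives of functions vanishing at
  both ends, hence constant. So f inherits the derivative H / P.\<close>

lemma regular_minimizer:
  obtains f f' H where "C1_on a b f f'" "pmass f = 1" "lower_part f \<le> Inf values_on_sphere"
    "\<And>x. x \<in> {a..b} \<Longrightarrow> 0 < f x" "0 < integral {a..b} (\<lambda>x. w x * f x)"
    "C1_on a b H (\<lambda>x. w x * euler_term f x)" "\<And>x. x \<in> {a..b} \<Longrightarrow> f' x = H x / P x" "H a = 0" "H b = 0"
proof (rule minimizer_exists)
  fix f
  assume cf: "continuous_on {a..b} f" and Nf: "pmass f = 1" and lf: "lower_part f \<le> Inf values_on_sphere"
    and el: "\<And>\<psi> \<psi>' \<phi>. C1_on a b \<psi> \<psi>' \<Longrightarrow> C1_on a b \<phi> (\<lambda>x. \<psi> x / P x) \<Longrightarrow>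
       f b * \<psi> b - f a * \<psi> a - integral {a..b} (\<lambda>x. f x * \<psi>' x)
         + integral {a..b} (\<lambda>x. w x * (euler_term f x * \<phi> x)) = 0"
  define G where "G x = w x * euler_term f x" for x
  have cG: "continuous_on {a..b} G"
    unfolding G_def by (intro continuous_intros cw continuous_on_euler_term cf)
  define H where "H x = 0 + integral {a..x} G" for x
  have H: "C1_on a b H G" unfolding H_def by (rule C1_on_indefinite_integral[OF cG])
  \<comment> \<open>The natural boundary condition: the flux vanishes at b because constants are
    admissible variations.\<close>
  have H0: "H a = 0" "H b = 0"
  proof -
    show "H a = 0" unfolding H_def by simp
    have "integral {a..b} (\<lambda>x. w x * (euler_term f x * 1)) = 0"
      using el[OF C1_on_const[of a b 0], of "\<lambda>_. 1"] C1_on_const[of a b 1] by simp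
    then show "H b = 0" unfolding H_def G_def by simp
  qed
  have cHP: "continuous_on {a..b} (\<lambda>x. H x / P x)"
    using P_pos by (intro continuous_intros C1_on_continuous[OF H] cP) force
  define F where "F x = 0 + integral {a..x} (\<lambda>x. H x / P x)" for x
  have F: "C1_on a b F (\<lambda>x. H x / P x)" unfolding F_def by (rule C1_on_indefinite_integral[OF cHP])
  have orth: "integral {a..b} (\<lambda>x. (f x - F x) * \<psi>' x) = 0"
    if \<psi>: "C1_on a b \<psi> \<psi>'" "\<psi> a = 0" "\<psi> b = 0" for \<psi> \<psi>'
  proof -
    have "continuous_on {a..b} (\<lambda>x. \<psi> x / P x)"
      using P_pos by (intro continuous_intros C1_on_continuous[OF \<psi>(1)] cP) force
    from C1_on_indefinite_integral[OF this, of 0]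
    have \<phi>: "C1_on a b (\<lambda>x. 0 + integral {a..x} (\<lambda>x. \<psi> x / P x)) (\<lambda>x. \<psi> x / P x)" .
    define \<phi> where "\<phi> = (\<lambda>x. 0 + integral {a..x} (\<lambda>x. \<psi> x / P x))"
    note \<phi> = \<phi>[folded \<phi>_def]
    have "integral {a..b} (\<lambda>x. w x * (euler_term f x * \<phi> x)) = integral {a..b} (\<lambda>x. G x * \<phi> x)"
      unfolding G_def by (simp add: mult.assoc)
    also have "\<dots> = - integral {a..b} (\<lambda>x. H x * (\<psi> x / P x))"
      using C1_on_by_parts[OF H \<phi>] ab H0 by simp
    also have "\<dots> = - integral {a..b} (\<lambda>x. (H x / P x) * \<psi> x)" by simp
    also have "\<dots> = integral {a..b} (\<lambda>x. F x * \<psi>' x)"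
      using C1_on_by_parts[OF F \<psi>(1)] ab \<psi> by simp
    finally have "integral {a..b} (\<lambda>x. f x * \<psi>' x) = integral {a..b} (\<lambda>x. F x * \<psi>' x)"
      using el[OF \<psi>(1) \<phi>] \<psi> by simp
    moreover have "(\<lambda>x. f x * \<psi>' x) integrable_on {a..b}" "(\<lambda>x. F x * \<psi>' x) integrable_on {a..b}"
      by (intro integrable_continuous_interval continuous_on_mult cf C1_on_continuous[OF F]
          C1_on_cont_deriv[OF \<psi>(1)])+
    ultimately show ?thesis by (simp add: left_diff_distrib integral_diff)
  qed
  have "continuous_on {a..b} (\<lambda>x. f x - F x)" by (intro continuous_intros cf C1_on_continuous[OF F])
  then obtain c where c: "\<And>x. x \<in> {a..b} \<Longrightarrow> f x - F x = c"
    using constant_if_annihilates_derivatives orth by blast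
  have f: "C1_on a b f (\<lambda>x. H x / P x)"
  proof -
    have "C1_on a b (\<lambda>x. c + F x) (\<lambda>x. 0 + H x / P x)" by (rule C1_on_add[OF C1_on_const F])
    then have *: "C1_on a b (\<lambda>x. c + F x) (\<lambda>x. H x / P x)" by simp
    have "f x = c + F x" if "x \<in> {a..b}" for x using c[OF that] by simp
    then show ?thesis by (intro C1_on_cong[OF *]) simp
  qed
  obtain z where z: "z \<in> {a..b}" "\<And>x. x \<in> {a..b} \<Longrightarrow> f z \<le> f x"
    using continuous_attains_inf[of "{a..b}" f] cf ab by auto
  have ez: "0 \<le> euler_term f z"
    by (rule minimum_point_euler_term[OF f _ _ H0 z]) (use H in \<open>simp_all add: G_def[abs_def]\<close>)
  define m where "m = integral {a..b} (\<lambda>x. w x * f x)"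
  \<comment> \<open>At a negative value the Euler term reduces to f minus a nonnegative constant;
    this is the effect of the penalty on the negative part.\<close>
  have "0 \<le> f z"
  proof (rule ccontr)
    assume "\<not> 0 \<le> f z"
    then have "euler_term f z = f z - e * max m 0" unfolding euler_term_def m_def by simp
    moreover have "0 \<le> e * max m 0" using e_pos by simp
    ultimately show False using ez \<open>\<not> 0 \<le> f z\<close> by linarith
  qed
  then have f0: "0 \<le> f x" if "x \<in> {a..b}" for x using z(2)[OF that] by simp
  have m: "0 < m"
  proof -
    have "0 \<le> m" unfolding m_def by (intro integral_w_nonneg f0 cf)
    moreover have "m \<noteq> 0"
    proof
      assume "m = 0"
      then have "\<forall>x\<in>{a..b}. w x * f x = 0"
        using integral_eq_0_iff[OF continuous_on_mult[OF cw cf] ab] w_pos f0 unfolding m_def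
        by (simp add: less_imp_le)
      then have "\<forall>x\<in>{a..b}. max (f x) 0 powr p = 0" using w_pos by force
      then have "pmass f = integral {a..b} (\<lambda>x. w x * 0)"
        unfolding pmass_def by (intro integral_cong) auto
      then show False using Nf by simp
    qed
    ultimately show ?thesis by simp
  qed
  \<comment> \<open>Here e > 0 decides: at a zero of f every term of \<open>euler_term f\<close>
    vanishes except \<open>- (e * m)\<close>.\<close>
  have "0 < f z"
  proof (rule ccontr)
    assume "\<not> 0 < f z"
    then have "f z = 0" using \<open>0 \<le> f z\<close> by simp
    then have "euler_term f z = - (e * m)" unfolding euler_term_def using m by (simp add: m_def)
    then show False using ez mult_pos_pos[OF e_pos m] by simp
  qed
  then have fpos: "0 < f x" if "x \<in> {a..b}" for x using z(2)[OF that] by simp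
  show thesis
    by (rule that[OF f Nf lf fpos m[unfolded m_def] H[unfolded G_def[abs_def]] refl H0])
qed

end

section \<open>Rigidity of minimizers\<close>

text \<open>Here d, s, v stand for f', f'', 1 / f, and \<open>- 2 * q * N\<close> is the exponent
  \<sigma>. The left side is the product rule for B, divided by w f^\<sigma>; the right side is the
  completed square in s. The hypothesis \<open>k * (q - 1) = n\<close> enters through
  \<open>(1 - x\<^sup>2) * d * (k * d - q * d * k)\<close>, which cancels
  \<open>n * (1 - x\<^sup>2) * d\<^sup>2\<close>.\<close>

lemma rigidity_polynomial_identity:
  fixes x n q s d v m N k G :: real
  assumes "(n + 2) * N = 1" "k * (q - 1) = n" "G = (1 - x\<^sup>2) * s - n * x * d"
  shows "G\<^sup>2 + (- 2 * q * N) * (1 - x\<^sup>2) * d\<^sup>2 * v * G + (1 - x\<^sup>2) * d * (k * d - q * d * (k - m * v - G * v))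
     + n * (1 - x\<^sup>2) * d\<^sup>2 + n * x * (- 2 * q * N) * (1 - x\<^sup>2) * d ^ 3 * v + n * x * (1 - x\<^sup>2) * d * s + n * x * d * G
     - (q * n * N) * (- 2 * x * (1 - x\<^sup>2) * d ^ 3 * v + (1 - x\<^sup>2) * G * d\<^sup>2 * v
        + (- 2 * q * N) * (1 - x\<^sup>2)\<^sup>2 * d ^ 4 * v\<^sup>2 + (1 - x\<^sup>2)\<^sup>2 * (2 * d\<^sup>2 * s * v - d ^ 4 * v\<^sup>2))
   = (1 - x\<^sup>2)\<^sup>2 * ((s - (q * n * N) * d\<^sup>2 * v)\<^sup>2 + q * n * N\<^sup>2 * ((n + 2) - (n - 2) * q) * d ^ 4 * v\<^sup>2)
     + m * q * (1 - x\<^sup>2) * d\<^sup>2 * v"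
  using assms by algebra

text \<open>\<open>P_deriv\<close> makes (P f')' / w equal to (1 - x^2) f'' - n x f'. The product
  form of \<open>admissible\<close> is the sign condition on the remainder of the completed square;
  for n > 2 it says p \<le> 2 n / (n - 2), and for n \<le> 2 it is satisfied for every p >
  1.\<close>

locale ultraspherical_functional = interpolation_functional +
  fixes n :: real
  assumes n_pos: "0 < n" and kn: "k * (p - 2) = n" and admissible: "(n - 2) * (p - 1) \<le> n + 2"
    and x_lt_1: "\<And>x. x \<in> {a..b} \<Longrightarrow> x\<^sup>2 < 1"
    and P_w: "\<And>x. x \<in> {a..b} \<Longrightarrow> P x = (1 - x\<^sup>2) * w x"
    and P_deriv: "\<And>x. a < x \<Longrightarrow> x < b \<Longrightarrow> (P has_real_derivative - n * x * w x) (at x)"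
begin

text \<open>Multiplying the Euler-Lagrange equation by
  \<open>f\<^sup>\<sigma> (L f + (p - 1 + \<sigma>) (1 - x\<^sup>2) f'\<^sup>2 / f)\<close>, \<open>L\<close> the ultraspherical operator, turns it into the
  derivative of \<open>B\<close> below; \<open>\<sigma> = - 2 (p - 1) / (n + 2)\<close> makes the discriminant of the resulting
  quadratic form in \<open>(f'', f'\<^sup>2 / f)\<close> as small as possible.\<close>

lemma minimizer_is_constant:
  assumes f: "C1_on a b f f'" and fpos: "\<And>x. x \<in> {a..b} \<Longrightarrow> 0 < f x"
    and \<mu>pos: "0 < integral {a..b} (\<lambda>x. w x * f x)"
    and H: "C1_on a b H (\<lambda>x. w x * euler_term f x)"
    and f': "\<And>x. x \<in> {a..b} \<Longrightarrow> f' x = H x / P x" and H0: "H a = 0" "H b = 0"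
    and x: "x \<in> {a..b}"
  shows "f' x = 0"
proof -
  define I where "I = Inf values_on_sphere"
  define m where "m = e * integral {a..b} (\<lambda>x. w x * f x)"
  have m: "m > 0" using e_pos \<mu>pos by (simp add: m_def)
  define q where "q = p - 1"
  have q: "q > 0" using p_gt by (simp add: q_def)
  \<comment> \<open>Together with \<open>(n + 2) * N = 1\<close> this removes the division, so that
    the identity to be checked is polynomial.\<close>
  define N where "N = 1 / (n + 2)"
  have N: "(n + 2) * N = 1" "N > 0" using n_pos by (auto simp: N_def)
  define \<sigma> where "\<sigma> = - 2 * q * N"
  define G where "G x = k * f x - I * f x powr q - m" for x
  have eG: "euler_term f x = G x" if "x \<in> {a..b}" for x
    using fpos[OF that] \<mu>pos unfolding euler_term_def G_def I_def m_def q_def by simp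
  define c where "c = q * n * N"
  \<comment> \<open>Each summand contains the flux H as a factor, so B is zero at both ends.\<close>
  define B where "B x = H x * f x powr \<sigma> * G x + n * x * f x powr \<sigma> * f' x * H x
     - c * ((1 - x\<^sup>2) * H x * f x powr \<sigma> * (f' x)\<^sup>2 / f x)" for x
  define f2 where "f2 x = (G x + n * x * f' x) / (1 - x\<^sup>2)" for x
  define B' where "B' x = w x * f x powr \<sigma> * ((1 - x\<^sup>2)\<^sup>2 * ((f2 x - c * (f' x)\<^sup>2 * (1 / f x))\<^sup>2
     + q * n * N\<^sup>2 * ((n + 2) - (n - 2) * q) * f' x ^ 4 * (1 / f x)\<^sup>2) + m * q * (1 - x\<^sup>2) * (f' x)\<^sup>2 * (1 / f x))" for x
  have B: "(B has_real_derivative B' x) (at x)" if x: "a < x" "x < b" for x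
  proof -
    have xi: "x \<in> {a..b}" using x by simp
    have rho: "1 - x\<^sup>2 > 0" using x_lt_1[OF xi] by simp
    have fx: "f x > 0" using fpos[OF xi] .
    have Df: "(f has_real_derivative f' x) (at x)" by (rule C1_on_interior[OF f x])
    have DH: "(H has_real_derivative w x * G x) (at x)"
      using C1_on_interior[OF H x] by (simp add: eG[OF xi])
    have Px: "P x = (1 - x\<^sup>2) * w x" "P x > 0" "w x > 0" using P_w[OF xi] P_pos[OF xi] w_pos[OF xi] by auto
    have P0: "P x \<noteq> 0" using P_pos[OF xi] by simp
    have Hx: "H x = (1 - x\<^sup>2) * w x * f' x" using f'[OF xi] Px rho by simp
    \<comment> \<open>The second derivative of f exists inside the interval because f' is the
      quotient of two differentiable functions; \<open>f2\<close> is its value read off from the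
      equation.\<close>
    have "((\<lambda>x. H x / P x) has_real_derivative (w x * G x * P x - H x * (- n * x * w x)) / (P x * P x)) (at x)"
      by (rule DERIV_divide[OF DH P_deriv[OF x] P0])
    also have "(w x * G x * P x - H x * (- n * x * w x)) / (P x * P x) = f2 x"
    proof -
      have "(w * g * (r * w) - r * w * d * (- n * x * w)) / (r * w * (r * w)) = (g + n * x * d) / r"
        if "w \<noteq> 0" "r \<noteq> 0" for w g r d :: real
        using that by (simp add: field_simps)
      then show ?thesis unfolding Hx f2_def Px(1) using Px(3) rho by simp
    qed
    finally have "((\<lambda>x. H x / P x) has_real_derivative f2 x) (at x)" .
    then have Df': "(f' has_real_derivative f2 x) (at x)"
      by (rule has_field_derivative_transform_within_open[where S = "{a<..<b}"]) (use x f' in auto)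
    have Dy: "((\<lambda>x. f x powr r) has_real_derivative r * f x powr r * (f' x * (1 / f x))) (at x)" for r
    proof -
      have "((\<lambda>x. f x powr r) has_real_derivative r * f x powr (r - 1) * f' x) (at x)"
        using DERIV_fun_powr[OF Df fx, of r] by simp
      then show ?thesis using fx by (simp add: powr_diff)
    qed
    define z where "z = I * f x powr q"
    define v where "v = 1 / f x"
    have DG: "(G has_real_derivative k * f' x - q * z * (f' x * v)) (at x)"
      unfolding G_def[abs_def] z_def v_def
      by (rule derivative_eq_intros Df Dy refl | simp)+
    have zG: "z = k * f x - m - G x" unfolding z_def G_def by simp
    have fv: "f x * v = 1" using fx by (simp add: v_def)
    \<comment> \<open>The power of f that carries the unknown infimum is eliminated through the
      definition of G. The infimum thus leaves the computation, and m is the only trace of the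
      perturbation.\<close>
    have DG': "(G has_real_derivative k * f' x - q * f' x * (k - m * v - G x * v)) (at x)"
    proof -
      have "z * v = k - m * v - G x * v" unfolding zG using fv by (simp add: algebra_simps)
      then have "q * z * (f' x * v) = q * f' x * (k - m * v - G x * v)"
        by (metis mult.assoc mult.commute)
      with DG show ?thesis by (simp only:)
    qed
    define y where "y = f x powr \<sigma>"
    have Dv: "((\<lambda>x. 1 / f x) has_real_derivative - (f' x * v\<^sup>2)) (at x)"
      using DERIV_inverse_fun[OF Df] fx by (simp add: v_def inverse_eq_divide power2_eq_square)
    have Dy': "((\<lambda>x. f x powr \<sigma>) has_real_derivative \<sigma> * y * (f' x * v)) (at x)"
      using Dy unfolding y_def v_def .
    have D1: "((\<lambda>x. H x * f x powr \<sigma> * G x) has_real_derivative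
       (w x * G x * y + H x * (\<sigma> * y * (f' x * v))) * G x + H x * y * (k * f' x - q * f' x * (k - m * v - G x * v))) (at x)"
      by (rule derivative_eq_intros DH Dy' DG' refl | simp add: y_def algebra_simps)+
    have D2: "((\<lambda>x. n * x * f x powr \<sigma> * f' x * H x) has_real_derivative
       n * (y * f' x * H x + x * (\<sigma> * y * (f' x * v)) * f' x * H x + x * y * f2 x * H x + x * y * f' x * (w x * G x))) (at x)"
      by (rule derivative_eq_intros DH Dy' Df' refl | simp add: y_def algebra_simps)+
    have D3: "((\<lambda>x. (1 - x\<^sup>2) * H x * f x powr \<sigma> * (f' x)\<^sup>2 * (1 / f x)) has_real_derivative
       (- 2 * x * H x * y * (f' x)\<^sup>2 * v + (1 - x\<^sup>2) * (w x * G x) * y * (f' x)\<^sup>2 * v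
        + (1 - x\<^sup>2) * H x * (\<sigma> * y * (f' x * v)) * (f' x)\<^sup>2 * v + (1 - x\<^sup>2) * H x * y * (2 * f' x * f2 x) * v
        - (1 - x\<^sup>2) * H x * y * (f' x)\<^sup>2 * (f' x * v\<^sup>2))) (at x)"
      by (rule derivative_eq_intros DH Dy' Df' Dv refl | simp add: y_def v_def algebra_simps)+
    have "B = (\<lambda>x. H x * f x powr \<sigma> * G x + n * x * f x powr \<sigma> * f' x * H x
        - c * ((1 - x\<^sup>2) * H x * f x powr \<sigma> * (f' x)\<^sup>2 * (1 / f x)))"
      unfolding B_def by simp
    then have DB: "(B has_real_derivative
       ((w x * G x * y + H x * (\<sigma> * y * (f' x * v))) * G x + H x * y * (k * f' x - q * f' x * (k - m * v - G x * v)))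
       + n * (y * f' x * H x + x * (\<sigma> * y * (f' x * v)) * f' x * H x + x * y * f2 x * H x + x * y * f' x * (w x * G x))
       - c * (- 2 * x * H x * y * (f' x)\<^sup>2 * v + (1 - x\<^sup>2) * (w x * G x) * y * (f' x)\<^sup>2 * v
        + (1 - x\<^sup>2) * H x * (\<sigma> * y * (f' x * v)) * (f' x)\<^sup>2 * v + (1 - x\<^sup>2) * H x * y * (2 * f' x * f2 x) * v
        - (1 - x\<^sup>2) * H x * y * (f' x)\<^sup>2 * (f' x * v\<^sup>2))) (at x)" (is "(B has_real_derivative ?D) _")
      using DERIV_diff[OF DERIV_add[OF D1 D2] DERIV_cmult[OF D3, of c]] by simp
    have "?D = w x * y * (G x ^ 2 + (- 2 * q * N) * (1 - x\<^sup>2) * (f' x)\<^sup>2 * v * G x + (1 - x\<^sup>2) * f' x * (k * f' x - q * f' x * (k - m * v - G x * v))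
     + n * (1 - x\<^sup>2) * (f' x)\<^sup>2 + n * x * (- 2 * q * N) * (1 - x\<^sup>2) * f' x ^ 3 * v + n * x * (1 - x\<^sup>2) * f' x * f2 x + n * x * f' x * G x
     - (q * n * N) * (- 2 * x * (1 - x\<^sup>2) * f' x ^ 3 * v + (1 - x\<^sup>2) * G x * (f' x)\<^sup>2 * v
        + (- 2 * q * N) * (1 - x\<^sup>2)\<^sup>2 * f' x ^ 4 * v\<^sup>2 + (1 - x\<^sup>2)\<^sup>2 * (2 * (f' x)\<^sup>2 * f2 x * v - f' x ^ 4 * v\<^sup>2)))"
      unfolding Hx c_def \<sigma>_def by algebra
    also have "\<dots> = B' x"
      unfolding B'_def y_def[symmetric] v_def[symmetric] c_def
      by (subst rigidity_polynomial_identity[OF N(1)])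
         (use kn rho in \<open>simp_all add: q_def f2_def\<close>)
    finally show ?thesis using DB by simp
  qed
  \<comment> \<open>Both the square and the remainder, nonnegative by \<open>admissible\<close>, are
    discarded.\<close>
  have B'_ge: "w x * f x powr \<sigma> * (m * q * (1 - x\<^sup>2) * (f' x)\<^sup>2 * (1 / f x)) \<le> B' x" if "x \<in> {a..b}" for x
  proof -
    have "0 \<le> (n + 2) - (n - 2) * q" using admissible by (simp add: q_def)
    then have "0 \<le> (1 - x\<^sup>2)\<^sup>2 * ((f2 x - c * (f' x)\<^sup>2 * (1 / f x))\<^sup>2
     + q * n * N\<^sup>2 * ((n + 2) - (n - 2) * q) * f' x ^ 4 * (1 / f x)\<^sup>2)"
      using q n_pos by (intro mult_nonneg_nonneg add_nonneg_nonneg) auto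
    then show ?thesis unfolding B'_def using w_pos[OF that] by (intro mult_left_mono) auto
  qed
  have coef: "0 < w x * f x powr \<sigma> * (m * q * (1 - x\<^sup>2) * (1 / f x))" if "x \<in> {a..b}" for x
    using w_pos[OF that] fpos[OF that] m q x_lt_1[OF that] by (intro mult_pos_pos) auto
  have B'_nonneg: "0 \<le> B' x" if "x \<in> {a..b}" for x
  proof -
    have "0 \<le> (w x * f x powr \<sigma> * (m * q * (1 - x\<^sup>2) * (1 / f x))) * (f' x)\<^sup>2"
      by (rule mult_nonneg_nonneg[OF less_imp_le[OF coef[OF that]] zero_le_power2])
    also have "\<dots> \<le> B' x" using B'_ge[OF that] by (simp add: mult_ac)
    finally show ?thesis .
  qed
  have ends: "B a = 0" "B b = 0" unfolding B_def H0 by auto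
  have cB: "continuous_on {a..b} B"
  proof -
    have "continuous_on {a..b} G"
      using continuous_on_euler_term[OF C1_on_continuous[OF f]] by (rule continuous_on_eq) (rule eG)
    then show ?thesis unfolding B_def[abs_def]
      by (intro continuous_intros C1_on_continuous[OF f] C1_on_continuous[OF H] C1_on_cont_deriv[OF f])
         (use fpos in force)+
  qed
  have mono: "B x \<le> B y" if "a \<le> x" "x \<le> y" "y \<le> b" for x y
  proof (rule DERIV_nonneg_imp_increasing_open[OF that(2)])
    show "continuous_on {x..y} B" by (rule continuous_on_subset[OF cB]) (use that in auto)
    fix t assume t: "x < t" "t < y"
    show "\<exists>l. (B has_real_derivative l) (at t) \<and> 0 \<le> l"
      using B[of t] B'_nonneg[of t] t that by (intro exI[of _ "B' t"]) auto
  qed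
  have B0: "B x = 0" if "x \<in> {a..b}" for x
    using mono[of a x] mono[of x b] that ends ab by auto
  show ?thesis
  proof (cases "x = a \<or> x = b")
    case True
    then show ?thesis using f'[OF x] H0 by auto
  next
    case False
    then have xi: "a < x" "x < b" using x by auto
    have "((\<lambda>_. 0) has_real_derivative B' x) (at x)"
      by (rule has_field_derivative_transform_within_open[OF B[OF xi], where S = "{a<..<b}"])
         (use xi B0 in auto)
    then have "B' x = 0" using DERIV_unique DERIV_const by blast
    then have "(w x * f x powr \<sigma> * (m * q * (1 - x\<^sup>2) * (1 / f x))) * (f' x)\<^sup>2 \<le> 0"
      using B'_ge[OF x] by (simp add: mult_ac)
    then have "(f' x)\<^sup>2 \<le> 0" using coef[OF x] by (meson mult_pos_pos not_le)
    then show ?thesis by simp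
  qed
qed

text \<open>A constant minimizer with \<open>pmass\<close> 1 and positive values is the function 1,
  whose \<open>lower_part\<close> is k - e. The bound
  \<open>lower_part f \<le> Inf values_on_sphere\<close> then suffices, so the energy of f never has
  to be identified with the limit of energies.\<close>

lemma Inf_values_on_sphere_ge: "k - e \<le> Inf values_on_sphere"
proof (rule regular_minimizer)
  fix f f' H
  assume f: "C1_on a b f f'" "pmass f = 1" "lower_part f \<le> Inf values_on_sphere"
    "\<And>x. x \<in> {a..b} \<Longrightarrow> 0 < f x" "0 < integral {a..b} (\<lambda>x. w x * f x)"
    "C1_on a b H (\<lambda>x. w x * euler_term f x)" "\<And>x. x \<in> {a..b} \<Longrightarrow> f' x = H x / P x" "H a = 0" "H b = 0"
  have f'0: "f' x = 0" if "x \<in> {a..b}" for x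
    using minimizer_is_constant[OF f(1,4-9) that] .
  have const: "f x = f a" if x: "x \<in> {a..b}" for x
  proof -
    have A: "(f' has_integral (f x - f a)) {a..x}"
      by (rule C1_on_integral[OF f(1)]) (use x in auto)
    have "(f' has_integral 0) {a..x}"
      by (rule has_integral_is_0) (use f'0 x in auto)
    from has_integral_unique[OF A this] show ?thesis by simp
  qed
  have fa: "0 < f a" using f(4) ab by auto
  have "pmass f = integral {a..b} (\<lambda>x. w x * f a powr p)"
    unfolding pmass_def
  proof (rule integral_cong)
    fix x assume "x \<in> {a..b}"
    from const[OF this] show "w x * max (f x) 0 powr p = w x * f a powr p" using fa by simp
  qed
  then have "f a powr p = 1" using f(2) w_int by simp
  then have "(f a powr p) powr (1 / p) = 1" by simp
  then have "f a = 1" using fa p_gt by (simp add: powr_powr)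
  then have f1: "f x = 1" if "x \<in> {a..b}" for x using const[OF that] by simp
  have "integral {a..b} (\<lambda>x. w x * (max (f x) 0)\<^sup>2) = integral {a..b} w"
    "integral {a..b} (\<lambda>x. w x * (max (- f x) 0)\<^sup>2) = integral {a..b} (\<lambda>x. 0)"
    "integral {a..b} (\<lambda>x. w x * f x) = integral {a..b} w"
    using f1 by (intro integral_cong; simp)+
  then have "lower_part f = k - e" unfolding lower_part_def using w_int by simp
  then show ?thesis using f(3) by simp
qed

end

lemma ultraspherical_C1_inequality:
  assumes wi: "weighted_interval a b P w" and n: "0 < n" and p: "1 < p" "p \<noteq> 2" and adm: "(n - 2) * (p - 1) \<le> n + 2"
    and x1: "\<And>x. x \<in> {a..b} \<Longrightarrow> x\<^sup>2 < 1"
    and Pw: "\<And>x. x \<in> {a..b} \<Longrightarrow> P x = (1 - x\<^sup>2) * w x"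
    and P': "\<And>x. a < x \<Longrightarrow> x < b \<Longrightarrow> (P has_real_derivative - n * x * w x) (at x)"
    and g: "C1_on a b g g'" "\<And>x. x \<in> {a..b} \<Longrightarrow> 0 < g x"
  shows "n / (p - 2) * integral {a..b} (\<lambda>x. w x * g x powr p) powr (2 / p)
     \<le> integral {a..b} (\<lambda>x. P x * (g' x)\<^sup>2) + n / (p - 2) * integral {a..b} (\<lambda>x. w x * (g x)\<^sup>2)"
proof -
  define k where "k = n / (p - 2)"
  interpret weighted_interval a b P w by (rule wi)
  define X where "X = integral {a..b} (\<lambda>x. w x * g x powr p) powr (2 / p)"
  have cg: "continuous_on {a..b} g" by (rule C1_on_continuous[OF g(1)])
  have Npos: "0 < integral {a..b} (\<lambda>x. w x * g x powr p)"
  proof -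
    have cgp: "continuous_on {a..b} (\<lambda>x. g x powr p)"
      by (intro continuous_intros cg) (use g(2) in force)
    have "0 \<le> integral {a..b} (\<lambda>x. w x * g x powr p)" by (intro integral_w_nonneg cgp) simp
    moreover have "integral {a..b} (\<lambda>x. w x * g x powr p) \<noteq> 0"
    proof
      assume "integral {a..b} (\<lambda>x. w x * g x powr p) = 0"
      then have "\<forall>x\<in>{a..b}. w x * g x powr p = 0"
        using integral_eq_0_iff[OF continuous_on_mult[OF cw cgp] ab] w_pos by (simp add: less_imp_le)
      moreover have "a \<in> {a..b}" using ab by simp
      ultimately show False using w_pos[of a] g(2)[of a] by force
    qed
    ultimately show ?thesis by simp
  qed
  have main: "(k - e) * X \<le> integral {a..b} (\<lambda>x. P x * (g' x)\<^sup>2) + k * integral {a..b} (\<lambda>x. w x * (g x)\<^sup>2)"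
    if e: "e > 0" for e
  proof -
    interpret ultraspherical_functional a b P w k p e n
      by unfold_locales (use n p adm x1 Pw P' e in \<open>auto simp: k_def\<close>)
    have gp: "max (g x) 0 = g x" "max (- g x) 0 = 0" if "x \<in> {a..b}" for x using g(2)[OF that] by auto
    have N: "pmass g = integral {a..b} (\<lambda>x. w x * g x powr p)"
      unfolding pmass_def using gp by (intro integral_cong) auto
    have "integral {a..b} (\<lambda>x. w x * (max (g x) 0)\<^sup>2) = integral {a..b} (\<lambda>x. w x * (g x)\<^sup>2)"
      "integral {a..b} (\<lambda>x. w x * (max (- g x) 0)\<^sup>2) = integral {a..b} (\<lambda>x. 0)"
      using gp by (intro integral_cong; simp)+
    then have "lower_part g \<le> k * integral {a..b} (\<lambda>x. w x * (g x)\<^sup>2)"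
      unfolding lower_part_def using e by simp
    moreover have "(k - e) * X \<le> Inf values_on_sphere * X"
      using Inf_values_on_sphere_ge by (intro mult_right_mono) (auto simp: X_def)
    moreover have "Inf values_on_sphere * X \<le> functional g g'"
      using functional_ge_Inf[OF g(1)] Npos unfolding N X_def by simp
    ultimately show ?thesis unfolding functional_def energy_def by linarith
  qed
  have Xpos: "X > 0" using Npos by (simp add: X_def)
  have "k * X \<le> integral {a..b} (\<lambda>x. P x * (g' x)\<^sup>2) + k * integral {a..b} (\<lambda>x. w x * (g x)\<^sup>2)"
  proof (rule field_le_epsilon)
    fix \<epsilon> :: real assume "\<epsilon> > 0"
    then have "(k - \<epsilon> / X) * X \<le> integral {a..b} (\<lambda>x. P x * (g' x)\<^sup>2) + k * integral {a..b} (\<lambda>x. w x * (g x)\<^sup>2)"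
      using Xpos by (intro main) simp
    then show "k * X \<le> integral {a..b} (\<lambda>x. P x * (g' x)\<^sup>2) + k * integral {a..b} (\<lambda>x. w x * (g x)\<^sup>2) + \<epsilon>"
      using Xpos by (simp add: left_diff_distrib)
  qed
  then show ?thesis unfolding k_def X_def .
qed

section \<open>Smooth bumps and weak derivatives\<close>

text \<open>The recursion passes to \<open>deriv f\<close> instead of looking at the iterates
  \<open>deriv ^^ k\<close>; closure under sums, products and primitives is then an induction on k
  with f general.\<close>

primrec smooth_upto :: "nat \<Rightarrow> (real \<Rightarrow> real) \<Rightarrow> bool" where
  "smooth_upto 0 f \<longleftrightarrow> (\<forall>x. f differentiable (at x))"
| "smooth_upto (Suc k) f \<longleftrightarrow> (\<forall>x. f differentiable (at x)) \<and> smooth_upto k (deriv f)"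

lemma smooth_upto_differentiable: "smooth_upto k f \<Longrightarrow> f differentiable (at x)"
  by (cases k) auto

lemma smooth_upto_deriv_differentiable: "smooth_upto k f \<Longrightarrow> ((deriv ^^ k) f) differentiable (at x)"
proof (induction k arbitrary: f)
  case (Suc k)
  then show ?case by (simp add: funpow_Suc_right del: funpow.simps)
qed simp

lemma smooth_upto_DERIV: "smooth_upto k f \<Longrightarrow> (f has_real_derivative deriv f x) (at x)"
  using smooth_upto_differentiable DERIV_deriv_iff_real_differentiable by blast

lemma smooth_upto_SucD: "smooth_upto (Suc k) f \<Longrightarrow> smooth_upto k f"
  by (induction k arbitrary: f) auto

lemma smooth_upto_intro:
  assumes "\<And>x. (f has_real_derivative f' x) (at x)" "smooth_upto k f'"
  shows "smooth_upto (Suc k) f"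
proof -
  have "deriv f = f'" using assms(1) DERIV_imp_deriv by blast
  then show ?thesis using assms real_differentiable_def by auto
qed

lemma smooth_upto_0I:
  assumes "\<And>x. (f has_real_derivative f' x) (at x)"
  shows "smooth_upto 0 f"
  using assms real_differentiable_def by auto

lemma smooth_upto_const: "smooth_upto k (\<lambda>_. c)"
proof (induction k arbitrary: c)
  case (Suc k)
  show ?case by (rule smooth_upto_intro[where f' = "\<lambda>_. 0"]) (auto simp: Suc)
qed simp

lemma smooth_upto_add:
  "smooth_upto k f \<Longrightarrow> smooth_upto k g \<Longrightarrow> smooth_upto k (\<lambda>x. f x + g x)"
proof (induction k arbitrary: f g)
  case (Suc k)
  have "smooth_upto k (\<lambda>x. deriv f x + deriv g x)" using Suc by auto
  then show ?case
    by (rule smooth_upto_intro[rotated]) (intro DERIV_add smooth_upto_DERIV[OF Suc.prems(1)] smooth_upto_DERIV[OF Suc.prems(2)])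
qed (auto intro: differentiable_add)

lemma smooth_upto_mult:
  "smooth_upto k f \<Longrightarrow> smooth_upto k g \<Longrightarrow> smooth_upto k (\<lambda>x. f x * g x)"
proof (induction k arbitrary: f g)
  case (Suc k)
  have "smooth_upto k (\<lambda>x. f x * deriv g x + deriv f x * g x)"
    using Suc smooth_upto_SucD by (intro smooth_upto_add Suc.IH) auto
  then show ?case
    by (rule smooth_upto_intro[rotated]) (intro DERIV_mult' smooth_upto_DERIV[OF Suc.prems(1)] smooth_upto_DERIV[OF Suc.prems(2)])
qed (auto intro: differentiable_mult)

lemma smooth_upto_affine: "smooth_upto k f \<Longrightarrow> smooth_upto k (\<lambda>x. f (c * x + d))"
proof (induction k arbitrary: f)
  case 0
  have "((\<lambda>x. f (c * x + d)) has_real_derivative deriv f (c * x + d) * c) (at x)" for x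
    by (rule DERIV_chain2[OF smooth_upto_DERIV[OF 0]]) (auto intro!: derivative_eq_intros)
  then show ?case by (rule smooth_upto_0I)
next
  case (Suc k)
  have "smooth_upto k (\<lambda>x. deriv f (c * x + d) * c)"
    using Suc by (intro smooth_upto_mult smooth_upto_const Suc.IH) auto
  moreover have "((\<lambda>x. f (c * x + d)) has_real_derivative deriv f (c * x + d) * c) (at x)" for x
    by (rule DERIV_chain2[OF smooth_upto_DERIV[OF Suc.prems]]) (auto intro!: derivative_eq_intros)
  ultimately show ?case by (rule smooth_upto_intro[rotated])
qed

text \<open>\<open>flat 0\<close> is the classical smooth function exp (- 1 / x) extended by 0. The
  powers of 1 / x are included because the span of the family is closed under
  differentiation.\<close>

definition flat :: "nat \<Rightarrow> real \<Rightarrow> real" where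
  "flat m x = (if x \<le> 0 then 0 else inverse x ^ m * exp (- inverse x))"

lemma flat_tendsto_0: "(flat m \<longlongrightarrow> 0) (at 0)"
proof (rule filterlim_split_at)
  show "(flat m \<longlongrightarrow> 0) (at_left 0)"
    by (rule tendsto_eventually) (auto simp: flat_def eventually_at_filter)
  have "((\<lambda>x::real. inverse x ^ m / exp (inverse x)) \<longlongrightarrow> 0) (at_right 0)"
    by (rule filterlim_compose[OF tendsto_power_div_exp_0 filterlim_inverse_at_top_right])
  moreover have "\<forall>\<^sub>F x in at_right 0. inverse x ^ m / exp (inverse x) = flat m x"
    by (auto simp: flat_def eventually_at_filter exp_minus divide_inverse)
  ultimately show "(flat m \<longlongrightarrow> 0) (at_right 0)" by (rule Lim_transform_eventually)
qed

lemma flat_deriv: "(flat m has_real_derivative (flat (m + 2) x - real m * flat (m + 1) x)) (at x)"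
proof (cases x "0::real" rule: linorder_cases)
  case less
  have "((\<lambda>_. 0) has_real_derivative 0) (at x)" by simp
  then have "(flat m has_real_derivative 0) (at x)"
    by (rule has_field_derivative_transform_within_open[where S = "{..<0}"]) (use less in \<open>auto simp: flat_def\<close>)
  then show ?thesis using less by (simp add: flat_def)
next
  case equal
  \<comment> \<open>At 0 the difference quotient is again a member of the family, so a single limit
    covers all orders.\<close>
  have "flat (m + 1) h = (flat m (0 + h) - flat m 0) / h" if "h \<noteq> 0" for h
    using that by (simp add: flat_def divide_inverse)
  then have "\<forall>\<^sub>F h in at 0. flat (m + 1) h = (flat m (0 + h) - flat m 0) / h"
    by (simp add: eventually_at_filter)
  from Lim_transform_eventually[OF flat_tendsto_0 this]
  have "((\<lambda>h. (flat m (0 + h) - flat m 0) / h) \<longlongrightarrow> 0) (at 0)" .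
  then show ?thesis using equal by (simp add: DERIV_def flat_def)
next
  case greater
  have "((\<lambda>x. inverse x ^ m * exp (- inverse x)) has_real_derivative
      (real m * inverse x ^ (m - 1) * (- (inverse x)\<^sup>2) * exp (- inverse x) + inverse x ^ m * (exp (- inverse x) * (inverse x)\<^sup>2))) (at x)"
    using greater by (auto intro!: derivative_eq_intros simp: power2_eq_square)
  also have "real m * inverse x ^ (m - 1) * (- (inverse x)\<^sup>2) * exp (- inverse x) + inverse x ^ m * (exp (- inverse x) * (inverse x)\<^sup>2)
      = flat (m + 2) x - real m * flat (m + 1) x"
    using greater by (cases m) (simp_all add: flat_def power2_eq_square power_add algebra_simps)
  finally show ?thesis
    by (rule has_field_derivative_transform_within_open[where S = "{0<..}"]) (use greater in \<open>auto simp: flat_def\<close>)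
qed

lemma smooth_upto_flat: "smooth_upto k (flat m)"
proof (induction k arbitrary: m)
  case 0 show ?case by (rule smooth_upto_0I[OF flat_deriv])
next
  case (Suc k)
  have "smooth_upto k (\<lambda>x. flat (m + 2) x + (- real m) * flat (m + 1) x)"
    by (intro smooth_upto_add smooth_upto_mult smooth_upto_const Suc)
  then show ?case using flat_deriv[of m] by (intro smooth_upto_intro[where f = "flat m"]) auto
qed

text \<open>The factor \<open>real j + 1\<close> steepens both flanks, so that the bumps approximate
  the indicator of the open interval boundedly.\<close>

definition bump :: "real \<Rightarrow> real \<Rightarrow> nat \<Rightarrow> real \<Rightarrow> real" where
  "bump \<alpha> \<beta> j x = flat 0 ((real j + 1) * (x - \<alpha>)) * flat 0 ((real j + 1) * (\<beta> - x))"

lemma smooth_bump: "smooth_upto k (bump \<alpha> \<beta> j)"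
proof -
  have "smooth_upto k (\<lambda>x. flat 0 ((real j + 1) * x + (- (real j + 1) * \<alpha>)) * flat 0 ((- (real j + 1)) * x + (real j + 1) * \<beta>))"
    by (intro smooth_upto_mult smooth_upto_affine smooth_upto_flat)
  moreover have "(\<lambda>x. flat 0 ((real j + 1) * x + (- (real j + 1) * \<alpha>)) * flat 0 ((- (real j + 1)) * x + (real j + 1) * \<beta>)) = bump \<alpha> \<beta> j"
    unfolding bump_def[abs_def] by (simp add: algebra_simps)
  ultimately show ?thesis by simp
qed

lemma flat_0_bounds: "0 \<le> flat 0 x" "flat 0 x \<le> 1"
  by (auto simp: flat_def)

lemma bump_bounds: "0 \<le> bump \<alpha> \<beta> j x" "bump \<alpha> \<beta> j x \<le> 1"
  unfolding bump_def using flat_0_bounds by (auto intro: mult_le_one)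

lemma bump_outside: "x \<notin> {\<alpha><..<\<beta>} \<Longrightarrow> bump \<alpha> \<beta> j x = 0"
  by (auto simp: bump_def flat_def not_less mult_le_0_iff zero_le_mult_iff)

lemma bump_pos: "\<alpha> < x \<Longrightarrow> x < \<beta> \<Longrightarrow> 0 < bump \<alpha> \<beta> j x"
  by (simp add: bump_def flat_def mult_le_0_iff not_le)

lemma bump_tendsto: "(\<lambda>j. bump \<alpha> \<beta> j x) \<longlonglongrightarrow> indicator {\<alpha><..<\<beta>} x"
proof (cases "x \<in> {\<alpha><..<\<beta>}")
  case True
  have *: "(\<lambda>j. flat 0 ((real j + 1) * y)) \<longlonglongrightarrow> 1" if "y > 0" for y
  proof -
    have "(\<lambda>j. inverse (real (Suc j)) * inverse y) \<longlonglongrightarrow> 0 * inverse y"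
      by (intro tendsto_intros LIMSEQ_inverse_real_of_nat)
    then have "(\<lambda>j. exp (- (inverse (real (Suc j)) * inverse y))) \<longlonglongrightarrow> exp (- (0 * inverse y))"
      by (rule tendsto_exp[OF tendsto_minus])
    moreover have "exp (- (inverse (real (Suc j)) * inverse y)) = flat 0 ((real j + 1) * y)" for j
      using that by (simp add: flat_def mult_le_0_iff not_le add.commute)
    ultimately show ?thesis by simp
  qed
  have "(\<lambda>j. bump \<alpha> \<beta> j x) \<longlonglongrightarrow> 1 * 1"
    unfolding bump_def using True by (intro tendsto_mult *) auto
  then show ?thesis using True by simp
qed (simp add: bump_outside)

lemma continuous_smooth:
  assumes "smooth_upto k f"
  shows "continuous_on S f"
  by (intro continuous_at_imp_continuous_on ballI DERIV_isCont[OF smooth_upto_DERIV[OF assms]])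

text \<open>Mean zero makes the primitive of \<open>\<eta>\<close> a test function.\<close>

lemma test_function_primitive:
  fixes \<eta> :: "real \<Rightarrow> real"
  assumes sm: "\<And>k. smooth_upto k \<eta>" and b: "0 < b" "b < 1"
    and out: "\<And>x. x \<notin> {-b..b} \<Longrightarrow> \<eta> x = 0" and int0: "(\<integral>x. \<eta> x \<partial>lborel) = 0"
  obtains \<phi> where "test_function \<phi>" "\<And>x. x \<notin> {-b<..<b} \<Longrightarrow> \<phi> x = 0"
    "\<And>x. (\<phi> has_real_derivative \<eta> x) (at x)"
proof -
  have c: "continuous_on S \<eta>" for S using continuous_smooth[OF sm[of 0]] .
  \<comment> \<open>The lower limit -2 lies to the left of the support, so this is the primitive
    from minus infinity.\<close>
  define \<phi> where "\<phi> x = integral {-2..x} \<eta>" for x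
  have eq: "\<phi> x = (\<integral>t. indicator {-2..x} t * \<eta> t \<partial>lborel)" for x
    unfolding \<phi>_def using set_borel_integral_eq_integral(2)[OF borel_integrable_atLeastAtMost'[OF c]]
    by (simp add: set_lebesgue_integral_def)
  have z1: "\<phi> x = 0" if "x \<le> -b" for x
  proof -
    \<comment> \<open>Continuity carries the vanishing over to the end point, which makes the
      integrand below identically zero.\<close>
    have "\<eta> (-b) = 0"
    proof (rule ccontr)
      assume "\<eta> (-b) \<noteq> 0"
      moreover have "isCont \<eta> (-b)" using c[of UNIV] by (simp add: continuous_on_eq_continuous_at)
      ultimately obtain d where "d > 0" "\<And>y. dist (-b) y < d \<Longrightarrow> \<eta> y \<noteq> 0"
        using continuous_at_avoid[of "-b" \<eta> 0] by auto
      then have "\<eta> (-b - d / 2) \<noteq> 0" by (simp add: dist_real_def)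
      moreover have "\<eta> (-b - d / 2) = 0" using \<open>d > 0\<close> by (intro out) auto
      ultimately show False by simp
    qed
    then have "indicator {-2..x} t * \<eta> t = 0" for t
      using out[of t] that by (cases "t = -b") (auto simp: indicator_def)
    then have "(\<lambda>t. indicator {-2..x} t * \<eta> t) = (\<lambda>t. 0)" by blast
    then show ?thesis unfolding eq by simp
  qed
  have z2: "\<phi> x = 0" if "b \<le> x" for x
  proof -
    have "indicator {-2..x} t * \<eta> t = \<eta> t" for t
      using out[of t] that b by (cases "t \<in> {-b..b}") (auto simp: indicator_def)
    then have "(\<lambda>t. indicator {-2..x} t * \<eta> t) = \<eta>" by blast
    then show ?thesis unfolding eq using int0 by simp
  qed
  have D: "(\<phi> has_real_derivative \<eta> x) (at x)" for x
  proof (cases "x > -2")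
    case True
    have "((\<lambda>x. integral {-2..x} \<eta>) has_real_derivative \<eta> x) (at x within {-2..x + 1})"
      by (rule integral_has_real_derivative[OF c]) (use True in auto)
    moreover have "at x within {-2..x + 1} = at x" using True by (intro at_within_interior) auto
    ultimately show ?thesis unfolding \<phi>_def by simp
  next
    case False
    have "((\<lambda>_. 0) has_real_derivative 0) (at x)" by simp
    then have "(\<phi> has_real_derivative 0) (at x)"
      by (rule has_field_derivative_transform_within_open[where S = "{..< -b}"]) (use False b z1 in auto)
    moreover have "\<eta> x = 0" using False b by (intro out) auto
    ultimately show ?thesis by simp
  qed
  have "smooth_upto k \<phi>" for k
    using smooth_upto_intro[OF D sm] smooth_upto_SucD by blast
  then have "((deriv ^^ k) \<phi>) differentiable (at x)" for k x
    by (rule smooth_upto_deriv_differentiable)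
  moreover have "\<forall>x. x \<notin> {-b..b} \<longrightarrow> \<phi> x = 0" using z1 z2 by auto
  moreover have "compact {-b..b}" "{-b..b} \<subseteq> {-1<..<1}" using b by auto
  ultimately have "test_function \<phi>" unfolding test_function_def by blast
  then show thesis using that[of \<phi>] z1 z2 D by force
qed

text \<open>The positive and the negative part of v are densities of two finite measures that agree
  on all right half-lines. Such measures coincide, hence so do their densities almost
  everywhere.\<close>

lemma AE_zero_if_tail_integrals_zero:
  fixes v :: "real \<Rightarrow> real"
  assumes v: "integrable lborel v" and tail: "\<And>x. (\<integral>t. indicator {x<..} t * v t \<partial>lborel) = 0"
  shows "AE x in lborel. v x = 0"
proof -
  define p where "p x = max (v x) 0" for x
  define q where "q x = max (- v x) 0" for x
  have [measurable]: "v \<in> borel_measurable borel" using v by auto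
  have [measurable]: "p \<in> borel_measurable borel" "q \<in> borel_measurable borel"
    unfolding p_def[abs_def] q_def[abs_def] by measurable
  have ip: "integrable lborel p" "integrable lborel q"
    unfolding p_def[abs_def] q_def[abs_def] using v by (auto intro!: integrable_max)
  have nn: "0 \<le> p x" "0 \<le> q x" "v x = p x - q x" for x by (auto simp: p_def q_def)
  have fin: "(\<integral>\<^sup>+x. ennreal (p x) \<partial>lborel) < \<infinity>"
    using ip(1) nn by (simp add: nn_integral_eq_integral)
  have em: "emeasure (density lborel (\<lambda>x. ennreal (r x))) {x<..} = ennreal (\<integral>t. indicator {x<..} t * r t \<partial>lborel)"
    if r: "integrable lborel r" "\<And>x. 0 \<le> r x" for r :: "real \<Rightarrow> real" and x
  proof -
    have [measurable]: "r \<in> borel_measurable borel" using r by auto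
    have "emeasure (density lborel (\<lambda>x. ennreal (r x))) {x<..} = (\<integral>\<^sup>+t. ennreal (indicator {x<..} t * r t) \<partial>lborel)"
      by (subst emeasure_density) (auto intro!: nn_integral_cong borel_open simp: indicator_def)
    also have "\<dots> = ennreal (\<integral>t. indicator {x<..} t * r t \<partial>lborel)"
      using integrable_mult_indicator[OF _ r(1), of "{x<..}"] r(2)
      by (intro nn_integral_eq_integral) auto
    finally show ?thesis .
  qed
  have "density lborel (\<lambda>x. ennreal (p x)) = density lborel (\<lambda>x. ennreal (q x))"
  proof (rule measure_eqI_lessThan)
    fix x
    show "emeasure (density lborel (\<lambda>x. ennreal (p x))) {x<..} < \<infinity>"
      using em[OF ip(1) nn(1)] by simp
    have i: "integrable lborel (\<lambda>t. indicator {x<..} t * p t)" "integrable lborel (\<lambda>t. indicator {x<..} t * q t)"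
      using integrable_mult_indicator[OF _ ip(1), of "{x<..}"] integrable_mult_indicator[OF _ ip(2), of "{x<..}"] by auto
    have "(\<integral>t. indicator {x<..} t * v t \<partial>lborel) = (\<integral>t. indicator {x<..} t * p t - indicator {x<..} t * q t \<partial>lborel)"
      unfolding nn(3) by (simp add: right_diff_distrib)
    also have "\<dots> = (\<integral>t. indicator {x<..} t * p t \<partial>lborel) - (\<integral>t. indicator {x<..} t * q t \<partial>lborel)"
      by (rule Bochner_Integration.integral_diff[OF i])
    finally show "emeasure (density lborel (\<lambda>x. ennreal (p x))) {x<..} = emeasure (density lborel (\<lambda>x. ennreal (q x))) {x<..}"
      using tail[of x] by (simp add: em[OF ip(1) nn(1)] em[OF ip(2) nn(2)])
  qed auto
  then have "AE x in lborel. ennreal (p x) = ennreal (q x)"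
    using fin by (subst (asm) finite_density_unique) auto
  then show ?thesis
  proof eventually_elim
    case (elim x)
    then have "p x = q x" using nn by simp
    then show ?case using nn(3)[of x] by simp
  qed
qed

text \<open>As h is merely integrable, its primitive need not have a classical derivative
  everywhere. Fubini over the region t \<le> x takes the place of integration by parts.\<close>

lemma integral_primitive_by_parts:
  fixes h \<eta> \<phi> :: "real \<Rightarrow> real"
  assumes h: "integrable lborel h" and h0: "\<And>t. t \<notin> {-b..b} \<Longrightarrow> h t = 0"
    and \<eta>: "continuous_on UNIV \<eta>" and \<eta>0: "\<And>t. t \<notin> {-b..b} \<Longrightarrow> \<eta> t = 0"
    and \<phi>: "\<And>x. (\<phi> has_real_derivative \<eta> x) (at x)" "\<phi> b = 0"
  shows "(\<integral>x. (\<integral>t. indicator {..x} t * h t \<partial>lborel) * \<eta> x \<partial>lborel) = - (\<integral>t. h t * \<phi> t \<partial>lborel)"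
proof -
  have [measurable]: "h \<in> borel_measurable borel" using h by auto
  have [measurable]: "\<eta> \<in> borel_measurable borel" using \<eta> by (rule borel_measurable_continuous_onI)
  have i\<eta>: "integrable lborel \<eta>"
  proof -
    have "integrable lborel (\<lambda>x. indicator {-b..b} x *\<^sub>R \<eta> x)"
      by (intro borel_integrable_compact compact_Icc continuous_on_subset[OF \<eta>]) auto
    moreover have "(\<lambda>x. indicator {-b..b} x *\<^sub>R \<eta> x) = \<eta>" using \<eta>0 by (fastforce simp: indicator_def)
    ultimately show ?thesis by simp
  qed
  have prod: "integrable (lborel \<Otimes>\<^sub>M lborel) (\<lambda>z. \<bar>h (fst z)\<bar> * \<bar>\<eta> (snd z)\<bar>)"
  proof (rule lborel_pair.Fubini_integrable)
    show "AE x in lborel. integrable lborel (\<lambda>y. \<bar>h (fst (x, y))\<bar> * \<bar>\<eta> (snd (x, y))\<bar>)"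
      using i\<eta> by auto
    show "integrable lborel (\<lambda>x. \<integral>y. norm (\<bar>h (fst (x, y))\<bar> * \<bar>\<eta> (snd (x, y))\<bar>) \<partial>lborel)"
      using h by (auto simp: abs_mult)
  qed measurable
  have int: "integrable (lborel \<Otimes>\<^sub>M lborel) (case_prod (\<lambda>t x. (if t \<le> x then 1 else 0) * h t * \<eta> x))"
    by (rule Bochner_Integration.integrable_bound[OF prod]) (auto simp: abs_mult)
  have in1: "(\<integral>x. (if t \<le> x then 1 else 0) * h t * \<eta> x \<partial>lborel) = - (h t * \<phi> t)" for t
  proof (cases "t \<in> {-b..b}")
    case True
    have "(\<integral>x. (if t \<le> x then 1 else 0) * h t * \<eta> x \<partial>lborel) = (\<integral>x. h t * (indicator {t..b} x * \<eta> x) \<partial>lborel)"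
      by (intro Bochner_Integration.integral_cong) (use True \<eta>0 in \<open>auto simp: indicator_def\<close>)
    also have "\<dots> = h t * (\<integral>x. indicator {t..b} x * \<eta> x \<partial>lborel)" by simp
    also have "(\<integral>x. indicator {t..b} x * \<eta> x \<partial>lborel) = integral {t..b} \<eta>"
      using set_borel_integral_eq_integral(2)[OF borel_integrable_atLeastAtMost'[OF continuous_on_subset[OF \<eta>]], of t b]
      by (simp add: set_lebesgue_integral_def)
    also have "integral {t..b} \<eta> = \<phi> b - \<phi> t"
    proof (rule integral_unique[OF fundamental_theorem_of_calculus])
      show "(\<phi> has_vector_derivative \<eta> x) (at x within {t..b})" for x
        using \<phi>(1)[of x] has_field_derivative_at_within
        unfolding has_real_derivative_iff_has_vector_derivative[symmetric] by blast
    qed (use True in auto)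
    finally show ?thesis using \<phi>(2) by simp
  qed (simp add: h0)
  have in2: "(\<integral>t. (if t \<le> x then 1 else 0) * h t * \<eta> x \<partial>lborel) = (\<integral>t. indicator {..x} t * h t \<partial>lborel) * \<eta> x" for x
  proof -
    have "(\<integral>t. (if t \<le> x then 1 else 0) * h t * \<eta> x \<partial>lborel) = (\<integral>t. (indicator {..x} t * h t) * \<eta> x \<partial>lborel)"
      by (intro Bochner_Integration.integral_cong) (auto simp: indicator_def)
    then show ?thesis by simp
  qed
  show ?thesis
    using lborel_pair.Fubini_integral[OF int] unfolding in1 in2 by simp
qed

text \<open>The difference D of f and the primitive H of g annihilates smooth functions of mean zero
  supported in [-b, b]. Bumps corrected to mean zero, in the limit of steep flanks, show that the
  integral of D over every subinterval is c times its length; this determines D almost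
  everywhere.\<close>

lemma weak_derivative_continuous_representative:
  assumes wd: "has_weak_deriv f g" and b: "0 < b" "b < 1"
  obtains F where "continuous_on {-b..b} F" "AE x in lborel. x \<in> {-b..b} \<longrightarrow> f x = F x"
    "\<And>x y. -b \<le> x \<Longrightarrow> x \<le> y \<Longrightarrow> y \<le> b \<Longrightarrow> F y - F x = (LBINT t:{x..y}. g t)"
proof -
  have [simp]: "{x<..<y} \<in> sets borel" for x y :: real by (rule borel_open) simp
  have sub: "compact {-b..b}" "{-b..b} \<subseteq> {-1<..<1}" using b by auto
  have sf: "set_integrable lborel {-b..b} f" and sg: "set_integrable lborel {-b..b} g"
    using wd sub unfolding has_weak_deriv_def locally_integrable_def by blast+
  define h where "h t = indicator {-b..b} t * g t" for t
  have ih: "integrable lborel h" using sg unfolding set_integrable_def h_def[abs_def] by simp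
  define H where "H x = integral {-b..x} g" for x
  have gi: "g integrable_on {-b..b}" using set_borel_integral_eq_integral(1)[OF sg] .
  have cH: "continuous_on {-b..b} H" unfolding H_def by (rule indefinite_integral_continuous_1[OF gi])
  have H_eq: "H x = (\<integral>t. indicator {..x} t * h t \<partial>lborel)" if "x \<in> {-b..b}" for x
  proof -
    have "set_integrable lborel {-b..x} g" using sg by (rule set_integrable_subset) (use that in auto)
    from set_borel_integral_eq_integral(2)[OF this]
    have "H x = (\<integral>t. indicator {-b..x} t * g t \<partial>lborel)" by (simp add: H_def set_lebesgue_integral_def)
    also have "\<dots> = (\<integral>t. indicator {..x} t * h t \<partial>lborel)"
      by (intro Bochner_Integration.integral_cong) (use that in \<open>auto simp: h_def indicator_def\<close>)
    finally show ?thesis .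
  qed
  define D where "D x = indicator {-b..b} x * (f x - H x)" for x
  have iD: "integrable lborel D"
  proof -
    have "set_integrable lborel {-b..b} (\<lambda>x. f x - H x)"
      by (intro set_integral_diff sf borel_integrable_atLeastAtMost' cH)
    then show ?thesis unfolding set_integrable_def D_def[abs_def] by simp
  qed
  have [measurable]: "D \<in> borel_measurable borel" using iD by auto
  have D\<eta>: "(\<integral>x. D x * \<eta> x \<partial>lborel) = 0"
    if sm: "\<And>k. smooth_upto k \<eta>" and out: "\<And>x. x \<notin> {-b..b} \<Longrightarrow> \<eta> x = 0"
      and i0: "(\<integral>x. \<eta> x \<partial>lborel) = 0" for \<eta>
  proof -
    obtain \<phi> where \<phi>: "test_function \<phi>" "\<And>x. x \<notin> {-b<..<b} \<Longrightarrow> \<phi> x = 0"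
      "\<And>x. (\<phi> has_real_derivative \<eta> x) (at x)"
      using test_function_primitive[OF sm b out i0] by blast
    have d\<phi>: "deriv \<phi> x = \<eta> x" for x using \<phi>(3) DERIV_imp_deriv by blast
    have c\<eta>: "continuous_on S \<eta>" for S using continuous_smooth[OF sm[of 0]] .
    have "(LBINT x:{-1<..<1}. f x * deriv \<phi> x) = - (LBINT x:{-1<..<1}. g x * \<phi> x)"
      using wd \<phi>(1) unfolding has_weak_deriv_def by blast
    moreover have "(LBINT x:{-1<..<1}. f x * deriv \<phi> x) = (LBINT x:{-b..b}. f x * \<eta> x)"
      unfolding set_lebesgue_integral_def d\<phi>
      by (intro Bochner_Integration.integral_cong) (use out b in \<open>auto simp: indicator_def\<close>)
    moreover have "(LBINT x:{-1<..<1}. g x * \<phi> x) = (\<integral>t. h t * \<phi> t \<partial>lborel)"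
      unfolding set_lebesgue_integral_def
      by (intro Bochner_Integration.integral_cong) (use \<phi>(2) b in \<open>auto simp: indicator_def h_def\<close>)
    moreover have "(\<integral>x. (\<integral>t. indicator {..x} t * h t \<partial>lborel) * \<eta> x \<partial>lborel) = - (\<integral>t. h t * \<phi> t \<partial>lborel)"
      by (rule integral_primitive_by_parts[OF ih _ c\<eta> out \<phi>(3)]) (auto simp: h_def \<phi>(2))
    moreover have "(\<integral>x. (\<integral>t. indicator {..x} t * h t \<partial>lborel) * \<eta> x \<partial>lborel) = (LBINT x:{-b..b}. H x * \<eta> x)"
      unfolding set_lebesgue_integral_def
    proof (intro Bochner_Integration.integral_cong refl)
      fix x show "(\<integral>t. indicator {..x} t * h t \<partial>lborel) * \<eta> x = indicator {-b..b} x *\<^sub>R (H x * \<eta> x)"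
        using H_eq[of x] out[of x] by (cases "x \<in> {-b..b}") auto
    qed
    ultimately have "(LBINT x:{-b..b}. f x * \<eta> x) = (LBINT x:{-b..b}. H x * \<eta> x)" by simp
    moreover have "set_integrable lborel {-b..b} (\<lambda>x. f x * \<eta> x)"
    proof -
      obtain B where B: "\<And>x. x \<in> {-b..b} \<Longrightarrow> \<bar>\<eta> x\<bar> \<le> B"
      proof -
        have "bounded (\<eta> ` {-b..b})" by (intro compact_imp_bounded compact_continuous_image c\<eta> compact_Icc)
        then obtain B where "\<forall>y\<in>\<eta> ` {-b..b}. norm y \<le> B" unfolding bounded_iff by blast
        then show thesis by (intro that[of B]) auto
      qed
      have [measurable]: "\<eta> \<in> borel_measurable borel" by (rule borel_measurable_continuous_onI[OF c\<eta>])
      have [measurable]: "(\<lambda>x. indicator {-b..b} x *\<^sub>R f x) \<in> borel_measurable borel"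
        using sf unfolding set_integrable_def by auto
      have i: "integrable lborel (\<lambda>x. B * \<bar>indicator {-b..b} x *\<^sub>R f x\<bar>)"
        using sf unfolding set_integrable_def by (intro integrable_mult_right integrable_abs)
      have "integrable lborel (\<lambda>x. (indicator {-b..b} x *\<^sub>R f x) * \<eta> x)"
      proof (rule Bochner_Integration.integrable_bound[OF i])
        show "AE x in lborel. norm ((indicator {-b..b} x *\<^sub>R f x) * \<eta> x) \<le> norm (B * \<bar>indicator {-b..b} x *\<^sub>R f x\<bar>)"
        proof (intro always_eventually allI)
          fix x
          show "norm ((indicator {-b..b} x *\<^sub>R f x) * \<eta> x) \<le> norm (B * \<bar>indicator {-b..b} x *\<^sub>R f x\<bar>)"
          proof (cases "x \<in> {-b..b}")
            case True
            have "\<bar>f x\<bar> * \<bar>\<eta> x\<bar> \<le> \<bar>f x\<bar> * \<bar>B\<bar>" using B[OF True] by (intro mult_left_mono) auto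
            then show ?thesis using True by (simp add: abs_mult mult.commute)
          qed simp
        qed
      qed measurable
      then show ?thesis unfolding set_integrable_def by (simp add: mult.assoc)
    qed
    moreover have "set_integrable lborel {-b..b} (\<lambda>x. H x * \<eta> x)"
      by (intro borel_integrable_atLeastAtMost' continuous_intros cH c\<eta>)
    ultimately have "(LBINT x:{-b..b}. f x * \<eta> x - H x * \<eta> x) = 0"
      by (simp add: set_integral_diff)
    then show ?thesis unfolding set_lebesgue_integral_def D_def by (simp add: left_diff_distrib mult.assoc)
  qed
  have bump_ind: "indicator {-b..b} x *\<^sub>R bump \<alpha> \<beta> j x = bump \<alpha> \<beta> j x"
    if "-b \<le> \<alpha>" "\<beta> \<le> b" for \<alpha> \<beta> j x
    using bump_outside[of x \<alpha> \<beta> j] that by (cases "x \<in> {-b..b}") auto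
  have ibump: "integrable lborel (bump \<alpha> \<beta> j)" if "-b \<le> \<alpha>" "\<beta> \<le> b" for \<alpha> \<beta> j
  proof -
    have "integrable lborel (\<lambda>x. indicator {-b..b} x *\<^sub>R bump \<alpha> \<beta> j x)"
      by (intro borel_integrable_compact compact_Icc continuous_smooth[OF smooth_bump])
    then show ?thesis by (simp only: bump_ind[OF that])
  qed
  have mbump[measurable]: "bump \<alpha> \<beta> j \<in> borel_measurable borel" for \<alpha> \<beta> j
    by (rule borel_measurable_continuous_onI[OF continuous_smooth[OF smooth_bump]])
  have iDbump: "integrable lborel (\<lambda>x. D x * bump \<alpha> \<beta> j x)" for \<alpha> \<beta> j
    by (rule Bochner_Integration.integrable_bound[OF iD])
       (auto simp: abs_mult bump_bounds intro!: mult_left_le)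
  define s where "s = (\<integral>x. bump (-b) b 0 x \<partial>lborel)"
  have s: "s \<noteq> 0"
  proof
    assume "s = 0"
    have "integral {-b..b} (bump (-b) b 0) = (LBINT x:{-b..b}. bump (-b) b 0 x)"
      by (rule set_borel_integral_eq_integral(2)[symmetric, OF borel_integrable_atLeastAtMost'[OF continuous_smooth[OF smooth_bump]]])
    also have "\<dots> = s" unfolding s_def set_lebesgue_integral_def
      by (simp only: bump_ind[OF order_refl order_refl])
    finally have "\<forall>x\<in>{-b..b}. bump (-b) b 0 x = 0"
      using \<open>s = 0\<close> integral_eq_0_iff[OF continuous_smooth[OF smooth_bump], of "-b" b "-b" b 0] b bump_bounds by simp
    then show False using bump_pos[of "-b" 0 b 0] b by force
  qed
  \<comment> \<open>The constant value of D, computed as its average against a fixed reference bump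
    of mass s.\<close>
  define c where "c = (\<integral>x. D x * bump (-b) b 0 x \<partial>lborel) / s"
  have Dbump: "(\<integral>x. D x * bump \<alpha> \<beta> j x \<partial>lborel) = c * (\<integral>x. bump \<alpha> \<beta> j x \<partial>lborel)"
    if ab: "-b \<le> \<alpha>" "\<beta> \<le> b" for \<alpha> \<beta> j
  proof -
    \<comment> \<open>The multiple of the reference bump whose subtraction makes the mean
      zero.\<close>
    define r where "r = (\<integral>x. bump \<alpha> \<beta> j x \<partial>lborel) / s"
    have "(\<integral>x. D x * (bump \<alpha> \<beta> j x + (- r) * bump (-b) b 0 x) \<partial>lborel) = 0"
    proof (rule D\<eta>)
      show "smooth_upto k (\<lambda>x. bump \<alpha> \<beta> j x + - r * bump (- b) b 0 x)" for k
        by (intro smooth_upto_add smooth_upto_mult smooth_upto_const smooth_bump)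
      show "bump \<alpha> \<beta> j x + - r * bump (- b) b 0 x = 0" if "x \<notin> {-b..b}" for x
        using that ab by (subst (1 2) bump_outside) auto
      show "(\<integral>x. bump \<alpha> \<beta> j x + - r * bump (- b) b 0 x \<partial>lborel) = 0"
        using ibump[OF ab] ibump[of "-b" b 0] s by (simp add: r_def s_def)
    qed
    moreover have "D x * (bump \<alpha> \<beta> j x + (- r) * bump (-b) b 0 x) = D x * bump \<alpha> \<beta> j x - r * (D x * bump (-b) b 0 x)" for x
      by (simp add: algebra_simps)
    ultimately have "(\<integral>x. D x * bump \<alpha> \<beta> j x \<partial>lborel) = r * (\<integral>x. D x * bump (-b) b 0 x \<partial>lborel)"
      using iDbump by simp
    then show ?thesis by (simp add: r_def c_def)
  qed
  have Dint: "(\<integral>x. D x * indicator {\<alpha><..<\<beta>} x \<partial>lborel) = c * (\<beta> - \<alpha>)"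
    if ab: "-b \<le> \<alpha>" "\<beta> \<le> b" "\<alpha> \<le> \<beta>" for \<alpha> \<beta>
  proof -
    have 1: "(\<lambda>j. \<integral>x. D x * bump \<alpha> \<beta> j x \<partial>lborel) \<longlonglongrightarrow> (\<integral>x. D x * indicator {\<alpha><..<\<beta>} x \<partial>lborel)"
    proof (rule integral_dominated_convergence[where w = "\<lambda>x. norm (D x)"])
      show "AE x in lborel. (\<lambda>j. D x * bump \<alpha> \<beta> j x) \<longlonglongrightarrow> D x * indicator {\<alpha><..<\<beta>} x"
        by (intro always_eventually allI tendsto_mult tendsto_const bump_tendsto)
      show "AE x in lborel. norm (D x * bump \<alpha> \<beta> j x) \<le> norm (D x)" for j
        by (auto simp: abs_mult bump_bounds intro!: mult_left_le)
    qed (use iD in auto)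
    have 2: "(\<lambda>j. \<integral>x. bump \<alpha> \<beta> j x \<partial>lborel) \<longlonglongrightarrow> (\<integral>x. indicator {\<alpha><..<\<beta>} x \<partial>lborel)"
    proof (rule integral_dominated_convergence[where w = "indicator {\<alpha>..\<beta>}"])
      show "AE x in lborel. norm (bump \<alpha> \<beta> j x) \<le> indicator {\<alpha>..\<beta>} x" for j
        using bump_outside[of _ \<alpha> \<beta> j] bump_bounds[of \<alpha> \<beta> j] by (force simp: indicator_def intro!: always_eventually)
      show "integrable lborel (indicator {\<alpha>..\<beta>} :: real \<Rightarrow> real)"
        by (rule integrable_real_indicator) (use that in auto)
    qed (use bump_tendsto in auto)
    have "(\<integral>x. D x * indicator {\<alpha><..<\<beta>} x \<partial>lborel) = c * (\<integral>x. indicator {\<alpha><..<\<beta>} x \<partial>lborel)"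
      by (rule LIMSEQ_unique[OF 1]) (unfold Dbump[OF ab(1,2)], intro tendsto_mult tendsto_const 2)
    then show ?thesis using ab by simp
  qed
  have ii: "integrable lborel (indicator {x<..<y} :: real \<Rightarrow> real)" if "x \<le> y" for x y :: real
    by (rule integrable_real_indicator) (use that in auto)
  define v where "v x = D x * indicator {-b<..<b} x - c * indicator {-b<..<b} x" for x
  have iv: "integrable lborel v"
    unfolding v_def[abs_def]
    using integrable_mult_indicator[OF _ iD, of "{-b<..<b}"] ii[of "-b" b] b by (simp add: mult.commute)
  have "AE x in lborel. v x = 0"
  proof (rule AE_zero_if_tail_integrals_zero[OF iv])
    fix x
    \<comment> \<open>Clamping x to [-b, b] turns the tail integral of v into an integral over the
      interval from \<alpha> to b.\<close>
    define \<alpha> where "\<alpha> = min (max x (-b)) b"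
    have ab: "-b \<le> \<alpha>" "\<alpha> \<le> b" using b by (auto simp: \<alpha>_def)
    have "indicator {x<..} t * v t = D t * indicator {\<alpha><..<b} t - c * indicator {\<alpha><..<b} t" for t
      unfolding v_def \<alpha>_def using b by (auto simp: indicator_def)
    moreover have "integrable lborel (\<lambda>t. D t * indicator {\<alpha><..<b} t)"
      using integrable_mult_indicator[OF _ iD, of "{\<alpha><..<b}"] by (auto simp: mult.commute)
    ultimately show "(\<integral>t. indicator {x<..} t * v t \<partial>lborel) = 0"
      using Dint[of \<alpha> b] ab ii[of \<alpha> b] by simp
  qed
  then have ae: "AE x in lborel. x \<in> {-b..b} \<longrightarrow> f x = c + H x"
    using AE_lborel_singleton[of b] AE_lborel_singleton[of "-b"]
  proof eventually_elim
    case (elim x)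
    then show ?case unfolding v_def D_def by (cases "x \<in> {-b<..<b}") auto
  qed
  show thesis
  proof (rule that[of "\<lambda>x. c + H x"])
    show "continuous_on {-b..b} (\<lambda>x. c + H x)" by (intro continuous_intros cH)
    show "AE x in lborel. x \<in> {-b..b} \<longrightarrow> f x = c + H x" by (rule ae)
    fix x y assume xy: "-b \<le> x" "x \<le> y" "y \<le> b"
    have "H x + integral {x..y} g = H y"
      unfolding H_def
      by (rule Henstock_Kurzweil_Integration.integral_combine)
         (use xy in \<open>auto intro: integrable_subinterval_real[OF gi]\<close>)
    moreover have "set_integrable lborel {x..y} g" using sg by (rule set_integrable_subset) (use xy in auto)
    ultimately show "c + H y - (c + H x) = (LBINT t:{x..y}. g t)"
      using set_borel_integral_eq_integral(2) by force
  qed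
qed

section \<open>Steklov averages\<close>

text \<open>Cauchy-Schwarz for a Lebesgue integrable g, from the integral of
  \<open>(g t - c)\<^sup>2\<close> with c the mean of g.\<close>

lemma increment_square_le:
  fixes g :: "real \<Rightarrow> real"
  assumes g: "set_integrable lborel {x..x + h} g" and g2: "set_integrable lborel {x..x + h} (\<lambda>t. (g t)\<^sup>2)"
    and h: "0 < h"
  shows "(LBINT t:{x..x + h}. g t)\<^sup>2 \<le> h * (LBINT t:{x..x + h}. (g t)\<^sup>2)"
proof -
  define A where "A = (LBINT t:{x..x + h}. g t)"
  define B where "B = (LBINT t:{x..x + h}. (g t)\<^sup>2)"
  define c where "c = A / h"
  have "(LBINT t:{x..x + h}. c\<^sup>2) = h * c\<^sup>2"
    using h by (subst set_integral_const) auto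
  moreover have ic: "set_integrable lborel {x..x + h} (\<lambda>t. c\<^sup>2)"
    using borel_integrable_atLeastAtMost'[of x "x + h" "\<lambda>_. c\<^sup>2"] by simp
  moreover have "set_integrable lborel {x..x + h} (\<lambda>t. (2 * c) * g t)"
    using g by (rule set_integrable_mult_right)
  ultimately have eq: "(LBINT t:{x..x + h}. ((g t)\<^sup>2 - (2 * c) * g t) + c\<^sup>2) = B - (2 * c) * A + h * c\<^sup>2"
    using g g2 by (simp only: set_integral_add set_integral_diff set_integral_mult_right A_def B_def)
  have "0 \<le> (LBINT t:{x..x + h}. ((g t)\<^sup>2 - (2 * c) * g t) + c\<^sup>2)"
    unfolding set_lebesgue_integral_def
  proof (rule Bochner_Integration.integral_nonneg)
    fix t
    have "((g t)\<^sup>2 - (2 * c) * g t) + c\<^sup>2 = (g t - c)\<^sup>2" by (simp add: power2_eq_square algebra_simps)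
    then show "0 \<le> indicator {x..x + h} t *\<^sub>R (((g t)\<^sup>2 - (2 * c) * g t) + c\<^sup>2)" by simp
  qed
  then have "0 \<le> B - (2 * c) * A + h * c\<^sup>2" unfolding eq .
  moreover have "A = c * h" using h by (simp add: c_def)
  ultimately have "h * c\<^sup>2 \<le> B" by (simp add: power2_eq_square algebra_simps)
  then have "h * (h * c\<^sup>2) \<le> h * B" using h by (intro mult_left_mono) auto
  then show ?thesis unfolding A_def[symmetric] B_def[symmetric] \<open>A = c * h\<close> by (simp add: power2_eq_square mult_ac)
qed

text \<open>The squared difference quotient is at most the mean of g^2 over [x, x + h]. After
  exchanging the integrals, each t is reached from points x in a window of length h, which cancels
  the factor 1 / h; \<open>1 + \<eta>\<close> is the price for replacing Q x by Q t. All integrands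
  are nonnegative, so the exchange takes place with extended integrals.\<close>

lemma difference_quotient_energy:
  fixes Q g F :: "real \<Rightarrow> real"
  assumes r: "0 < h" "r + h \<le> b" "0 < r"
    and F: "continuous_on {-b..b} F"
    and Fg: "\<And>x y. -b \<le> x \<Longrightarrow> x \<le> y \<Longrightarrow> y \<le> b \<Longrightarrow> F y - F x = (LBINT t:{x..y}. g t)"
    and g: "set_integrable lborel {-b..b} g" and g2: "set_integrable lborel {-b..b} (\<lambda>t. (g t)\<^sup>2)"
    and Q: "continuous_on {-b..b} Q" "Q \<in> borel_measurable borel" "\<And>x. x \<in> {-b..b} \<Longrightarrow> 0 \<le> Q x"
    and \<eta>: "0 \<le> \<eta>" "\<And>x t. x \<in> {-b..b} \<Longrightarrow> t \<in> {-b..b} \<Longrightarrow> \<bar>x - t\<bar> \<le> h \<Longrightarrow> Q x \<le> (1 + \<eta>) * Q t"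
    and Qg: "set_integrable lborel {-b..b} (\<lambda>t. Q t * (g t)\<^sup>2)"
  shows "integral {-r..r} (\<lambda>x. Q x * ((F (x + h) - F x) / h)\<^sup>2) \<le> (1 + \<eta>) * (LBINT t:{-b..b}. Q t * (g t)\<^sup>2)"
proof -
  define \<gamma> where "\<gamma> t = indicator {-b..b} t * (g t)\<^sup>2" for t
  have [measurable]: "Q \<in> borel_measurable borel" by (rule Q(2))
  have [measurable]: "\<gamma> \<in> borel_measurable borel"
    using g2 unfolding set_integrable_def \<gamma>_def[abs_def] by auto
  have \<gamma>0: "0 \<le> \<gamma> t" for t by (simp add: \<gamma>_def)
  define d where "d x = Q x * ((F (x + h) - F x) / h)\<^sup>2" for x
  have cd: "continuous_on {-r..r} d"
    unfolding d_def using r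
    by (intro continuous_intros continuous_on_subset[OF Q(1)] continuous_on_subset[OF F] continuous_on_compose2[OF F]) auto
  have d0: "0 \<le> d x" if "x \<in> {-r..r}" for x
    unfolding d_def using Q(3)[of x] that r by (intro mult_nonneg_nonneg) auto
  have id: "integrable lborel (\<lambda>x. indicator {-r..r} x * d x)"
    using borel_integrable_atLeastAtMost'[OF cd] unfolding set_integrable_def by simp
  have pt: "ennreal (indicator {-r..r} x * d x)
      \<le> (\<integral>\<^sup>+t. ennreal (\<gamma> t * (1 / h) * (if -r \<le> x \<and> x \<le> r \<and> x \<le> t \<and> t \<le> x + h then Q x else 0)) \<partial>lborel)" for x
  proof (cases "x \<in> {-r..r}")
    case True
    have sub: "{x..x + h} \<subseteq> {-b..b}" using True r by auto
    have i1: "set_integrable lborel {x..x + h} g" and i2: "set_integrable lborel {x..x + h} (\<lambda>t. (g t)\<^sup>2)"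
      using set_integrable_subset[OF g _ sub] set_integrable_subset[OF g2 _ sub] by auto
    have Qx: "0 \<le> Q x" using Q(3)[of x] sub r by auto
    have "F (x + h) - F x = (LBINT t:{x..x + h}. g t)" using sub r by (intro Fg) auto
    then have "(F (x + h) - F x)\<^sup>2 \<le> h * (LBINT t:{x..x + h}. (g t)\<^sup>2)"
      using increment_square_le[OF i1 i2 r(1)] by simp
    then have "((F (x + h) - F x) / h)\<^sup>2 \<le> h * (LBINT t:{x..x + h}. (g t)\<^sup>2) / h\<^sup>2"
      unfolding power_divide by (rule divide_right_mono) simp
    also have "\<dots> = (1 / h) * (LBINT t:{x..x + h}. (g t)\<^sup>2)"
      using r by (simp add: power2_eq_square)
    finally have "((F (x + h) - F x) / h)\<^sup>2 \<le> (1 / h) * (LBINT t:{x..x + h}. (g t)\<^sup>2)" .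
    then have "d x \<le> Q x * ((1 / h) * (LBINT t:{x..x + h}. (g t)\<^sup>2))"
      unfolding d_def using Qx by (intro mult_left_mono) auto
    also have "\<dots> = (\<integral>t. (Q x * (1 / h)) * (indicator {x..x + h} t * (g t)\<^sup>2) \<partial>lborel)"
      by (simp add: set_lebesgue_integral_def)
    finally have le: "d x \<le> (\<integral>t. (Q x * (1 / h)) * (indicator {x..x + h} t * (g t)\<^sup>2) \<partial>lborel)" .
    have "ennreal (d x) \<le> ennreal (\<integral>t. (Q x * (1 / h)) * (indicator {x..x + h} t * (g t)\<^sup>2) \<partial>lborel)"
      using le by (rule ennreal_leI)
    also have "\<dots> = (\<integral>\<^sup>+t. ennreal ((Q x * (1 / h)) * (indicator {x..x + h} t * (g t)\<^sup>2)) \<partial>lborel)"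
      using i2 Qx r unfolding set_integrable_def
      by (intro nn_integral_eq_integral[symmetric]) (auto intro!: integrable_mult_right)
    also have "\<dots> = (\<integral>\<^sup>+t. ennreal (\<gamma> t * (1 / h) * (if -r \<le> x \<and> x \<le> r \<and> x \<le> t \<and> t \<le> x + h then Q x else 0)) \<partial>lborel)"
      by (intro nn_integral_cong) (use True r in \<open>auto simp: \<gamma>_def indicator_def mult.commute\<close>)
    finally show ?thesis using True by simp
  qed simp
  have inner: "(\<integral>\<^sup>+x. ennreal (\<gamma> t * (1 / h) * (if -r \<le> x \<and> x \<le> r \<and> x \<le> t \<and> t \<le> x + h then Q x else 0)) \<partial>lborel)
      \<le> ennreal ((1 + \<eta>) * (Q t * \<gamma> t))" for t
  proof (cases "t \<in> {-b..b}")
    case True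
    have Qt: "0 \<le> Q t" using Q(3)[OF True] .
    have "(\<integral>\<^sup>+x. ennreal (\<gamma> t * (1 / h) * (if -r \<le> x \<and> x \<le> r \<and> x \<le> t \<and> t \<le> x + h then Q x else 0)) \<partial>lborel)
        \<le> (\<integral>\<^sup>+x. ennreal (\<gamma> t * (1 / h) * ((1 + \<eta>) * Q t)) * indicator {t - h..t} x \<partial>lborel)"
    proof (rule nn_integral_mono)
      fix x
      show "ennreal (\<gamma> t * (1 / h) * (if -r \<le> x \<and> x \<le> r \<and> x \<le> t \<and> t \<le> x + h then Q x else 0))
          \<le> ennreal (\<gamma> t * (1 / h) * ((1 + \<eta>) * Q t)) * indicator {t - h..t} x"
      proof (cases "-r \<le> x \<and> x \<le> r \<and> x \<le> t \<and> t \<le> x + h")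
        case c: True
        have "Q x \<le> (1 + \<eta>) * Q t" using c True r by (intro \<eta>(2)) auto
        then have "\<gamma> t * (1 / h) * Q x \<le> \<gamma> t * (1 / h) * ((1 + \<eta>) * Q t)"
          using \<gamma>0[of t] r by (intro mult_left_mono mult_nonneg_nonneg) auto
        then show ?thesis using c by (simp add: ennreal_leI)
      next
        case False
        then show ?thesis by (subst if_not_P[OF False]) simp
      qed
    qed
    also have "\<dots> = ennreal (\<gamma> t * (1 / h) * ((1 + \<eta>) * Q t)) * ennreal h"
      using r by (subst nn_integral_cmult_indicator) auto
    also have "\<dots> = ennreal ((1 + \<eta>) * (Q t * \<gamma> t))"
    proof -
      have "\<gamma> t * (1 / h) * ((1 + \<eta>) * Q t) * h = (1 + \<eta>) * (Q t * \<gamma> t)" using r by simp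
      then show ?thesis using r \<gamma>0[of t] \<eta>(1) Qt by (subst ennreal_mult'[symmetric]) auto
    qed
    finally show ?thesis .
  qed (simp add: \<gamma>_def)
  have iQ: "integrable lborel (\<lambda>t. Q t * \<gamma> t)"
    using Qg unfolding set_integrable_def \<gamma>_def by (simp add: mult_ac)
  have Q\<gamma>0: "0 \<le> Q t * \<gamma> t" for t using Q(3)[of t] by (auto simp: \<gamma>_def indicator_def)
  have "ennreal (\<integral>x. indicator {-r..r} x * d x \<partial>lborel) = (\<integral>\<^sup>+x. ennreal (indicator {-r..r} x * d x) \<partial>lborel)"
    by (rule nn_integral_eq_integral[OF id, symmetric]) (use d0 in \<open>auto simp: indicator_def\<close>)
  also have "\<dots> \<le> (\<integral>\<^sup>+x. (\<integral>\<^sup>+t. ennreal (\<gamma> t * (1 / h) * (if -r \<le> x \<and> x \<le> r \<and> x \<le> t \<and> t \<le> x + h then Q x else 0)) \<partial>lborel) \<partial>lborel)"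
    by (intro nn_integral_mono pt)
  also have "\<dots> = (\<integral>\<^sup>+t. (\<integral>\<^sup>+x. ennreal (\<gamma> t * (1 / h) * (if -r \<le> x \<and> x \<le> r \<and> x \<le> t \<and> t \<le> x + h then Q x else 0)) \<partial>lborel) \<partial>lborel)"
    by (rule lborel_pair.Fubini') measurable
  also have "\<dots> \<le> (\<integral>\<^sup>+t. ennreal ((1 + \<eta>) * (Q t * \<gamma> t)) \<partial>lborel)"
    by (intro nn_integral_mono inner)
  also have "\<dots> = ennreal (\<integral>t. (1 + \<eta>) * (Q t * \<gamma> t) \<partial>lborel)"
    using iQ Q\<gamma>0 \<eta>(1) by (intro nn_integral_eq_integral integrable_mult_right) auto
  finally have "(\<integral>x. indicator {-r..r} x * d x \<partial>lborel) \<le> (\<integral>t. (1 + \<eta>) * (Q t * \<gamma> t) \<partial>lborel)"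
    using \<eta>(1) Q\<gamma>0 by (subst (asm) ennreal_le_iff) (auto intro!: Bochner_Integration.integral_nonneg)
  moreover have "(\<integral>x. indicator {-r..r} x * d x \<partial>lborel) = integral {-r..r} d"
    using set_borel_integral_eq_integral(2)[OF borel_integrable_atLeastAtMost'[OF cd]] by (simp add: set_lebesgue_integral_def)
  moreover have "(\<integral>t. (1 + \<eta>) * (Q t * \<gamma> t) \<partial>lborel) = (1 + \<eta>) * (LBINT t:{-b..b}. Q t * (g t)\<^sup>2)"
    unfolding integral_mult_right_zero by (simp add: set_lebesgue_integral_def \<gamma>_def mult_ac)
  ultimately show ?thesis unfolding d_def by linarith
qed

text \<open>Forward averages are chosen because their derivative is exactly the difference quotient
  of F, to which \<open>difference_quotient_energy\<close> applies. The gap between r and b leaves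
  room for the shift, and the sup bound is the mean value theorem for the primitive.\<close>

lemma steklov_average:
  fixes F :: "real \<Rightarrow> real"
  assumes r: "0 < r" "r < b" and F: "continuous_on {-b..b} F" and M: "\<And>x. x \<in> {-b..b} \<Longrightarrow> \<bar>F x\<bar> \<le> M"
  obtains S where
    "\<And>h. 0 < h \<Longrightarrow> r + h < b \<Longrightarrow> C1_on (-r) r (S h) (\<lambda>x. (F (x + h) - F x) / h)"
    "\<And>h x. 0 < h \<Longrightarrow> r + h < b \<Longrightarrow> x \<in> {-r..r} \<Longrightarrow> \<bar>S h x\<bar> \<le> M"
    "\<And>x. x \<in> {-r..r} \<Longrightarrow> ((\<lambda>h. S h x) \<longlongrightarrow> F x) (at_right 0)"
proof -
  define \<Phi> where "\<Phi> x = integral {-b..x} F" for x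
  have D: "(\<Phi> has_real_derivative F x) (at x)" if "-b < x" "x < b" for x
  proof -
    have "(\<Phi> has_real_derivative F x) (at x within {-b..b})"
      unfolding \<Phi>_def by (rule integral_has_real_derivative[OF F]) (use that in auto)
    moreover have "at x within {-b..b} = at x" using that by (intro at_within_interior) auto
    ultimately show ?thesis by simp
  qed
  define S where "S h x = (\<Phi> (x + h) - \<Phi> x) / h" for h x
  show thesis
  proof (rule that[of S])
    fix h assume h: "0 < h" "r + h < b"
    show "C1_on (-r) r (S h) (\<lambda>x. (F (x + h) - F x) / h)"
      unfolding C1_on_def
    proof (intro conjI ballI)
      show "continuous_on {-r..r} (\<lambda>x. (F (x + h) - F x) / h)"
        using r h by (intro continuous_intros continuous_on_subset[OF F] continuous_on_compose2[OF F]) auto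
      fix x assume x: "x \<in> {-r..r}"
      have D1: "((\<lambda>x. \<Phi> (x + h)) has_real_derivative F (x + h)) (at x)"
        using DERIV_shift[of \<Phi> "F (x + h)" x h] D[of "x + h"] x r h by simp
      have "(\<Phi> has_real_derivative F x) (at x)" using D[of x] x r by simp
      from DERIV_cdivide[OF DERIV_diff[OF D1 this]]
      have "(S h has_real_derivative (F (x + h) - F x) / h) (at x)" unfolding S_def[abs_def] .
      then show "(S h has_real_derivative (F (x + h) - F x) / h) (at x within {-r..r})"
        by (rule has_field_derivative_at_within)
    qed
    fix x assume x: "x \<in> {-r..r}"
    obtain z where z: "x < z" "z < x + h" "\<Phi> (x + h) - \<Phi> x = (x + h - x) * F z"
    proof -
      have "\<exists>z>x. z < x + h \<and> \<Phi> (x + h) - \<Phi> x = (x + h - x) * F z"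
        by (rule MVT2) (use D x r h in auto)
      then show thesis using that by blast
    qed
    then have "S h x = F z" using h by (simp add: S_def)
    then show "\<bar>S h x\<bar> \<le> M" using M[of z] z x r h by simp
  next
    fix x assume x: "x \<in> {-r..r}"
    have "((\<lambda>h. S h x) \<longlongrightarrow> F x) (at 0)"
      using D[of x] x r unfolding S_def DERIV_def by simp
    then show "((\<lambda>h. S h x) \<longlongrightarrow> F x) (at_right 0)"
      by (rule tendsto_mono[rotated]) (simp add: at_le)
  qed
qed

text \<open>A positive C^1 substitute for the absolute value of g whose derivative is no larger than
  that of g, because the inequality for C^1 functions asks for positivity.\<close>

lemma C1_on_sqrt_shift:
  assumes g: "C1_on a b g g'" and d: "\<delta> > 0"
  shows "C1_on a b (\<lambda>x. sqrt ((g x)\<^sup>2 + \<delta>\<^sup>2)) (\<lambda>x. g x * g' x / sqrt ((g x)\<^sup>2 + \<delta>\<^sup>2))"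
    "(g x * g' x / sqrt ((g x)\<^sup>2 + \<delta>\<^sup>2))\<^sup>2 \<le> (g' x)\<^sup>2" "0 < sqrt ((g x)\<^sup>2 + \<delta>\<^sup>2)"
proof -
  have pos: "0 < (g x)\<^sup>2 + \<delta>\<^sup>2" for x using d by (simp add: add_nonneg_pos)
  then show "0 < sqrt ((g x)\<^sup>2 + \<delta>\<^sup>2)" by simp
  show "C1_on a b (\<lambda>x. sqrt ((g x)\<^sup>2 + \<delta>\<^sup>2)) (\<lambda>x. g x * g' x / sqrt ((g x)\<^sup>2 + \<delta>\<^sup>2))"
    unfolding C1_on_def
  proof (intro conjI ballI)
    have "sqrt ((g x)\<^sup>2 + \<delta>\<^sup>2) \<noteq> 0" for x using pos[of x] by (metis less_irrefl real_sqrt_eq_zero_cancel_iff)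
    then show "continuous_on {a..b} (\<lambda>x. g x * g' x / sqrt ((g x)\<^sup>2 + \<delta>\<^sup>2))"
      by (intro continuous_on_divide continuous_on_mult continuous_on_real_sqrt continuous_on_add continuous_on_power
          continuous_on_const C1_on_continuous[OF g] C1_on_cont_deriv[OF g]) blast
    fix x assume "x \<in> {a..b}"
    then have d: "(g has_real_derivative g' x) (at x within {a..b})" using g unfolding C1_on_def by auto
    have d2: "((\<lambda>x. (g x)\<^sup>2 + \<delta>\<^sup>2) has_real_derivative 2 * (g x * g' x)) (at x within {a..b})"
      by (rule DERIV_cong[OF DERIV_add[OF DERIV_power[OF d] DERIV_const]]) simp
    show "((\<lambda>x. sqrt ((g x)\<^sup>2 + \<delta>\<^sup>2)) has_real_derivative g x * g' x / sqrt ((g x)\<^sup>2 + \<delta>\<^sup>2)) (at x within {a..b})"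
      by (rule DERIV_cong[OF DERIV_chain2[OF DERIV_real_sqrt[OF pos] d2]]) (simp add: field_simps)
  qed
  have "(g x * g' x / sqrt ((g x)\<^sup>2 + \<delta>\<^sup>2))\<^sup>2 = ((g x)\<^sup>2 / ((g x)\<^sup>2 + \<delta>\<^sup>2)) * (g' x)\<^sup>2"
    using pos[of x] by (simp add: power_divide power_mult_distrib)
  also have "\<dots> \<le> 1 * (g' x)\<^sup>2" using pos[of x] by (intro mult_right_mono) auto
  finally show "(g x * g' x / sqrt ((g x)\<^sup>2 + \<delta>\<^sup>2))\<^sup>2 \<le> (g' x)\<^sup>2" by simp
qed

section \<open>The inequality on truncated intervals\<close>

definition weight :: "real \<Rightarrow> real \<Rightarrow> real" where
  "weight n x = rho x powr (n - 2)"

lemma one_minus_square_pos: "\<bar>x\<bar> < 1 \<Longrightarrow> 0 < 1 - (x::real)\<^sup>2"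
  by (simp add: abs_square_less_1)

lemma weight_eq: "\<bar>x\<bar> < 1 \<Longrightarrow> weight n x = (1 - x\<^sup>2) powr ((n - 2) / 2)"
proof -
  assume "\<bar>x\<bar> < 1"
  then have "0 < 1 - x\<^sup>2" by (simp add: abs_square_less_1)
  then show ?thesis unfolding weight_def rho_def by (simp add: powr_half_sqrt[symmetric] powr_powr)
qed

lemma weight_nonneg: "0 \<le> weight n x"
  by (simp add: weight_def)

lemma weight_pos: "\<bar>x\<bar> < 1 \<Longrightarrow> 0 < weight n x"
  using one_minus_square_pos[of x] by (simp add: weight_def rho_def)

lemma weight_outside: "x \<in> {-1..1} \<Longrightarrow> x \<notin> {-1<..<1} \<Longrightarrow> weight n x = 0"
  by (force simp: weight_def rho_def)

lemma weight_measurable [measurable]: "weight n \<in> borel_measurable borel"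
  unfolding weight_def[abs_def] rho_def[abs_def] by measurable

lemma continuous_on_weight: "S \<subseteq> {-1<..<1} \<Longrightarrow> continuous_on S (weight n)"
proof -
  assume S: "S \<subseteq> {-1<..<1}"
  have *: "\<bar>x\<bar> < 1" if "x \<in> S" for x
    using subsetD[OF S that] by auto
  have "continuous_on S (\<lambda>x. (1 - x\<^sup>2) powr ((n - 2) / 2))"
    by (intro continuous_intros) (use one_minus_square_pos[OF *] in force)
  then show ?thesis by (rule continuous_on_eq) (simp add: weight_eq[OF *])
qed

text \<open>Inside the interval the product is \<open>(1 - x\<^sup>2) powr (n / 2)\<close>, and its
  exponent is the source of the n in the operator and in the Bochner identity.\<close>

lemma rho_weight_deriv:
  assumes "\<bar>x\<bar> < 1"
  shows "((\<lambda>x. (1 - x\<^sup>2) * weight n x) has_real_derivative - n * x * weight n x) (at x)"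
proof -
  have pos: "0 < 1 - x\<^sup>2" using assms by (rule one_minus_square_pos)
  have d: "((\<lambda>x. 1 - x\<^sup>2) has_real_derivative - 2 * x) (at x)" by (auto intro!: derivative_eq_intros)
  have "((\<lambda>x. (1 - x\<^sup>2) powr (n / 2)) has_real_derivative n / 2 * (1 - x\<^sup>2) powr (n / 2 - 1) * (- 2 * x)) (at x)"
    using DERIV_fun_powr[OF d pos, of "n / 2"] by simp
  also have "n / 2 * (1 - x\<^sup>2) powr (n / 2 - 1) * (- 2 * x) = - n * x * weight n x"
    using weight_eq[OF assms, of n] by (simp add: diff_divide_distrib)
  finally show ?thesis
  proof (rule has_field_derivative_transform_within_open[where S = "{-1<..<1}"])
    fix y :: real assume "y \<in> {-1<..<1}"
    then have y: "\<bar>y\<bar> < 1" by auto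
    have "(1 - y\<^sup>2) powr (n / 2) = (1 - y\<^sup>2) powr (1 + (n - 2) / 2)" by (simp add: field_simps)
    also have "\<dots> = (1 - y\<^sup>2) powr 1 * (1 - y\<^sup>2) powr ((n - 2) / 2)" by (rule powr_add)
    finally show "(1 - y\<^sup>2) powr (n / 2) = (1 - y\<^sup>2) * weight n y"
      using one_minus_square_pos[OF y] weight_eq[OF y, of n] by simp
  qed (use assms in auto)
qed

lemma set_integral_AE_eq:
  fixes u v :: "real \<Rightarrow> real"
  assumes "set_integrable lborel S v" "(\<lambda>x. indicator S x * u x) \<in> borel_measurable borel"
    "AE x in lborel. x \<in> S \<longrightarrow> u x = v x"
  shows "set_integrable lborel S u" "(LBINT x:S. u x) = (LBINT x:S. v x)"
proof -
  have m: "(\<lambda>x. indicator S x * v x) \<in> borel_measurable borel"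
    using assms(1) unfolding set_integrable_def by auto
  have ae: "AE x in lborel. indicator S x * u x = indicator S x * v x"
    using assms(3) by eventually_elim (auto simp: indicator_def)
  show "set_integrable lborel S u"
    using assms(1) integrable_cong_AE[of _ lborel, OF _ _ ae] assms(2) m unfolding set_integrable_def by simp
  show "(LBINT x:S. u x) = (LBINT x:S. v x)"
    using integral_cong_AE[of _ lborel, OF _ _ ae] assms(2) m unfolding set_lebesgue_integral_def by simp
qed

text \<open>Passage from positive C^1 functions to a Sobolev function. The energy on the right
  extends over the whole interval and only the prefactor 1 / m depends on r, so the estimate is
  ready for the limit r to 1.\<close>

lemma truncated_inequality:
  assumes n: "0 < n" and p: "1 < p" "p \<noteq> 2" and adm: "(n - 2) * (p - 1) \<le> n + 2"
    and wd: "has_weak_deriv f g" and r: "0 < r" "r < 1"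
    and A: "set_integrable lborel {-1<..<1} (\<lambda>x. (1 - x\<^sup>2) * weight n x * (g x)\<^sup>2)"
  defines "m \<equiv> (LBINT x:{-r..r}. weight n x)"
  shows "0 < m" "set_integrable lborel {-r..r} (\<lambda>x. weight n x * \<bar>f x\<bar> powr p)"
    "n / (p - 2) * ((1 / m) * (LBINT x:{-r..r}. weight n x * \<bar>f x\<bar> powr p)) powr (2 / p)
      \<le> (1 / m) * (LBINT x:{-1<..<1}. (1 - x\<^sup>2) * weight n x * (g x)\<^sup>2)
        + n / (p - 2) * ((1 / m) * (LBINT x:{-r..r}. weight n x * (f x)\<^sup>2))"
proof -
  define k where "k = n / (p - 2)"
  \<comment> \<open>An intermediate radius: the Steklov shift needs values beyond r, while the
    weight has to stay bounded and positive on [-b, b].\<close>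
  define b where "b = (1 + r) / 2"
  have b: "0 < b" "b < 1" "r < b" using r by (auto simp: b_def)
  have bs: "{-b..b} \<subseteq> {-1<..<1}" "{-r..r} \<subseteq> {-b..b}" "{-r..r} \<subseteq> {-1<..<1}" using b r by auto
  define Q where "Q x = (1 - x\<^sup>2) * weight n x" for x
  have Qm: "Q \<in> borel_measurable borel" unfolding Q_def[abs_def] by measurable
  have cQ: "continuous_on {-b..b} Q"
    unfolding Q_def by (intro continuous_intros continuous_on_weight bs)
  have Qpos: "0 < Q x" if "\<bar>x\<bar> < 1" for x
    unfolding Q_def using one_minus_square_pos[OF that] weight_pos[OF that] by simp
  have Q0: "0 \<le> Q x" if "x \<in> {-b..b}" for x
    by (intro less_imp_le Qpos) (use that b in auto)
  \<comment> \<open>The minimum of Q is positive, hence g itself is square integrable on [-b, b]; it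
    also serves below as a unit for the modulus of continuity of Q.\<close>
  obtain z where z: "z \<in> {-b..b}" "\<And>x. x \<in> {-b..b} \<Longrightarrow> Q z \<le> Q x"
    using continuous_attains_inf[of "{-b..b}" Q] cQ b by auto
  have Qz: "0 < Q z" using Qpos[of z] z(1) b by auto
  obtain F where F: "continuous_on {-b..b} F" "AE x in lborel. x \<in> {-b..b} \<longrightarrow> f x = F x"
    "\<And>x y. -b \<le> x \<Longrightarrow> x \<le> y \<Longrightarrow> y \<le> b \<Longrightarrow> F y - F x = (LBINT t:{x..y}. g t)"
    using weak_derivative_continuous_representative[OF wd b(1,2)] by blast
  have sf: "set_integrable lborel {-b..b} f" and sg: "set_integrable lborel {-b..b} g"
    using wd bs(1) compact_Icc unfolding has_weak_deriv_def locally_integrable_def by blast+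
  have Ab: "set_integrable lborel {-b..b} (\<lambda>x. Q x * (g x)\<^sup>2)"
    unfolding Q_def by (rule set_integrable_subset[OF A _ bs(1)]) simp
  have sg2: "set_integrable lborel {-b..b} (\<lambda>x. (g x)\<^sup>2)"
  proof (rule set_integrable_bound)
    show "set_integrable lborel {-b..b} (\<lambda>x. (1 / Q z) * (Q x * (g x)\<^sup>2))"
      using Ab by (rule set_integrable_mult_right)
    have "(\<lambda>x. (indicator {-b..b} x *\<^sub>R g x)\<^sup>2) \<in> borel_measurable lborel"
      using sg unfolding set_integrable_def by (intro borel_measurable_power) auto
    moreover have "(indicator {-b..b} x *\<^sub>R g x)\<^sup>2 = indicator {-b..b} x *\<^sub>R (g x)\<^sup>2" for x
      by (simp add: indicator_def)
    ultimately show "set_borel_measurable lborel {-b..b} (\<lambda>x. (g x)\<^sup>2)"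
      unfolding set_borel_measurable_def by (simp only:)
    show "AE x in lborel. x \<in> {-b..b} \<longrightarrow> norm ((g x)\<^sup>2) \<le> norm ((1 / Q z) * (Q x * (g x)\<^sup>2))"
    proof (intro always_eventually allI impI)
      fix x assume x: "x \<in> {-b..b}"
      have "1 \<le> Q x / Q z" using z(2)[OF x] Qz by simp
      then have "1 * (g x)\<^sup>2 \<le> Q x / Q z * (g x)\<^sup>2" by (rule mult_right_mono) simp
      then show "norm ((g x)\<^sup>2) \<le> norm ((1 / Q z) * (Q x * (g x)\<^sup>2))" using Qz Q0[OF x] by (simp add: abs_mult)
    qed
  qed
  have nnQ: "0 \<le> indicator {-1<..<1} x *\<^sub>R (Q x * (g x)\<^sup>2)" for x
  proof (cases "x \<in> {-1<..<1}")
    case True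
    then have "0 \<le> Q x * (g x)\<^sup>2" by (intro mult_nonneg_nonneg less_imp_le[OF Qpos]) auto
    then show ?thesis by simp
  qed simp
  define Atot where "Atot = (LBINT x:{-1<..<1}. Q x * (g x)\<^sup>2)"
  have Able: "(LBINT x:{-b..b}. Q x * (g x)\<^sup>2) \<le> Atot"
    unfolding Atot_def set_lebesgue_integral_def
  proof (rule integral_mono)
    show "integrable lborel (\<lambda>x. indicator {-b..b} x *\<^sub>R (Q x * (g x)\<^sup>2))" using Ab unfolding set_integrable_def .
    show "integrable lborel (\<lambda>x. indicator {-1<..<1} x *\<^sub>R (Q x * (g x)\<^sup>2))" using A unfolding set_integrable_def Q_def .
    fix x show "indicator {-b..b} x *\<^sub>R (Q x * (g x)\<^sup>2) \<le> indicator {-1<..<1} x *\<^sub>R (Q x * (g x)\<^sup>2)"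
    proof (cases "x \<in> {-b..b}")
      case True
      then show ?thesis using subsetD[OF bs(1) True] by simp
    next
      case False
      then show ?thesis using nnQ[of x] by simp
    qed
  qed
  have Atot0: "0 \<le> Atot"
    unfolding Atot_def set_lebesgue_integral_def
  proof (rule Bochner_Integration.integral_nonneg)
    fix x show "0 \<le> indicator {-1<..<1} x *\<^sub>R (Q x * (g x)\<^sup>2)" by (rule nnQ)
  qed
  have cwn: "continuous_on {-r..r} (weight n)" by (intro continuous_on_weight bs)
  have mH: "m = integral {-r..r} (weight n)"
    unfolding m_def by (rule set_borel_integral_eq_integral(2)[OF borel_integrable_atLeastAtMost'[OF cwn]])
  have wpos: "0 < weight n x" if "x \<in> {-r..r}" for x using that r by (intro weight_pos) auto
  show m: "0 < m"
  proof -
    have "0 \<le> m" unfolding mH by (intro integral_nonneg integrable_continuous_interval cwn weight_nonneg)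
    moreover have "m \<noteq> 0" unfolding mH
      using integral_eq_0_iff[OF cwn] wpos[of 0] wpos r by (force simp: less_imp_le)
    ultimately show ?thesis by simp
  qed
  define w where "w x = weight n x / m" for x
  define P where "P x = (1 - x\<^sup>2) * w x" for x
  have P_Q: "P x = (1 / m) * Q x" for x by (simp add: P_def w_def Q_def)
  have wi: "weighted_interval (-r) r P w"
  proof
    show "continuous_on {-r..r} P" unfolding P_Q[abs_def] by (intro continuous_intros continuous_on_subset[OF cQ bs(2)])
    show "continuous_on {-r..r} w" unfolding w_def using m by (intro continuous_intros cwn) auto
    show "0 < P x" if "x \<in> {-r..r}" for x unfolding P_Q using Qpos[of x] m that r by auto
    show "0 < w x" if "x \<in> {-r..r}" for x unfolding w_def using wpos[OF that] m by simp
    show "integral {-r..r} w = 1" unfolding w_def using m mH by simp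
  qed (use r in auto)
  interpret weighted_interval "-r" r P w by (rule wi)
  obtain M where M: "\<And>x. x \<in> {-b..b} \<Longrightarrow> \<bar>F x\<bar> \<le> M"
  proof -
    have "bounded (F ` {-b..b})" by (intro compact_imp_bounded compact_continuous_image F(1) compact_Icc)
    then obtain B where "\<forall>y\<in>F ` {-b..b}. norm y \<le> B" unfolding bounded_iff by blast
    then show thesis by (intro that[of B]) auto
  qed
  have M0: "0 \<le> M" using M[of 0] b by auto
  obtain S where S: "\<And>h. 0 < h \<Longrightarrow> r + h < b \<Longrightarrow> C1_on (-r) r (S h) (\<lambda>x. (F (x + h) - F x) / h)"
    "\<And>h x. 0 < h \<Longrightarrow> r + h < b \<Longrightarrow> x \<in> {-r..r} \<Longrightarrow> \<bar>S h x\<bar> \<le> M"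
    "\<And>x. x \<in> {-r..r} \<Longrightarrow> ((\<lambda>h. S h x) \<longlongrightarrow> F x) (at_right 0)"
    using steklov_average[OF r(1) b(3) F(1) M] by blast
  have cF: "continuous_on {-r..r} F" by (rule continuous_on_subset[OF F(1) bs(2)])
  have step: "k * integral {-r..r} (\<lambda>x. w x * \<bar>F x\<bar> powr p) powr (2 / p)
      \<le> (1 / m) * ((1 + \<eta>) * Atot) + k * integral {-r..r} (\<lambda>x. w x * (F x)\<^sup>2)" if \<eta>: "0 < \<eta>" for \<eta>
  proof -
    have "uniformly_continuous_on {-b..b} Q" by (intro compact_uniformly_continuous cQ compact_Icc)
    \<comment> \<open>With the tolerance \<open>\<eta> * Q z\<close>, Q z being the minimum, the
      additive modulus of continuity becomes the factor \<open>1 + \<eta>\<close> asked for by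
      \<open>difference_quotient_energy\<close>.\<close>
    then obtain d where d: "d > 0" "\<And>x t. x \<in> {-b..b} \<Longrightarrow> t \<in> {-b..b} \<Longrightarrow> dist t x < d \<Longrightarrow> dist (Q t) (Q x) < \<eta> * Q z"
      unfolding uniformly_continuous_on_def using \<eta> Qz by (metis mult_pos_pos)
    define c where "c = min ((b - r) / 2) (d / 2)"
    have "0 < (b - r) / 2" "0 < d / 2" using b(3) d(1) by simp_all
    then have c: "0 < c" "c \<le> (b - r) / 2" "c \<le> d / 2"
      unfolding c_def by (simp_all only: min_less_iff_conj simp_thms min.cobounded1 min.cobounded2)
    define h where "h j = c * inverse (real (Suc j))" for j
    have hj: "0 < h j" "r + h j < b" "h j < d" for j
    proof -
      show "0 < h j" unfolding h_def using c(1) by simp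
      have "inverse (real (Suc j)) \<le> 1" by (simp add: inverse_le_1_iff)
      then have "c * inverse (real (Suc j)) \<le> c * 1" using c(1) by (intro mult_left_mono) auto
      then have "h j \<le> c" unfolding h_def by simp
      then show "r + h j < b" "h j < d" using c b(3) d(1) by (simp_all add: field_simps)
    qed
    have hlim: "filterlim h (at_right 0) sequentially"
    proof (rule filterlim_at_withinI)
      have "(\<lambda>j. c * inverse (real (Suc j))) \<longlonglongrightarrow> c * 0"
        by (rule tendsto_mult[OF tendsto_const LIMSEQ_inverse_real_of_nat])
      then show "h \<longlonglongrightarrow> 0" unfolding h_def[abs_def] by simp
      show "\<forall>\<^sub>F j in sequentially. h j \<in> {0<..} - {0}" using hj(1) by auto
    qed
    define \<delta> where "\<delta> j = inverse (real (Suc j))" for j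
    have \<delta>: "0 < \<delta> j" "\<delta> j \<le> 1" for j by (auto simp: \<delta>_def inverse_le_1_iff)
    define T where "T j x = sqrt ((S (h j) x)\<^sup>2 + (\<delta> j)\<^sup>2)" for j x
    define T' where "T' j x = S (h j) x * ((F (x + h j) - F x) / h j) / sqrt ((S (h j) x)\<^sup>2 + (\<delta> j)\<^sup>2)" for j x
    note Sj = S(1)[OF hj(1,2)]
    have T: "C1_on (-r) r (T j) (T' j)" "0 < T j x" "(T' j x)\<^sup>2 \<le> ((F (x + h j) - F x) / h j)\<^sup>2" for j x
      using C1_on_sqrt_shift[OF Sj \<delta>(1)] unfolding T_def[abs_def] T'_def[abs_def] by blast+
    have Tb: "\<bar>T j x\<bar> \<le> M + 1" if "x \<in> {-r..r}" for j x
    proof -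
      have "T j x \<le> \<bar>S (h j) x\<bar> + \<bar>\<delta> j\<bar>" unfolding T_def by (rule sqrt_sum_squares_le_sum_abs)
      then show ?thesis using T(2)[of j x] S(2)[OF hj(1,2) that, of j] \<delta>[of j] by simp
    qed
    have Tlim: "(\<lambda>j. T j x) \<longlonglongrightarrow> \<bar>F x\<bar>" if x: "x \<in> {-r..r}" for x
    proof -
      have "(\<lambda>j. S (h j) x) \<longlonglongrightarrow> F x" by (rule filterlim_compose[OF S(3)[OF x] hlim])
      moreover have "\<delta> \<longlonglongrightarrow> 0" unfolding \<delta>_def[abs_def] by (rule LIMSEQ_inverse_real_of_nat)
      ultimately have "(\<lambda>j. sqrt ((S (h j) x)\<^sup>2 + (\<delta> j)\<^sup>2)) \<longlonglongrightarrow> sqrt ((F x)\<^sup>2 + 0\<^sup>2)"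
        by (intro tendsto_real_sqrt tendsto_add tendsto_power)
      then show ?thesis unfolding T_def by simp
    qed
    note cT = C1_on_continuous[OF T(1)]
    have hp: "continuous_on UNIV (\<lambda>y::real. \<bar>y\<bar> powr p)"
      by (rule continuous_on_powr') (use p in \<open>auto intro!: continuous_intros\<close>)
    have L1: "(\<lambda>j. integral {-r..r} (\<lambda>x. w x * \<bar>T j x\<bar> powr p)) \<longlonglongrightarrow> integral {-r..r} (\<lambda>x. w x * \<bar>\<bar>F x\<bar>\<bar> powr p)"
      by (rule integral_w_compose_tendsto[OF cT Tb Tlim hp])
    have L2: "(\<lambda>j. integral {-r..r} (\<lambda>x. w x * (T j x)\<^sup>2)) \<longlonglongrightarrow> integral {-r..r} (\<lambda>x. w x * \<bar>F x\<bar>\<^sup>2)"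
      by (rule integral_w_compose_tendsto[OF cT Tb Tlim continuous_on_power[OF continuous_on_id]])
    have I0: "0 \<le> integral {-r..r} (\<lambda>x. w x * \<bar>T j x\<bar> powr p)" for j
      by (intro integral_w_nonneg continuous_on_compose2[OF hp cT]) auto
    have ineq: "k * integral {-r..r} (\<lambda>x. w x * \<bar>T j x\<bar> powr p) powr (2 / p)
        \<le> (1 / m) * ((1 + \<eta>) * Atot) + k * integral {-r..r} (\<lambda>x. w x * (T j x)\<^sup>2)" for j
    proof -
      have "n / (p - 2) * integral {-r..r} (\<lambda>x. w x * T j x powr p) powr (2 / p)
         \<le> integral {-r..r} (\<lambda>x. P x * (T' j x)\<^sup>2) + n / (p - 2) * integral {-r..r} (\<lambda>x. w x * (T j x)\<^sup>2)"
      proof (rule ultraspherical_C1_inequality[OF wi n p adm _ _ _ T(1,2)])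
        show "x\<^sup>2 < 1" if "x \<in> {-r..r}" for x using one_minus_square_pos[of x] that r by auto
        show "P x = (1 - x\<^sup>2) * w x" for x by (rule P_def)
        show "(P has_real_derivative - n * x * w x) (at x)" if "-r < x" "x < r" for x
        proof -
          have "\<bar>x\<bar> < 1" using that r by auto
          from DERIV_cmult[OF rho_weight_deriv[OF this, of n], of "1 / m"]
          have "((\<lambda>x. (1 / m) * Q x) has_real_derivative (1 / m) * (- n * x * weight n x)) (at x)" unfolding Q_def .
          moreover have "(\<lambda>x. (1 / m) * Q x) = P" using P_Q by auto
          ultimately show ?thesis by (simp add: w_def)
        qed
      qed
      moreover have "integral {-r..r} (\<lambda>x. P x * (T' j x)\<^sup>2) \<le> integral {-r..r} (\<lambda>x. (1 / m) * (Q x * ((F (x + h j) - F x) / h j)\<^sup>2))"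
      proof (rule integral_le)
        show "(\<lambda>x. P x * (T' j x)\<^sup>2) integrable_on {-r..r}"
          by (intro integrable_continuous_interval continuous_intros cP C1_on_cont_deriv[OF T(1)])
        show "(\<lambda>x. (1 / m) * (Q x * ((F (x + h j) - F x) / h j)\<^sup>2)) integrable_on {-r..r}"
          by (intro integrable_continuous_interval continuous_on_mult continuous_on_const continuous_on_power
              C1_on_cont_deriv[OF Sj] continuous_on_subset[OF cQ bs(2)])
        fix x assume "x \<in> {-r..r}"
        then have "P x * (T' j x)\<^sup>2 \<le> P x * ((F (x + h j) - F x) / h j)\<^sup>2"
          using P_pos[of x] T(3)[of j x] by (intro mult_left_mono) auto
        then show "P x * (T' j x)\<^sup>2 \<le> (1 / m) * (Q x * ((F (x + h j) - F x) / h j)\<^sup>2)"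
          unfolding P_Q by (simp only: mult.assoc)
      qed
      moreover have "\<dots> = (1 / m) * integral {-r..r} (\<lambda>x. Q x * ((F (x + h j) - F x) / h j)\<^sup>2)"
        by (rule integral_mult_right)
      moreover have "integral {-r..r} (\<lambda>x. Q x * ((F (x + h j) - F x) / h j)\<^sup>2) \<le> (1 + \<eta>) * (LBINT t:{-b..b}. Q t * (g t)\<^sup>2)"
      proof (rule difference_quotient_energy[OF hj(1) less_imp_le[OF hj(2)] r(1) F(1,3) sg sg2 cQ Qm Q0 _ _ Ab])
        show "0 \<le> \<eta>" using \<eta> by simp
        fix x t assume xt: "x \<in> {-b..b}" "t \<in> {-b..b}" "\<bar>x - t\<bar> \<le> h j"
        then have "dist (Q t) (Q x) < \<eta> * Q z" using hj(3)[of j] by (intro d(2)) (auto simp: dist_real_def abs_minus_commute)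
        moreover have "\<eta> * Q z \<le> \<eta> * Q t" using z(2)[OF xt(2)] \<eta> by (intro mult_left_mono) auto
        ultimately show "Q x \<le> (1 + \<eta>) * Q t" by (simp add: dist_real_def algebra_simps)
      qed
      moreover have "(1 + \<eta>) * (LBINT t:{-b..b}. Q t * (g t)\<^sup>2) \<le> (1 + \<eta>) * Atot"
        using Able \<eta> by (intro mult_left_mono) auto
      ultimately have "n / (p - 2) * integral {-r..r} (\<lambda>x. w x * T j x powr p) powr (2 / p)
         \<le> (1 / m) * ((1 + \<eta>) * Atot) + n / (p - 2) * integral {-r..r} (\<lambda>x. w x * (T j x)\<^sup>2)"
        using mult_left_mono[of "integral {-r..r} (\<lambda>x. Q x * ((F (x + h j) - F x) / h j)\<^sup>2)" "(1 + \<eta>) * Atot" "1 / m"] m by simp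
      moreover have "\<bar>T j x\<bar> = T j x" for x using T(2)[of j x] by simp
      ultimately show ?thesis unfolding k_def by simp
    qed
    have A1: "(\<lambda>j. k * integral {-r..r} (\<lambda>x. w x * \<bar>T j x\<bar> powr p) powr (2 / p))
        \<longlonglongrightarrow> k * integral {-r..r} (\<lambda>x. w x * \<bar>\<bar>F x\<bar>\<bar> powr p) powr (2 / p)"
      by (intro tendsto_mult tendsto_const tendsto_powr'[OF L1]) (use p I0 in auto)
    have A2: "(\<lambda>j. (1 / m) * ((1 + \<eta>) * Atot) + k * integral {-r..r} (\<lambda>x. w x * (T j x)\<^sup>2))
        \<longlonglongrightarrow> (1 / m) * ((1 + \<eta>) * Atot) + k * integral {-r..r} (\<lambda>x. w x * \<bar>F x\<bar>\<^sup>2)"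
      by (intro tendsto_add tendsto_mult tendsto_const L2)
    have "\<exists>N. \<forall>j\<ge>N. k * integral {-r..r} (\<lambda>x. w x * \<bar>T j x\<bar> powr p) powr (2 / p)
        \<le> (1 / m) * ((1 + \<eta>) * Atot) + k * integral {-r..r} (\<lambda>x. w x * (T j x)\<^sup>2)"
      using ineq by blast
    from LIMSEQ_le[OF A1 A2 this] show ?thesis by (simp only: abs_idempotent power2_abs)
  qed
  have fin: "k * integral {-r..r} (\<lambda>x. w x * \<bar>F x\<bar> powr p) powr (2 / p)
      \<le> (1 / m) * Atot + k * integral {-r..r} (\<lambda>x. w x * (F x)\<^sup>2)"
  proof (rule field_le_epsilon)
    fix \<epsilon> :: real assume \<epsilon>: "0 < \<epsilon>"
    \<comment> \<open>Chosen so that the surplus \<open>\<eta> * Atot / m\<close> is at most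
      \<epsilon>; the + 1 covers Atot = 0.\<close>
    define \<eta> where "\<eta> = \<epsilon> * m / (Atot + 1)"
    have \<eta>: "0 < \<eta>" using \<epsilon> m Atot0 by (simp add: \<eta>_def)
    have "(1 / m) * (\<eta> * Atot) = \<epsilon> * (Atot / (Atot + 1))" using m by (simp add: \<eta>_def)
    also have "\<dots> \<le> \<epsilon> * 1" using Atot0 \<epsilon> by (intro mult_left_mono) auto
    finally have "(1 / m) * ((1 + \<eta>) * Atot) \<le> (1 / m) * Atot + \<epsilon>" by (simp add: algebra_simps add_divide_distrib)
    then show "k * integral {-r..r} (\<lambda>x. w x * \<bar>F x\<bar> powr p) powr (2 / p)
      \<le> (1 / m) * Atot + k * integral {-r..r} (\<lambda>x. w x * (F x)\<^sup>2) + \<epsilon>" using step[OF \<eta>] by linarith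
  qed
  have conv: "set_integrable lborel {-r..r} (\<lambda>x. weight n x * h (f x))"
    "integral {-r..r} (\<lambda>x. w x * h (F x)) = (1 / m) * (LBINT x:{-r..r}. weight n x * h (f x))"
    if h: "continuous_on UNIV h" for h :: "real \<Rightarrow> real"
  proof -
    have i: "set_integrable lborel {-r..r} (\<lambda>x. weight n x * h (F x))"
      by (intro borel_integrable_atLeastAtMost' continuous_on_mult cwn continuous_on_compose2[OF h cF]) auto
    have [measurable]: "h \<in> borel_measurable borel" by (rule borel_measurable_continuous_onI[OF h])
    have [measurable]: "(\<lambda>x. indicator {-b..b} x *\<^sub>R f x) \<in> borel_measurable borel"
      using sf unfolding set_integrable_def by auto
    \<comment> \<open>Local integrability makes f measurable only after a cut-off, so h is applied
      to the cut-off function, which agrees with f on [-r, r].\<close>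
    have "(\<lambda>x. indicator {-r..r} x * (weight n x * h (indicator {-b..b} x *\<^sub>R f x))) \<in> borel_measurable borel"
      by measurable
    moreover have "indicator {-r..r} x * (weight n x * h (indicator {-b..b} x *\<^sub>R f x))
        = indicator {-r..r} x * (weight n x * h (f x))" for x
      using bs(2) by (auto simp: indicator_def)
    ultimately have me: "(\<lambda>x. indicator {-r..r} x * (weight n x * h (f x))) \<in> borel_measurable borel" by (simp only:)
    have ae: "AE x in lborel. x \<in> {-r..r} \<longrightarrow> weight n x * h (f x) = weight n x * h (F x)"
      using F(2) by eventually_elim (use bs(2) in auto)
    show "set_integrable lborel {-r..r} (\<lambda>x. weight n x * h (f x))"
      by (rule set_integral_AE_eq(1)[OF i me ae])
    have "integral {-r..r} (\<lambda>x. w x * h (F x)) = integral {-r..r} (\<lambda>x. (1 / m) * (weight n x * h (F x)))"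
      by (simp add: w_def)
    also have "\<dots> = (1 / m) * integral {-r..r} (\<lambda>x. weight n x * h (F x))" by (rule integral_mult_right)
    also have "integral {-r..r} (\<lambda>x. weight n x * h (F x)) = (LBINT x:{-r..r}. weight n x * h (F x))"
      by (rule set_borel_integral_eq_integral(2)[OF i, symmetric])
    also have "\<dots> = (LBINT x:{-r..r}. weight n x * h (f x))"
      by (rule set_integral_AE_eq(2)[OF i me ae, symmetric])
    finally show "integral {-r..r} (\<lambda>x. w x * h (F x)) = (1 / m) * (LBINT x:{-r..r}. weight n x * h (f x))" .
  qed
  have hp: "continuous_on UNIV (\<lambda>y::real. \<bar>y\<bar> powr p)"
    by (rule continuous_on_powr') (use p in \<open>auto intro!: continuous_intros\<close>)
  have h2: "continuous_on UNIV (\<lambda>y::real. y\<^sup>2)" by (intro continuous_intros)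
  show "set_integrable lborel {-r..r} (\<lambda>x. weight n x * \<bar>f x\<bar> powr p)" by (rule conv(1)[OF hp])
  show "n / (p - 2) * ((1 / m) * (LBINT x:{-r..r}. weight n x * \<bar>f x\<bar> powr p)) powr (2 / p)
      \<le> (1 / m) * (LBINT x:{-1<..<1}. (1 - x\<^sup>2) * weight n x * (g x)\<^sup>2)
        + n / (p - 2) * ((1 / m) * (LBINT x:{-r..r}. weight n x * (f x)\<^sup>2))"
    using fin unfolding conv(2)[OF hp] conv(2)[OF h2] k_def Atot_def Q_def .
qed

section \<open>The inequality on the whole interval\<close>

lemma Gamma_duplication_real:
  assumes "0 < (a::real)"
  shows "Gamma a * Gamma (a + 1 / 2) = 2 powr (1 - 2 * a) * sqrt pi * Gamma (2 * a)"
proof -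
  have nI: "x \<notin> \<int>\<^sub>\<le>\<^sub>0" if "0 < x" for x :: real using that nonpos_Ints_nonpos[of x] by auto
  have "complex_of_real a \<notin> \<int>\<^sub>\<le>\<^sub>0" using nI[OF assms] by (simp add: of_real_in_nonpos_Ints_iff)
  moreover have "complex_of_real a + 1 / 2 \<notin> \<int>\<^sub>\<le>\<^sub>0"
  proof -
    have "complex_of_real (a + 1 / 2) \<notin> \<int>\<^sub>\<le>\<^sub>0" using nI[of "a + 1 / 2"] assms unfolding of_real_in_nonpos_Ints_iff by simp
    then show ?thesis by simp
  qed
  ultimately have "Gamma (complex_of_real a) * Gamma (complex_of_real a + 1 / 2) =
      exp ((1 - 2 * complex_of_real a) * of_real (ln 2)) * of_real (sqrt pi) * Gamma (2 * complex_of_real a)"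
    by (rule Gamma_legendre_duplication)
  also have "complex_of_real a + 1 / 2 = complex_of_real (a + 1 / 2)" by simp
  also have "2 * complex_of_real a = complex_of_real (2 * a)" by simp
  also have "exp ((1 - complex_of_real (2 * a)) * of_real (ln 2)) = complex_of_real (exp ((1 - 2 * a) * ln 2))"
    by (simp add: exp_of_real[symmetric])
  also have "exp ((1 - 2 * a) * ln 2) = 2 powr (1 - 2 * a)" by (simp add: powr_def)
  finally have "complex_of_real (Gamma a * Gamma (a + 1 / 2)) = complex_of_real (2 powr (1 - 2 * a) * sqrt pi * Gamma (2 * a))"
    by (simp only: Gamma_complex_of_real of_real_mult[symmetric])
  then show ?thesis by (simp only: of_real_eq_iff)
qed

lemma Zn_pos: "0 < n \<Longrightarrow> 0 < Zn n"
  by (simp add: Zn_def Gamma_real_pos)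

text \<open>The substitution x = 2 t - 1 produces \<open>4 powr (a - 1) * (2 * Beta a a)\<close>
  with a = n / 2, and Legendre duplication cancels \<open>Gamma (2 * a)\<close>.\<close>

lemma weight_has_integral:
  assumes n: "0 < n"
  shows "(weight n has_integral Zn n) {-1..1}"
proof -
  define a where "a = n / 2"
  have a: "0 < a" using n by (simp add: a_def)
  have "((\<lambda>t. t powr (a - 1) * (1 - t) powr (a - 1)) has_integral Beta a a) (cbox 0 1)"
    using has_integral_Beta_real[OF a a] by simp
  from has_integral_affinity'[OF this, of "1 / 2" "1 / 2"]
  have "((\<lambda>x. (x / 2 + 1 / 2) powr (a - 1) * (1 - (x / 2 + 1 / 2)) powr (a - 1)) has_integral 2 * Beta a a) {-1..1}"
    by (simp add: field_simps)
  from has_integral_mult_right[OF this, of "4 powr (a - 1)"]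
  have "((\<lambda>x. 4 powr (a - 1) * ((x / 2 + 1 / 2) powr (a - 1) * (1 - (x / 2 + 1 / 2)) powr (a - 1))) has_integral
      4 powr (a - 1) * (2 * Beta a a)) {-1..1}" .
  moreover have "4 powr (a - 1) * ((x / 2 + 1 / 2) powr (a - 1) * (1 - (x / 2 + 1 / 2)) powr (a - 1)) = weight n x"
    if x: "x \<in> {-1..1}" for x
  proof (cases "x \<in> {-1<..<1}")
    case True
    then have "\<bar>x\<bar> < 1" by auto
    have "4 powr (a - 1) * ((x / 2 + 1 / 2) powr (a - 1) * (1 - (x / 2 + 1 / 2)) powr (a - 1))
        = (4 * ((x / 2 + 1 / 2) * (1 - (x / 2 + 1 / 2)))) powr (a - 1)"
      using True by (simp add: powr_mult)
    also have "4 * ((x / 2 + 1 / 2) * (1 - (x / 2 + 1 / 2))) = 1 - x\<^sup>2"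
      by (simp add: field_simps power2_eq_square)
    also have "(1 - x\<^sup>2) powr (a - 1) = weight n x"
      using weight_eq[OF \<open>\<bar>x\<bar> < 1\<close>, of n] by (simp add: a_def diff_divide_distrib)
    finally show ?thesis .
  next
    case False
    then have "x = -1 \<or> x = 1" using x by auto
    then show ?thesis using weight_outside[OF x False] by auto
  qed
  ultimately have "(weight n has_integral 4 powr (a - 1) * (2 * Beta a a)) {-1..1}"
    by (rule has_integral_eq[rotated])
  moreover have "4 powr (a - 1) * (2 * Beta a a) = Zn n"
  proof -
    have "(4::real) powr (a - 1) = (2 powr 2) powr (a - 1)" by simp
    also have "\<dots> = 2 powr (2 * a - 2)" by (simp only: powr_powr) (simp add: algebra_simps)
    finally have 4: "(4::real) powr (a - 1) = 2 powr (2 * a - 2)" .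
    have "2 powr (2 * a - 2) * 2 * 2 powr (1 - 2 * a) = (2::real) powr (2 * a - 2) * 2 powr 1 * 2 powr (1 - 2 * a)" by simp
    also have "\<dots> = 1" by (simp only: powr_add[symmetric]) simp
    finally have c: "2 powr (2 * a - 2) * 2 * 2 powr (1 - 2 * a) = (1::real)" .
    have G: "0 < Gamma a" "0 < Gamma (a + 1 / 2)" "0 < Gamma (2 * a)" using a by (auto intro!: Gamma_real_pos)
    have "Gamma a = 2 powr (1 - 2 * a) * sqrt pi * Gamma (2 * a) / Gamma (a + 1 / 2)"
      using Gamma_duplication_real[OF a] G(2) by (simp add: field_simps)
    then have "4 powr (a - 1) * (2 * Beta a a)
        = (2 powr (2 * a - 2) * 2 * 2 powr (1 - 2 * a)) * (sqrt pi * Gamma a / Gamma (a + 1 / 2)) * (Gamma (2 * a) / Gamma (2 * a))"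
      unfolding 4 Beta_def by (simp add: mult_ac)
    also have "\<dots> = sqrt pi * Gamma a / Gamma (a + 1 / 2)" unfolding c using G(3) by simp
    also have "\<dots> = Zn n" unfolding Zn_def a_def by (simp add: add_divide_distrib)
    finally show ?thesis .
  qed
  ultimately show ?thesis by simp
qed

abbreviation unit_ivl :: "real set" where "unit_ivl \<equiv> {-1<..<1}"

text \<open>Since the weight is 0 at the end points, the closed interval carrying \<open>nu\<close>
  and the open interval of the weak derivative can be exchanged pointwise, not only almost
  everywhere.\<close>

lemma indicator_weight: "indicator {-1..1} x * weight n x = indicator unit_ivl x * weight n x"
  using weight_outside[of x n] by (cases "x \<in> unit_ivl") (auto simp: indicator_def)

lemma weight_set_integral:
  assumes n: "0 < n"
  shows "set_integrable lborel unit_ivl (weight n)" "(LBINT x:unit_ivl. weight n x) = Zn n"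
proof -
  have "(\<integral>\<^sup>+x. ennreal (indicator {-1..1} x * weight n x) \<partial>lborel) = ennreal (Zn n)"
    by (rule nn_integral_has_integral_lebesgue[OF weight_nonneg weight_has_integral[OF n]])
  then have nn: "(\<integral>\<^sup>+x. ennreal (indicator unit_ivl x * weight n x) \<partial>lborel) = ennreal (Zn n)"
    by (simp only: indicator_weight)
  have m: "(\<lambda>x. indicator unit_ivl x * weight n x) \<in> borel_measurable lborel" by measurable
  have nonneg: "0 \<le> indicator unit_ivl x * weight n x" for x using weight_nonneg by simp
  have i: "integrable lborel (\<lambda>x. indicator unit_ivl x * weight n x)"
    by (rule integrableI_nn_integral_finite[OF m _ nn]) (use nonneg in auto)
  then show "set_integrable lborel unit_ivl (weight n)" unfolding set_integrable_def by simp
  have "ennreal (\<integral>x. indicator unit_ivl x * weight n x \<partial>lborel) = ennreal (Zn n)"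
    using nn_integral_eq_integral[OF i] nonneg nn by simp
  then show "(LBINT x:unit_ivl. weight n x) = Zn n"
    using Zn_pos[OF n] nonneg unfolding set_lebesgue_integral_def
    by (subst (asm) ennreal_inj) (auto intro!: Bochner_Integration.integral_nonneg)
qed

section \<open>Integration against \<open>nu\<close> and exhaustion by compact intervals\<close>

lemma borel_measurable_nu_iff:
  fixes h :: "real \<Rightarrow> real"
  shows "h \<in> borel_measurable (nu n) \<longleftrightarrow> (\<lambda>x. indicator {-1..1} x * h x) \<in> borel_measurable borel"
proof -
  have "(borel_measurable (nu n) :: (real \<Rightarrow> real) set) = borel_measurable (restrict_space lborel {-1..1})"
    by (rule measurable_cong_sets) (simp_all add: nu_def)
  then have "h \<in> borel_measurable (nu n) \<longleftrightarrow> h \<in> borel_measurable (restrict_space lborel {-1..1})"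
    by (simp only:)
  also have "\<dots> \<longleftrightarrow> (\<lambda>x. indicator {-1..1} x *\<^sub>R h x) \<in> borel_measurable lborel"
    by (rule borel_measurable_restrict_space_iff) simp
  finally show ?thesis by simp
qed

lemma nu_integral:
  fixes h :: "real \<Rightarrow> real"
  assumes n: "0 < n" and h: "h \<in> borel_measurable (nu n)"
  shows "integrable (nu n) h \<longleftrightarrow> set_integrable lborel unit_ivl (\<lambda>x. weight n x * h x)"
    "(\<integral>x. h x \<partial>nu n) = (1 / Zn n) * (LBINT x:unit_ivl. weight n x * h x)"
proof -
  define R where "R = restrict_space lborel {-1..1::real}"
  define d where "d x = weight n x / Zn n" for x
  have nu: "nu n = density R (\<lambda>x. ennreal (d x))" unfolding nu_def R_def d_def weight_def ..
  have hm: "h \<in> borel_measurable R"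
    using h unfolding borel_measurable_nu_iff R_def by (simp add: borel_measurable_restrict_space_iff)
  have dm: "d \<in> borel_measurable R"
    unfolding R_def d_def[abs_def] by (rule measurable_restrict_space1) measurable
  have nn: "AE x in R. 0 \<le> d x" using weight_nonneg Zn_pos[OF n] by (auto simp: d_def)
  have eq: "indicator {-1..1} x *\<^sub>R (d x *\<^sub>R h x) = (1 / Zn n) * (indicator unit_ivl x *\<^sub>R (weight n x * h x))" for x
  proof -
    have "indicator {-1..1} x *\<^sub>R (d x *\<^sub>R h x) = (indicator {-1..1} x * weight n x) * h x / Zn n" by (simp add: d_def)
    then show ?thesis unfolding indicator_weight by (simp add: mult.assoc)
  qed
  have "integrable (nu n) h \<longleftrightarrow> integrable lborel (\<lambda>x. (1 / Zn n) * (indicator unit_ivl x *\<^sub>R (weight n x * h x)))"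
    unfolding nu integrable_density[OF hm dm nn] unfolding R_def eq[symmetric] by (rule integrable_restrict_space) simp
  also have "\<dots> \<longleftrightarrow> set_integrable lborel unit_ivl (\<lambda>x. weight n x * h x)"
    using Zn_pos[OF n] unfolding set_integrable_def integrable_mult_left_iff by simp
  finally show "integrable (nu n) h \<longleftrightarrow> set_integrable lborel unit_ivl (\<lambda>x. weight n x * h x)" .
  have "(\<integral>x. h x \<partial>nu n) = (\<integral>x. (1 / Zn n) * (indicator unit_ivl x *\<^sub>R (weight n x * h x)) \<partial>lborel)"
    unfolding nu integral_density[OF hm dm nn] unfolding R_def eq[symmetric] by (rule integral_restrict_space) simp
  then show "(\<integral>x. h x \<partial>nu n) = (1 / Zn n) * (LBINT x:unit_ivl. weight n x * h x)"
    unfolding set_lebesgue_integral_def by simp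
qed

lemma prob_space_nu:
  assumes n: "0 < n"
  shows "integrable (nu n) (\<lambda>_. c::real)" "(\<integral>_. (c::real) \<partial>nu n) = c"
proof -
  have m: "(\<lambda>_. c) \<in> borel_measurable (nu n)" by simp
  show "integrable (nu n) (\<lambda>_. c::real)"
    unfolding nu_integral(1)[OF n m] using weight_set_integral(1)[OF n] by (rule set_integrable_mult_left)
  show "(\<integral>_. (c::real) \<partial>nu n) = c"
    unfolding nu_integral(2)[OF n m] using weight_set_integral(2)[OF n] Zn_pos[OF n] by simp
qed

text \<open>Two successors, so that \<open>radius 0\<close> is 1 / 2 and hence positive.\<close>

definition radius :: "nat \<Rightarrow> real" where
  "radius j = 1 - inverse (real (Suc (Suc j)))"

lemma radius: "0 < radius j" "radius j < 1" "i \<le> j \<Longrightarrow> radius i \<le> radius j"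
  by (auto simp: radius_def field_simps)

lemma radius_tendsto: "radius \<longlonglongrightarrow> 1"
proof -
  have "(\<lambda>j. 1 - inverse (real (Suc (Suc j)))) \<longlonglongrightarrow> 1 - 0"
    by (intro tendsto_diff tendsto_const LIMSEQ_Suc[OF LIMSEQ_inverse_real_of_nat])
  then show ?thesis unfolding radius_def[abs_def] by simp
qed

lemma indicator_radius_tendsto: "(\<lambda>j. indicator {-radius j..radius j} x * (y::real)) \<longlonglongrightarrow> indicator unit_ivl x * y"
proof (cases "x \<in> unit_ivl")
  case True
  then have "\<bar>x\<bar> < 1" by auto
  then have "\<forall>\<^sub>F j in sequentially. \<bar>x\<bar> < radius j" using radius_tendsto by (intro order_tendstoD)
  then have "\<forall>\<^sub>F j in sequentially. indicator {-radius j..radius j} x * y = indicator unit_ivl x * y"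
    by eventually_elim (use True in \<open>auto simp: indicator_def\<close>)
  then show ?thesis by (rule tendsto_eventually)
next
  case False
  have "x \<notin> {-radius j..radius j}" for j using False radius(2)[of j] by auto
  then have "(\<lambda>j. indicator {-radius j..radius j} x * y) = (\<lambda>j. indicator unit_ivl x * y)" using False by auto
  then show ?thesis by simp
qed

lemma truncation_tendsto:
  fixes h :: "real \<Rightarrow> real"
  assumes h: "set_integrable lborel unit_ivl h"
  shows "(\<lambda>j. LBINT x:{-radius j..radius j}. h x) \<longlonglongrightarrow> (LBINT x:unit_ivl. h x)"
proof -
  have sub: "{-radius j..radius j} \<subseteq> unit_ivl" for j using radius(2)[of j] by auto
  have i: "set_integrable lborel {-radius j..radius j} h" for j
    by (rule set_integrable_subset[OF h _ sub]) simp
  have "(\<lambda>j. \<integral>x. indicator {-radius j..radius j} x * h x \<partial>lborel) \<longlonglongrightarrow> (\<integral>x. indicator unit_ivl x * h x \<partial>lborel)"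
  proof (rule integral_dominated_convergence[where w = "\<lambda>x. norm (indicator unit_ivl x * h x)"])
    show "integrable lborel (\<lambda>x. norm (indicator unit_ivl x * h x))" using h unfolding set_integrable_def by simp
    show "(\<lambda>x. indicator unit_ivl x * h x) \<in> borel_measurable lborel" using h unfolding set_integrable_def by auto
    show "(\<lambda>x. indicator {-radius j..radius j} x * h x) \<in> borel_measurable lborel" for j
      using i[of j] unfolding set_integrable_def by auto
    show "AE x in lborel. (\<lambda>j. indicator {-radius j..radius j} x * h x) \<longlonglongrightarrow> indicator unit_ivl x * h x"
      by (intro always_eventually allI indicator_radius_tendsto)
    show "AE x in lborel. norm (indicator {-radius j..radius j} x * h x) \<le> norm (indicator unit_ivl x * h x)" for j
    proof (intro always_eventually allI)
      fix x show "norm (indicator {-radius j..radius j} x * h x) \<le> norm (indicator unit_ivl x * h x)"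
        using subsetD[OF sub[of j], of x] by (cases "x \<in> {-radius j..radius j}") auto
    qed
  qed
  then show ?thesis unfolding set_lebesgue_integral_def by simp
qed

lemma abs_powr_2: "\<bar>x::real\<bar> powr 2 = x\<^sup>2"
  by (cases "x = 0") auto

lemma Lq_norm_2_square: "(Lq_norm n 2 h)\<^sup>2 = (\<integral>z. (h z)\<^sup>2 \<partial>nu n)"
proof -
  have "0 \<le> (\<integral>z. (h z)\<^sup>2 \<partial>nu n)" by simp
  then show ?thesis unfolding Lq_norm_def abs_powr_2 by (simp add: powr_half_sqrt)
qed

lemma Lq_norm_square: "(Lq_norm n p h)\<^sup>2 = (\<integral>z. \<bar>h z\<bar> powr p \<partial>nu n) powr (2 / p)"
proof -
  have "(Lq_norm n p h)\<^sup>2 = \<bar>Lq_norm n p h\<bar> powr 2" by (rule abs_powr_2[symmetric])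
  then show ?thesis unfolding Lq_norm_def by (simp add: powr_powr)
qed

lemma in_Lq_2: "in_Lq n 2 h \<longleftrightarrow> h \<in> borel_measurable (nu n) \<and> integrable (nu n) (\<lambda>z. (h z)\<^sup>2)"
  unfolding in_Lq_def abs_powr_2 ..

lemma abs_powr_le_square: "1 \<le> p \<Longrightarrow> p \<le> 2 \<Longrightarrow> \<bar>y::real\<bar> powr p \<le> 1 + y\<^sup>2"
proof (cases "\<bar>y\<bar> \<le> 1")
  case True
  assume "1 \<le> p"
  with True have "\<bar>y\<bar> powr p \<le> 1 powr p" by (intro powr_mono2) auto
  then have "\<bar>y\<bar> powr p \<le> 1" by simp
  then show ?thesis using zero_le_power2[of y] by linarith
next
  case False
  assume "p \<le> 2"
  with False have "\<bar>y\<bar> powr p \<le> \<bar>y\<bar> powr 2" by (intro powr_mono) auto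
  then show ?thesis unfolding abs_powr_2 by simp
qed

lemma in_Lq_of_in_Lq_2:
  assumes n: "0 < n" and p: "1 \<le> p" "p \<le> 2" and f: "in_Lq n 2 f"
  shows "in_Lq n p f"
proof -
  have fm: "f \<in> borel_measurable (nu n)" and f2: "integrable (nu n) (\<lambda>z. (f z)\<^sup>2)" using f unfolding in_Lq_2 by auto
  have "integrable (nu n) (\<lambda>z. \<bar>f z\<bar> powr p)"
  proof (rule Bochner_Integration.integrable_bound[OF Bochner_Integration.integrable_add[OF prob_space_nu(1)[OF n, of 1] f2]])
    show "(\<lambda>z. \<bar>f z\<bar> powr p) \<in> borel_measurable (nu n)" using fm by measurable
    show "AE x in nu n. norm (\<bar>f x\<bar> powr p) \<le> norm (1 + (f x)\<^sup>2)"
      using abs_powr_le_square[OF p] by simp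
  qed
  then show ?thesis unfolding in_Lq_def using fm by simp
qed

text \<open>Integrability of the p-th power has to precede the limit. For p < 2 it follows from
  square integrability on a probability space. For p > 2 the factor k is positive and the truncated
  inequality itself bounds the truncated p-integrals uniformly, so monotone convergence yields
  it.\<close>

lemma interpolation_inequality:
  assumes n: "0 < n" and p: "1 < p" "p \<noteq> 2" and adm: "(n - 2) * (p - 1) \<le> n + 2" and H: "in_H1 n f f'"
  shows "in_Lq n p f"
    "n / (p - 2) * ((Lq_norm n p f)\<^sup>2 - (Lq_norm n 2 f)\<^sup>2) \<le> (Lq_norm n 2 (\<lambda>z. rho z * f' z))\<^sup>2"
proof -
  define k where "k = n / (p - 2)"
  have fm: "f \<in> borel_measurable (nu n)" and f2: "integrable (nu n) (\<lambda>z. (f z)\<^sup>2)"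
    and wd: "has_weak_deriv f f'" and gm: "(\<lambda>z. rho z * f' z) \<in> borel_measurable (nu n)"
    and g2: "integrable (nu n) (\<lambda>z. (rho z * f' z)\<^sup>2)"
    using H unfolding in_H1_def in_Lq_2 by auto
  have fpm: "(\<lambda>z. \<bar>f z\<bar> powr p) \<in> borel_measurable (nu n)" using fm by measurable
  have f2m: "(\<lambda>z. (f z)\<^sup>2) \<in> borel_measurable (nu n)" using fm by measurable
  have g2m: "(\<lambda>z. (rho z * f' z)\<^sup>2) \<in> borel_measurable (nu n)" using gm by measurable
  have Z: "0 < Zn n" by (rule Zn_pos[OF n])
  have rho2: "indicator unit_ivl x *\<^sub>R (weight n x * (rho x * f' x)\<^sup>2) = indicator unit_ivl x *\<^sub>R ((1 - x\<^sup>2) * weight n x * (f' x)\<^sup>2)" for x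
  proof (cases "x \<in> unit_ivl")
    case True
    then have "0 < 1 - x\<^sup>2" by (intro one_minus_square_pos) auto
    then show ?thesis by (simp add: rho_def power_mult_distrib)
  qed simp
  define A where "A = (LBINT x:unit_ivl. (1 - x\<^sup>2) * weight n x * (f' x)\<^sup>2)"
  have iA: "set_integrable lborel unit_ivl (\<lambda>x. (1 - x\<^sup>2) * weight n x * (f' x)\<^sup>2)"
    using g2 unfolding nu_integral(1)[OF n g2m] set_integrable_def rho2 .
  have A: "(Lq_norm n 2 (\<lambda>z. rho z * f' z))\<^sup>2 = (1 / Zn n) * A"
    unfolding Lq_norm_2_square nu_integral(2)[OF n g2m] A_def set_lebesgue_integral_def rho2 ..
  define B where "B = (LBINT x:unit_ivl. weight n x * (f x)\<^sup>2)"
  have iB: "set_integrable lborel unit_ivl (\<lambda>x. weight n x * (f x)\<^sup>2)" using f2 unfolding nu_integral(1)[OF n f2m] .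
  have B: "(Lq_norm n 2 f)\<^sup>2 = (1 / Zn n) * B" unfolding Lq_norm_2_square nu_integral(2)[OF n f2m] B_def ..
  define m where "m j = (LBINT x:{-radius j..radius j}. weight n x)" for j
  define U where "U j = (LBINT x:{-radius j..radius j}. weight n x * \<bar>f x\<bar> powr p)" for j
  define V where "V j = (LBINT x:{-radius j..radius j}. weight n x * (f x)\<^sup>2)" for j
  have m: "0 < m j" and iU: "set_integrable lborel {-radius j..radius j} (\<lambda>x. weight n x * \<bar>f x\<bar> powr p)"
    and ineq: "k * ((1 / m j) * U j) powr (2 / p) \<le> (1 / m j) * A + k * ((1 / m j) * V j)" for j
    using truncated_inequality[OF n p adm wd radius(1,2) iA, of j] unfolding m_def U_def V_def A_def k_def by auto
  have mlim: "m \<longlonglongrightarrow> Zn n"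
    using truncation_tendsto[OF weight_set_integral(1)[OF n]] unfolding m_def[abs_def] weight_set_integral(2)[OF n] .
  have Vlim: "V \<longlonglongrightarrow> B" using truncation_tendsto[OF iB] unfolding V_def[abs_def] B_def .
  have U0: "0 \<le> U j" for j
    unfolding U_def set_lebesgue_integral_def by (intro Bochner_Integration.integral_nonneg) (simp add: weight_nonneg)
  have iP: "set_integrable lborel unit_ivl (\<lambda>x. weight n x * \<bar>f x\<bar> powr p)"
  proof (cases "p < 2")
    case True
    have "in_Lq n p f"
      by (rule in_Lq_of_in_Lq_2[OF n]) (use p True H in \<open>auto simp: in_H1_def\<close>)
    then have "integrable (nu n) (\<lambda>z. \<bar>f z\<bar> powr p)" unfolding in_Lq_def by simp
    then show ?thesis unfolding nu_integral(1)[OF n fpm] .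
  next
    case False
    then have k: "0 < k" using p n by (simp add: k_def)
    \<comment> \<open>Uniform in j: the masses \<open>m j\<close> increase, so their reciprocals are
      at most \<open>1 / m 0\<close>, and V j is at most B.\<close>
    define Rb where "Rb = (1 / m 0) * A / k + (1 / m 0) * B"
    have A0: "0 \<le> A"
    proof -
      have "0 \<le> (1 / Zn n) * A" unfolding A[symmetric] by simp
      then show ?thesis using Z by (simp add: zero_le_divide_iff)
    qed
    have mono_set: "(LBINT x:S. weight n x * h x) \<le> (LBINT x:S'. weight n x * h x)"
      if "set_integrable lborel S' (\<lambda>x. weight n x * h x)" "S \<in> sets lborel" "S \<subseteq> S'" "\<And>x. 0 \<le> h x" for S S' h
    proof -
      have "set_integrable lborel S (\<lambda>x. weight n x * h x)" by (rule set_integrable_subset[OF that(1-3)])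
      then show ?thesis using that(1) unfolding set_lebesgue_integral_def set_integrable_def
        by (rule integral_mono) (use that(3,4) weight_nonneg[of n] in \<open>auto simp: indicator_def\<close>)
    qed
    have i0: "set_integrable lborel {-radius j..radius j} (\<lambda>x. weight n x * 1)" for j
      by (simp, rule borel_integrable_atLeastAtMost'[OF continuous_on_weight]) (use radius(2)[of j] in auto)
    have mm: "m 0 \<le> m j" for j
      using mono_set[OF i0[of j], of "{-radius 0..radius 0}"] radius(3)[of 0 j] unfolding m_def by auto
    have mZ: "m j \<le> Zn n" for j
    proof -
      have "{-radius j..radius j} \<subseteq> unit_ivl" using radius(2)[of j] by auto
      then show ?thesis
        using mono_set[of unit_ivl "\<lambda>_. 1" "{-radius j..radius j}"] weight_set_integral[OF n] unfolding m_def by simp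
    qed
    have VB: "V j \<le> B" for j
      unfolding V_def B_def by (rule mono_set[OF iB]) (use radius(2)[of j] in auto)
    have B0: "0 \<le> B" unfolding B_def set_lebesgue_integral_def
      by (intro Bochner_Integration.integral_nonneg) (simp add: weight_nonneg)
    have Ub: "U j \<le> Zn n * Rb powr (p / 2)" for j
    proof -
      have mj: "1 / m j \<le> 1 / m 0" using m[of 0] mm[of j] by (intro divide_left_mono) auto
      define T where "T = (1 / m j) * U j"
      have T0: "0 \<le> T" using m[of j] U0[of j] by (simp add: T_def)
      have "T powr (2 / p) \<le> (1 / m j) * A / k + (1 / m j) * V j"
      proof -
        have "k * T powr (2 / p) / k \<le> ((1 / m j) * A + k * ((1 / m j) * V j)) / k"
          using ineq[of j] k unfolding T_def[symmetric] by (intro divide_right_mono) auto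
        then show ?thesis using k by (simp only: add_divide_distrib nonzero_mult_div_cancel_left less_imp_neq[symmetric] not_False_eq_True)
      qed
      also have "\<dots> \<le> (1 / m 0) * A / k + (1 / m 0) * B"
      proof (rule add_mono)
        show "(1 / m j) * A / k \<le> (1 / m 0) * A / k" using mj A0 k by (intro divide_right_mono mult_right_mono) auto
        have "(1 / m j) * V j \<le> (1 / m j) * B" using VB[of j] m[of j] by (intro mult_left_mono) auto
        also have "\<dots> \<le> (1 / m 0) * B" using mj B0 by (rule mult_right_mono)
        finally show "(1 / m j) * V j \<le> (1 / m 0) * B" .
      qed
      finally have "T powr (2 / p) \<le> Rb" unfolding Rb_def .
      then have "(T powr (2 / p)) powr (p / 2) \<le> Rb powr (p / 2)" using p by (intro powr_mono2) auto
      moreover have "(T powr (2 / p)) powr (p / 2) = T" using p T0 by (simp add: powr_powr)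
      ultimately have "T \<le> Rb powr (p / 2)" by simp
      moreover have "U j = m j * T" using m[of j] by (simp add: T_def)
      ultimately have "U j \<le> m j * Rb powr (p / 2)" using m[of j] by (simp add: mult_left_mono less_imp_le)
      also have "\<dots> \<le> Zn n * Rb powr (p / 2)" using mZ[of j] by (rule mult_right_mono) simp
      finally show ?thesis .
    qed
    have incU: "incseq U"
    proof (rule incseq_SucI)
      fix j show "U j \<le> U (Suc j)"
        unfolding U_def by (rule mono_set[OF iU]) (use radius(3)[of j "Suc j"] in auto)
    qed
    obtain L where L: "U \<longlonglongrightarrow> L" using incseq_convergent[OF incU] Ub by blast
    have "integrable lborel (\<lambda>x. indicator unit_ivl x * (weight n x * \<bar>f x\<bar> powr p))"
    proof (rule integral_monotone_convergence_nonneg(1)[where f = "\<lambda>j x. indicator {-radius j..radius j} x * (weight n x * \<bar>f x\<bar> powr p)"])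
      show "integrable lborel (\<lambda>x. indicator {-radius j..radius j} x * (weight n x * \<bar>f x\<bar> powr p))" for j
        using iU[of j] unfolding set_integrable_def by simp
      show "AE x in lborel. mono (\<lambda>j. indicator {-radius j..radius j} x * (weight n x * \<bar>f x\<bar> powr p))"
      proof (intro always_eventually allI monoI)
        fix x and i j :: nat assume "i \<le> j"
        then have "{-radius i..radius i} \<subseteq> {-radius j..radius j}" using radius(3)[of i j] by auto
        then show "indicator {-radius i..radius i} x * (weight n x * \<bar>f x\<bar> powr p)
            \<le> indicator {-radius j..radius j} x * (weight n x * \<bar>f x\<bar> powr p)"
          using weight_nonneg[of n x] by (intro mult_right_mono indicator_leI) auto
      qed
      show "AE x in lborel. 0 \<le> indicator {-radius j..radius j} x * (weight n x * \<bar>f x\<bar> powr p)" for j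
        using weight_nonneg by simp
      show "AE x in lborel. (\<lambda>j. indicator {-radius j..radius j} x * (weight n x * \<bar>f x\<bar> powr p))
          \<longlonglongrightarrow> indicator unit_ivl x * (weight n x * \<bar>f x\<bar> powr p)"
        by (intro always_eventually allI indicator_radius_tendsto)
      show "(\<lambda>j. \<integral>x. indicator {-radius j..radius j} x * (weight n x * \<bar>f x\<bar> powr p) \<partial>lborel) \<longlonglongrightarrow> L"
        using L unfolding U_def[abs_def] set_lebesgue_integral_def by simp
      have [measurable]: "(\<lambda>x. indicator {-1..1} x * f x) \<in> borel_measurable borel"
        using fm unfolding borel_measurable_nu_iff .
      have "(\<lambda>x. indicator unit_ivl x * (weight n x * \<bar>indicator {-1..1} x * f x\<bar> powr p)) \<in> borel_measurable borel" by measurable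
      moreover have "indicator unit_ivl x * (weight n x * \<bar>indicator {-1..1} x * f x\<bar> powr p) = indicator unit_ivl x * (weight n x * \<bar>f x\<bar> powr p)" for x
        by (auto simp: indicator_def)
      ultimately show "(\<lambda>x. indicator unit_ivl x * (weight n x * \<bar>f x\<bar> powr p)) \<in> borel_measurable lborel" by simp
    qed
    then show ?thesis unfolding set_integrable_def by simp
  qed
  show "in_Lq n p f" unfolding in_Lq_def nu_integral(1)[OF n fpm] using fm iP by blast
  define Uinf where "Uinf = (LBINT x:unit_ivl. weight n x * \<bar>f x\<bar> powr p)"
  have Ulim: "U \<longlonglongrightarrow> Uinf" using truncation_tendsto[OF iP] unfolding U_def[abs_def] Uinf_def .
  have "(\<lambda>j. ((1 / m j) * U j) powr (2 / p)) \<longlonglongrightarrow> ((1 / Zn n) * Uinf) powr (2 / p)"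
  proof (rule tendsto_powr')
    show "(\<lambda>j. (1 / m j) * U j) \<longlonglongrightarrow> (1 / Zn n) * Uinf"
      by (intro tendsto_mult tendsto_divide tendsto_const mlim Ulim) (use Z in simp)
    have "0 \<le> (1 / m j) * U j" for j using m[of j] U0[of j] by simp
    then show "(1 / Zn n) * Uinf \<noteq> 0 \<or> 0 < 2 / p \<and> (\<forall>\<^sub>F j in sequentially. 0 \<le> (1 / m j) * U j)"
      using p by simp
  qed (rule tendsto_const)
  then have 1: "(\<lambda>j. k * ((1 / m j) * U j) powr (2 / p)) \<longlonglongrightarrow> k * ((1 / Zn n) * Uinf) powr (2 / p)"
    by (rule tendsto_mult[OF tendsto_const])
  have 2: "(\<lambda>j. (1 / m j) * A + k * ((1 / m j) * V j)) \<longlonglongrightarrow> (1 / Zn n) * A + k * ((1 / Zn n) * B)"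
    by (intro tendsto_add tendsto_mult tendsto_divide tendsto_const mlim Vlim) (use Z in simp_all)
  have "k * ((1 / Zn n) * Uinf) powr (2 / p) \<le> (1 / Zn n) * A + k * ((1 / Zn n) * B)"
    by (rule LIMSEQ_le[OF 1 2]) (use ineq in blast)
  moreover have "(Lq_norm n p f)\<^sup>2 = ((1 / Zn n) * Uinf) powr (2 / p)"
    unfolding Lq_norm_square nu_integral(2)[OF n fpm] Uinf_def ..
  ultimately show "n / (p - 2) * ((Lq_norm n p f)\<^sup>2 - (Lq_norm n 2 f)\<^sup>2) \<le> (Lq_norm n 2 (\<lambda>z. rho z * f' z))\<^sup>2"
    unfolding A B k_def[symmetric] right_diff_distrib by (simp only: diff_le_eq)
qed

section \<open>The cases p = 1 and p = 2\<close>

text \<open>Young's inequality with weights 2 - p and p - 1, multiplied by y. The bound is affine in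
  p, which makes the limit p to 1 explicit.\<close>

lemma powr_le_interpolation:
  fixes y p :: real
  assumes "0 \<le> y" "1 < p" "p < 2"
  shows "y powr p \<le> (2 - p) * y + (p - 1) * y\<^sup>2"
proof (cases "y = 0")
  case False
  then have y: "0 < y" using assms by simp
  have "1 powr (2 - p) * y powr (p - 1) \<le> (2 - p) * 1 + (p - 1) * y"
    by (rule Youngs_inequality_0) (use assms y in auto)
  then have "y * y powr (p - 1) \<le> y * ((2 - p) + (p - 1) * y)" using y by (intro mult_left_mono) auto
  moreover have "y * y powr (p - 1) = y powr p" using y by (simp add: powr_diff)
  ultimately show ?thesis by (simp add: algebra_simps power2_eq_square)
qed (use assms in simp)

lemma poincare_inequality:
  assumes n: "0 < n" and H: "in_H1 n f f'"
  shows "in_Lq n 1 f"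
    "n / (1 - 2) * ((Lq_norm n 1 f)\<^sup>2 - (Lq_norm n 2 f)\<^sup>2) \<le> (Lq_norm n 2 (\<lambda>z. rho z * f' z))\<^sup>2"
proof -
  have L2: "in_Lq n 2 f" using H unfolding in_H1_def by simp
  have i2: "integrable (nu n) (\<lambda>z. (f z)\<^sup>2)" using L2 unfolding in_Lq_2 by simp
  show L1: "in_Lq n 1 f" by (rule in_Lq_of_in_Lq_2[OF n _ _ L2]) auto
  have i1: "integrable (nu n) (\<lambda>z. \<bar>f z\<bar>)" using L1 unfolding in_Lq_def by simp
  define a where "a = (\<integral>z. \<bar>f z\<bar> \<partial>nu n)"
  define B where "B = (Lq_norm n 2 f)\<^sup>2"
  define E where "E = (Lq_norm n 2 (\<lambda>z. rho z * f' z))\<^sup>2"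
  have a0: "0 \<le> a" unfolding a_def by simp
  have B0: "0 \<le> B" unfolding B_def by simp
  have BI: "B = (\<integral>z. (f z)\<^sup>2 \<partial>nu n)" unfolding B_def Lq_norm_2_square ..
  have le: "n / (2 - p) * (B - ((2 - p) * a + (p - 1) * B) powr (2 / p)) \<le> E" if p: "1 < p" "p < 2" for p
  proof -
    have "(n - 2) * (p - 1) \<le> n + 2"
    proof (cases "0 \<le> n - 2")
      case True
      then have "(n - 2) * (p - 1) \<le> (n - 2) * 1" using p by (intro mult_left_mono) auto
      then show ?thesis by simp
    next
      case False
      then have "(n - 2) * (p - 1) \<le> 0" using p by (intro mult_nonpos_nonneg) auto
      then show ?thesis using n by simp
    qed
    from interpolation_inequality[OF n p(1) _ this H] p
    have Lp: "in_Lq n p f" and ineq: "n / (p - 2) * ((Lq_norm n p f)\<^sup>2 - B) \<le> E" unfolding B_def E_def by auto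
    have ip: "integrable (nu n) (\<lambda>z. \<bar>f z\<bar> powr p)" using Lp unfolding in_Lq_def by simp
    have "(\<integral>z. \<bar>f z\<bar> powr p \<partial>nu n) \<le> (\<integral>z. (2 - p) * \<bar>f z\<bar> + (p - 1) * (f z)\<^sup>2 \<partial>nu n)"
    proof (rule integral_mono[OF ip])
      show "integrable (nu n) (\<lambda>z. (2 - p) * \<bar>f z\<bar> + (p - 1) * (f z)\<^sup>2)"
        by (intro Bochner_Integration.integrable_add integrable_mult_right i1 i2)
      show "\<bar>f z\<bar> powr p \<le> (2 - p) * \<bar>f z\<bar> + (p - 1) * (f z)\<^sup>2" for z
        using powr_le_interpolation[OF abs_ge_zero p, of "f z"] by simp
    qed
    also have "\<dots> = (2 - p) * a + (p - 1) * B"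
      using i1 i2 unfolding a_def BI by simp
    finally have "(\<integral>z. \<bar>f z\<bar> powr p \<partial>nu n) powr (2 / p) \<le> ((2 - p) * a + (p - 1) * B) powr (2 / p)"
      using p by (intro powr_mono2) auto
    then have "n / (2 - p) * (B - ((2 - p) * a + (p - 1) * B) powr (2 / p)) \<le> n / (2 - p) * (B - (Lq_norm n p f)\<^sup>2)"
      unfolding Lq_norm_square using p n by (intro mult_left_mono) auto
    also have "\<dots> = n / (p - 2) * ((Lq_norm n p f)\<^sup>2 - B)" using p by (simp add: field_simps)
    finally show ?thesis using ineq by simp
  qed
  have "((\<lambda>p. n / (2 - p) * (B - ((2 - p) * a + (p - 1) * B) powr (2 / p))) \<longlongrightarrow>
      n / (2 - 1) * (B - ((2 - 1) * a + (1 - 1) * B) powr (2 / 1))) (at_right 1)"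
  proof (rule tendsto_mult[OF _ tendsto_diff[OF tendsto_const tendsto_powr']])
    show "(2 - 1) * a + (1 - 1) * B \<noteq> 0 \<or> 0 < (2 / 1 :: real) \<and> (\<forall>\<^sub>F p in at_right 1. 0 \<le> (2 - p) * a + (p - 1) * B)"
    proof -
      have "\<forall>\<^sub>F p in at_right (1::real). p \<in> {1<..<2}" by (rule eventually_at_right_real) simp
      then have "\<forall>\<^sub>F p in at_right (1::real). 0 \<le> (2 - p) * a + (p - 1) * B"
        by eventually_elim (use a0 B0 in auto)
      then show ?thesis by simp
    qed
  qed (intro tendsto_intros; simp)+
  then have lim: "((\<lambda>p. n / (2 - p) * (B - ((2 - p) * a + (p - 1) * B) powr (2 / p))) \<longlongrightarrow> n * (B - a\<^sup>2)) (at_right 1)"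
    using a0 by simp
  have "n * (B - a\<^sup>2) \<le> E"
  proof (rule tendsto_upperbound[OF lim])
    have "\<forall>\<^sub>F p in at_right (1::real). p \<in> {1<..<2}" by (rule eventually_at_right_real) simp
    then show "\<forall>\<^sub>F p in at_right 1. n / (2 - p) * (B - ((2 - p) * a + (p - 1) * B) powr (2 / p)) \<le> E"
      by eventually_elim (use le in auto)
  qed simp
  moreover have "(Lq_norm n 1 f)\<^sup>2 = a\<^sup>2" unfolding Lq_norm_def a_def by simp
  ultimately show "n / (1 - 2) * ((Lq_norm n 1 f)\<^sup>2 - (Lq_norm n 2 f)\<^sup>2) \<le> (Lq_norm n 2 (\<lambda>z. rho z * f' z))\<^sup>2"
    unfolding B_def[symmetric] E_def[symmetric] by (simp add: algebra_simps)
qed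

text \<open>Above, ln y \<le> y^s / s; below, ln y \<ge> 1 - 1 / y, so that the product is at least
  y^2 - y. A single exponent beyond 2 thus makes the entropy integrable.\<close>

lemma square_log_bound:
  fixes y s :: real
  assumes "0 \<le> y" "0 < s"
  shows "\<bar>y\<^sup>2 * ln y\<bar> \<le> 1 + y powr (2 + s) / s"
proof (cases "y = 0")
  case False
  then have y: "0 < y" using assms by simp
  have "ln (y powr s) \<le> y powr s - 1" using y by (intro ln_le_minus_one) simp
  then have "s * ln y \<le> y powr s" using y by (simp add: ln_powr)
  then have "ln y \<le> y powr s / s" using assms by (simp add: field_simps)
  then have "y\<^sup>2 * ln y \<le> y\<^sup>2 * (y powr s / s)" by (intro mult_left_mono) auto
  also have "\<dots> = y powr (2 + s) / s" using y by (simp add: powr_add)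
  finally have up: "y\<^sup>2 * ln y \<le> y powr (2 + s) / s" .
  have "ln (1 / y) \<le> 1 / y - 1" using y by (intro ln_le_minus_one) simp
  then have "1 - 1 / y \<le> ln y" using y by (simp add: ln_div)
  then have "y\<^sup>2 * (1 - 1 / y) \<le> y\<^sup>2 * ln y" by (intro mult_left_mono) auto
  moreover have "y\<^sup>2 * (1 - 1 / y) = y\<^sup>2 - y" using y by (simp add: right_diff_distrib power2_eq_square)
  moreover have "(y - 1 / 2)\<^sup>2 = y\<^sup>2 - y + 1 / 4" by (simp add: power2_diff power_divide)
  moreover have "0 \<le> (y - 1 / 2)\<^sup>2" by simp
  ultimately have low: "- 1 \<le> y\<^sup>2 * ln y" by linarith
  have "0 \<le> y powr (2 + s) / s" using assms by simp
  then show ?thesis using up low by (simp add: abs_le_iff)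
qed (use assms in simp)

text \<open>The tangent of the exponential at 0, applied to y^p = y^2 exp ((p - 2) ln y). It is an
  inequality without error term, so it can be integrated as it stands.\<close>

lemma powr_ge_log_expansion:
  fixes y p :: real
  assumes "0 \<le> y"
  shows "y\<^sup>2 + (p - 2) * (y\<^sup>2 * ln y) \<le> y powr p"
proof (cases "y = 0")
  case False
  then have y: "0 < y" using assms by simp
  have "1 + (p - 2) * ln y \<le> exp ((p - 2) * ln y)" by (rule exp_ge_add_one_self)
  then have "y\<^sup>2 * (1 + (p - 2) * ln y) \<le> y\<^sup>2 * exp ((p - 2) * ln y)" by (intro mult_left_mono) auto
  also have "\<dots> = y powr 2 * y powr (p - 2)" using y by (simp add: powr_def[of y "p - 2"])
  also have "\<dots> = y powr p" by (simp add: powr_add[symmetric])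
  finally show ?thesis by (simp add: algebra_simps)
qed simp

text \<open>The limit is a derivative at p = 2. The base equals 1 there, so varying the exponent
  contributes ln 1 = 0, and the base contributes S times the exponent 2 / 2.\<close>

lemma powr_difference_quotient_tendsto:
  fixes S :: real
  shows "((\<lambda>p. ((1 + (p - 2) * S) powr (2 / p) - 1) / (p - 2)) \<longlongrightarrow> S) (at_right 2)"
proof -
  have "((\<lambda>p. 1 + (p - 2) * S) has_real_derivative S) (at 2)" by (auto intro!: derivative_eq_intros)
  moreover have "((\<lambda>p::real. 2 / p) has_real_derivative - (1 / 2)) (at 2)"
    by (auto intro!: derivative_eq_intros)
  ultimately have "((\<lambda>p. (1 + (p - 2) * S) powr (2 / p)) has_real_derivative
      (1 + (2 - 2) * S) powr (2 / 2) * (- (1 / 2) * ln (1 + (2 - 2) * S) + S * (2 / 2) / (1 + (2 - 2) * S))) (at 2)"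
    by (intro DERIV_powr) auto
  then have "((\<lambda>p. (1 + (p - 2) * S) powr (2 / p)) has_real_derivative S) (at 2)" by simp
  then have "((\<lambda>p. ((1 + (p - 2) * S) powr (2 / p) - (1 + (2 - 2) * S) powr (2 / 2)) / (p - 2)) \<longlongrightarrow> S) (at 2)"
    unfolding has_field_derivative_iff .
  then have "((\<lambda>p. ((1 + (p - 2) * S) powr (2 / p) - 1) / (p - 2)) \<longlongrightarrow> S) (at 2)" by simp
  then show ?thesis by (rule tendsto_mono[rotated]) (simp add: at_le)
qed

text \<open>Only p slightly above 2 is used. For f normalized to y the expansion gives a lower bound
  of the p-integral by 1 + (p - 2) S, so differentiating the p-norm under the integral is replaced
  by differentiating an explicit function at p = 2.\<close>

lemma log_sobolev_inequality:
  assumes n: "0 < n" and H: "in_H1 n f f'"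
  shows "integrable (nu n) (entropy_integrand n f)"
    "n / 2 * (\<integral>z. entropy_integrand n f z \<partial>(nu n)) \<le> (Lq_norm n 2 (\<lambda>z. rho z * f' z))\<^sup>2"
proof -
  define B where "B = (Lq_norm n 2 f)\<^sup>2"
  define E where "E = (Lq_norm n 2 (\<lambda>z. rho z * f' z))\<^sup>2"
  have fm: "f \<in> borel_measurable (nu n)" and i2: "integrable (nu n) (\<lambda>z. (f z)\<^sup>2)"
    using H unfolding in_H1_def in_Lq_2 by auto
  have B0: "0 \<le> B" unfolding B_def by simp
  have "integrable (nu n) (entropy_integrand n f) \<and> n / 2 * (\<integral>z. entropy_integrand n f z \<partial>(nu n)) \<le> E"
  proof (cases "B = 0")
    case True
    then have "entropy_integrand n f = (\<lambda>_. 0)" unfolding entropy_integrand_def[abs_def] B_def by simp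
    then show ?thesis by (simp add: E_def)
  next
    case False
    then have B: "0 < B" using B0 by simp
    \<comment> \<open>For n > 2 the critical exponent exceeds 2 by 4 / (n - 2), which is larger than
      t; this choice makes sense for every n > 0.\<close>
    define t where "t = 4 / (n + 2)"
    have t: "0 < t" using n by (simp add: t_def)
    have adm: "(n - 2) * (p - 1) \<le> n + 2" if "2 < p" "p \<le> 2 + t" for p
    proof (cases "0 \<le> n - 2")
      case True
      have "(n - 2) * (p - 2) \<le> (n - 2) * t" using True that by (intro mult_left_mono) auto
      also have "\<dots> \<le> (n + 2) * t" using t by (intro mult_right_mono) auto
      also have "\<dots> = 4" unfolding t_def times_divide_eq_right
        using n by (subst nonzero_mult_div_cancel_left) auto
      finally show ?thesis by (simp add: algebra_simps)
    next
      case False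
      then have "(n - 2) * (p - 1) \<le> 0" using that by (intro mult_nonpos_nonneg) auto
      then show ?thesis using n by simp
    qed
    have main: "in_Lq n p f" "n / (p - 2) * ((Lq_norm n p f)\<^sup>2 - B) \<le> E" if "2 < p" "p \<le> 2 + t" for p
      using interpolation_inequality[OF n _ _ adm[OF that] H] that unfolding B_def E_def by auto
    define y where "y z = \<bar>f z\<bar> / sqrt B" for z
    have y0: "0 \<le> y z" for z unfolding y_def using B0 by simp
    have fy: "\<bar>f z\<bar> = sqrt B * y z" for z using B by (simp add: y_def)
    have ym: "y \<in> borel_measurable (nu n)" unfolding y_def[abs_def] using fm by measurable
    have y2: "(y z)\<^sup>2 = (f z)\<^sup>2 / B" for z using B by (simp add: y_def power_divide)
    define L where "L z = (y z)\<^sup>2 * ln (y z)" for z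
    have ent: "entropy_integrand n f z = 2 * B * L z" for z
    proof (cases "f z = 0")
      case False
      then have "0 < y z" using B by (simp add: y_def)
      have "ln ((f z)\<^sup>2 / B) = ln ((y z)\<^sup>2)" unfolding y2 ..
      also have "\<dots> = 2 * ln (y z)" using \<open>0 < y z\<close> by (simp add: ln_realpow)
      finally show ?thesis unfolding entropy_integrand_def B_def[symmetric] L_def y2 using B by simp
    qed (simp add: entropy_integrand_def L_def y_def)
    have iyp: "integrable (nu n) (\<lambda>z. y z powr p)" if "2 < p" "p \<le> 2 + t" for p
    proof -
      have "integrable (nu n) (\<lambda>z. \<bar>f z\<bar> powr p)" using main(1)[OF that] unfolding in_Lq_def by simp
      moreover have "y z powr p = (1 / sqrt B powr p) * \<bar>f z\<bar> powr p" for z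
        unfolding y_def using B by (simp add: powr_divide)
      ultimately show ?thesis by (simp only:) (rule integrable_mult_right)
    qed
    have iL: "integrable (nu n) L"
    proof (rule Bochner_Integration.integrable_bound)
      show "integrable (nu n) (\<lambda>z. 1 + (1 / t) * y z powr (2 + t))"
        using t by (intro Bochner_Integration.integrable_add prob_space_nu(1)[OF n] integrable_mult_right iyp) auto
      show "L \<in> borel_measurable (nu n)" unfolding L_def[abs_def] using ym by measurable
      show "AE z in nu n. norm (L z) \<le> norm (1 + (1 / t) * y z powr (2 + t))"
      proof (intro always_eventually allI)
        fix z
        have "\<bar>L z\<bar> \<le> 1 + y z powr (2 + t) / t" unfolding L_def by (rule square_log_bound[OF y0 t])
        then show "norm (L z) \<le> norm (1 + (1 / t) * y z powr (2 + t))" by simp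
      qed
    qed
    define S where "S = (\<integral>z. L z \<partial>nu n)"
    have ie: "integrable (nu n) (entropy_integrand n f)"
      unfolding ent[abs_def] by (rule integrable_mult_right[OF iL])
    have S: "(\<integral>z. entropy_integrand n f z \<partial>nu n) = 2 * B * S" unfolding ent S_def by simp
    have iy2: "integrable (nu n) (\<lambda>z. (y z)\<^sup>2)" unfolding y2 using i2 by simp
    have y1: "(\<integral>z. (y z)\<^sup>2 \<partial>nu n) = 1"
      unfolding y2 using B unfolding B_def Lq_norm_2_square by simp
    have step: "n * B * (((1 + (p - 2) * S) powr (2 / p) - 1) / (p - 2)) \<le> E"
      if p: "2 < p" "p \<le> 2 + t" and nn: "0 \<le> 1 + (p - 2) * S" for p
    proof -
      have "1 + (p - 2) * S = (\<integral>z. (y z)\<^sup>2 + (p - 2) * L z \<partial>nu n)"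
        using iy2 iL y1 by (simp add: S_def)
      also have "\<dots> \<le> (\<integral>z. y z powr p \<partial>nu n)"
        using powr_ge_log_expansion[OF y0] unfolding L_def
        by (intro integral_mono iyp[OF p] Bochner_Integration.integrable_add iy2 integrable_mult_right iL[unfolded L_def[abs_def]])
      finally have "(1 + (p - 2) * S) powr (2 / p) \<le> (\<integral>z. y z powr p \<partial>nu n) powr (2 / p)"
        using nn p by (intro powr_mono2) auto
      then have "B * (1 + (p - 2) * S) powr (2 / p) \<le> B * (\<integral>z. y z powr p \<partial>nu n) powr (2 / p)"
        using B0 by (rule mult_left_mono)
      also have "\<dots> = (Lq_norm n p f)\<^sup>2"
      proof -
        have "(\<integral>z. \<bar>f z\<bar> powr p \<partial>nu n) = sqrt B powr p * (\<integral>z. y z powr p \<partial>nu n)"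
          unfolding fy using B0 y0 by (simp add: powr_mult)
        then have "(Lq_norm n p f)\<^sup>2 = (sqrt B powr p) powr (2 / p) * (\<integral>z. y z powr p \<partial>nu n) powr (2 / p)"
          unfolding Lq_norm_square by (simp add: powr_mult)
        also have "(sqrt B powr p) powr (2 / p) = B" using p B by (simp add: powr_powr)
        finally show ?thesis by simp
      qed
      finally have "B * ((1 + (p - 2) * S) powr (2 / p) - 1) \<le> (Lq_norm n p f)\<^sup>2 - B" by (simp add: algebra_simps)
      then have "n / (p - 2) * (B * ((1 + (p - 2) * S) powr (2 / p) - 1)) \<le> n / (p - 2) * ((Lq_norm n p f)\<^sup>2 - B)"
        using p n by (intro mult_left_mono) auto
      also have "\<dots> \<le> E" by (rule main(2)[OF p])
      finally show ?thesis by (simp add: mult_ac)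
    qed
    \<comment> \<open>Near p = 2 the base 1 + (p - 2) S is positive whatever the sign of S. The
      entropy being 2 B S, this is the claim with constant n / 2.\<close>
    have "n * B * S \<le> E"
    proof (rule tendsto_upperbound)
      show "((\<lambda>p. n * B * (((1 + (p - 2) * S) powr (2 / p) - 1) / (p - 2))) \<longlongrightarrow> n * B * S) (at_right 2)"
        by (intro tendsto_mult[OF tendsto_const] powr_difference_quotient_tendsto)
      have ev1: "\<forall>\<^sub>F p in at_right (2::real). p \<in> {2<..<2 + t}" using t by (intro eventually_at_right_real) simp
      have "((\<lambda>p. 1 + (p - 2) * S) \<longlongrightarrow> 1 + (2 - 2) * S) (at_right 2)" by (intro tendsto_intros)
      then have "\<forall>\<^sub>F p in at_right 2. 0 < 1 + (p - 2) * S" by (rule order_tendstoD) simp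
      with ev1 show "\<forall>\<^sub>F p in at_right 2. n * B * (((1 + (p - 2) * S) powr (2 / p) - 1) / (p - 2)) \<le> E"
        by eventually_elim (rule step, auto)
    qed simp
    then show ?thesis using ie unfolding S by simp
  qed
  then show "integrable (nu n) (entropy_integrand n f)"
    "n / 2 * (\<integral>z. entropy_integrand n f z \<partial>(nu n)) \<le> (Lq_norm n 2 (\<lambda>z. rho z * f' z))\<^sup>2"
    unfolding E_def by auto
qed

section \<open>Sharpness of the constants\<close>

lemma borel_measurable_nu:
  fixes h :: "real \<Rightarrow> real"
  assumes [measurable]: "h \<in> borel_measurable borel"
  shows "h \<in> borel_measurable (nu n)"
  unfolding borel_measurable_nu_iff by measurable

lemma nu_integrable_bounded:
  fixes h :: "real \<Rightarrow> real"
  assumes n: "0 < n" and h: "h \<in> borel_measurable (nu n)" and b: "\<And>z. z \<in> {-1..1} \<Longrightarrow> \<bar>h z\<bar> \<le> c"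
  shows "integrable (nu n) h"
proof (rule Bochner_Integration.integrable_bound[OF prob_space_nu(1)[OF n, of c] h])
  show "AE z in nu n. norm (h z) \<le> norm c"
    by (rule AE_I2) (use b in \<open>force simp: nu_def\<close>)
qed

lemma nu_first_moment:
  assumes n: "0 < n"
  shows "(\<integral>z. z \<partial>nu n) = 0"
proof -
  have m: "(\<lambda>z. z) \<in> borel_measurable (nu n)" by (rule borel_measurable_nu) measurable
  have "(LBINT x:unit_ivl. weight n x * x) = (LBINT x:{x. - x \<in> unit_ivl}. weight n (- x) * (- x))"
    by (rule set_integral_reflect)
  also have "{x. - x \<in> unit_ivl} = unit_ivl" by auto
  also have "(LBINT x:unit_ivl. weight n (- x) * (- x)) = (LBINT x:unit_ivl. - (weight n x * x))"
    unfolding weight_def rho_def by simp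
  also have "\<dots> = - (LBINT x:unit_ivl. weight n x * x)"
    unfolding set_lebesgue_integral_def by simp
  finally have "(LBINT x:unit_ivl. weight n x * x) = 0" by simp
  then show ?thesis unfolding nu_integral(2)[OF n m] by simp
qed

text \<open>The combination \<open>weight n x - (n + 1) * (weight n x * x\<^sup>2)\<close> is the
  derivative of \<open>x * ((1 - x\<^sup>2) * weight n x)\<close>, which tends to 0 at both ends
  because n > 0. Hence its integral is zero.\<close>

lemma nu_second_moment:
  assumes n: "0 < n"
  shows "(\<integral>z. z\<^sup>2 \<partial>nu n) = 1 / (n + 1)"
proof -
  have m: "(\<lambda>z. z\<^sup>2) \<in> borel_measurable (nu n)" by (rule borel_measurable_nu) measurable
  have "integrable (nu n) (\<lambda>z. z\<^sup>2)"
    by (rule nu_integrable_bounded[OF n m, of 1]) (auto simp: abs_square_le_1)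
  then have i: "set_integrable lborel unit_ivl (\<lambda>x. weight n x * x\<^sup>2)" unfolding nu_integral(1)[OF n m] .
  define D where "D x = weight n x - (n + 1) * (weight n x * x\<^sup>2)" for x
  have iD: "set_integrable lborel unit_ivl D"
    unfolding D_def by (intro set_integral_diff weight_set_integral(1)[OF n] set_integrable_mult_right i)
  have "(LBINT x:unit_ivl. D x) = Zn n - (n + 1) * (LBINT x:unit_ivl. weight n x * x\<^sup>2)"
    unfolding D_def using weight_set_integral[OF n] i by (simp add: set_integral_diff)
  moreover have "(LBINT x:unit_ivl. D x) = 0"
  proof (rule LIMSEQ_unique[OF truncation_tendsto[OF iD]])
    define R where "R x = x * ((1 - x\<^sup>2) * weight n x)" for x
    have dR: "(R has_real_derivative D x) (at x)" if "\<bar>x\<bar> < 1" for x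
    proof -
      have "(R has_real_derivative x * (- n * x * weight n x) + 1 * ((1 - x\<^sup>2) * weight n x)) (at x)"
        unfolding R_def[abs_def] by (rule DERIV_mult'[OF DERIV_ident rho_weight_deriv[OF that]])
      moreover have "x * (- n * x * weight n x) + 1 * ((1 - x\<^sup>2) * weight n x) = D x"
        unfolding D_def by (simp add: algebra_simps power2_eq_square)
      ultimately show ?thesis by simp
    qed
    have eq: "(LBINT x:{-radius j..radius j}. D x) = 2 * (radius j * (1 - (radius j)\<^sup>2) powr (n / 2))" for j
    proof -
      have r: "\<bar>radius j\<bar> < 1" using radius[of j] by simp
      have rp: "0 < 1 - (radius j)\<^sup>2" using one_minus_square_pos[OF r] .
      have "set_integrable lborel {-radius j..radius j} D"
        by (rule set_integrable_subset[OF iD]) (use radius[of j] in auto)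
      from set_borel_integral_eq_integral(2)[OF this]
      have "(LBINT x:{-radius j..radius j}. D x) = integral {-radius j..radius j} D" .
      also have "\<dots> = R (radius j) - R (- radius j)"
      proof (rule integral_unique[OF fundamental_theorem_of_calculus])
        fix x assume "x \<in> {-radius j..radius j}"
        then have "\<bar>x\<bar> < 1" using radius[of j] by auto
        from has_field_derivative_at_within[OF dR[OF this]]
        show "(R has_vector_derivative D x) (at x within {-radius j..radius j})"
          unfolding has_real_derivative_iff_has_vector_derivative .
      qed (use radius[of j] in simp)
      also have "\<dots> = 2 * (radius j * ((1 - (radius j)\<^sup>2) * weight n (radius j)))"
        unfolding R_def weight_def rho_def by simp
      also have "(1 - (radius j)\<^sup>2) * weight n (radius j) = (1 - (radius j)\<^sup>2) powr 1 * (1 - (radius j)\<^sup>2) powr ((n - 2) / 2)"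
        using rp weight_eq[OF r] by simp
      also have "\<dots> = (1 - (radius j)\<^sup>2) powr (n / 2)"
        unfolding powr_add[symmetric] by (simp add: diff_divide_distrib)
      finally show ?thesis .
    qed
    have "(\<lambda>j. 2 * (radius j * (1 - (radius j)\<^sup>2) powr (n / 2))) \<longlonglongrightarrow> 2 * (1 * (1 - 1\<^sup>2) powr (n / 2))"
    proof (intro tendsto_mult tendsto_const radius_tendsto tendsto_powr')
      show "(\<lambda>j. 1 - (radius j)\<^sup>2) \<longlonglongrightarrow> 1 - 1\<^sup>2" by (intro tendsto_intros radius_tendsto)
      have "0 \<le> 1 - (radius j)\<^sup>2" for j using one_minus_square_pos[of "radius j"] radius[of j] by simp
      then show "1 - 1\<^sup>2 \<noteq> (0::real) \<or> 0 < n / 2 \<and> (\<forall>\<^sub>F j in sequentially. 0 \<le> 1 - (radius j)\<^sup>2)"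
        using n by simp
    qed
    then show "(\<lambda>j. LBINT x:{-radius j..radius j}. D x) \<longlonglongrightarrow> 0" unfolding eq by simp
  qed
  ultimately have "(n + 1) * (LBINT x:unit_ivl. weight n x * x\<^sup>2) = Zn n" by simp
  then have "(LBINT x:unit_ivl. weight n x * x\<^sup>2) = Zn n / (n + 1)" using n by (simp add: field_simps)
  then show ?thesis unfolding nu_integral(2)[OF n m] using Zn_pos[OF n] by simp
qed

lemma in_H1_affine:
  assumes n: "0 < n"
  shows "in_H1 n (\<lambda>z. 1 + \<epsilon> * z) (\<lambda>_. \<epsilon>)"
  unfolding in_H1_def
proof (intro conjI)
  have m1: "(\<lambda>z. 1 + \<epsilon> * z) \<in> borel_measurable (nu n)" by (rule borel_measurable_nu) measurable
  have "integrable (nu n) (\<lambda>z. (1 + \<epsilon> * z)\<^sup>2)"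
  proof (rule nu_integrable_bounded[OF n])
    show "(\<lambda>z. (1 + \<epsilon> * z)\<^sup>2) \<in> borel_measurable (nu n)" by (rule borel_measurable_nu) measurable
    fix z :: real assume "z \<in> {-1..1}"
    then have "\<bar>\<epsilon> * z\<bar> \<le> \<bar>\<epsilon>\<bar> * 1" unfolding abs_mult by (intro mult_left_mono) auto
    then have "\<bar>1 + \<epsilon> * z\<bar> \<le> 1 + \<bar>\<epsilon>\<bar>" by simp
    then have "\<bar>1 + \<epsilon> * z\<bar>\<^sup>2 \<le> (1 + \<bar>\<epsilon>\<bar>)\<^sup>2" by (intro power_mono) auto
    then show "\<bar>(1 + \<epsilon> * z)\<^sup>2\<bar> \<le> (1 + \<bar>\<epsilon>\<bar>)\<^sup>2" by simp
  qed
  then show "in_Lq n 2 (\<lambda>z. 1 + \<epsilon> * z)" unfolding in_Lq_2 using m1 by simp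
  have m2: "(\<lambda>z. rho z * \<epsilon>) \<in> borel_measurable (nu n)"
    by (rule borel_measurable_nu) (unfold rho_def, measurable)
  have "integrable (nu n) (\<lambda>z. (rho z * \<epsilon>)\<^sup>2)"
  proof (rule nu_integrable_bounded[OF n])
    show "(\<lambda>z. (rho z * \<epsilon>)\<^sup>2) \<in> borel_measurable (nu n)" using m2 by measurable
    fix z :: real assume "z \<in> {-1..1}"
    then have z2: "z\<^sup>2 \<le> 1" by (simp add: abs_square_le_1 abs_le_iff)
    then have "(rho z * \<epsilon>)\<^sup>2 = (1 - z\<^sup>2) * \<epsilon>\<^sup>2" by (simp add: rho_def power_mult_distrib)
    also have "\<dots> \<le> 1 * \<epsilon>\<^sup>2" by (intro mult_right_mono) auto
    finally show "\<bar>(rho z * \<epsilon>)\<^sup>2\<bar> \<le> \<epsilon>\<^sup>2" by simp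
  qed
  then show "in_Lq n 2 (\<lambda>z. rho z * \<epsilon>)" unfolding in_Lq_2 using m2 by simp
  have li: "locally_integrable h" if "continuous_on UNIV h" for h :: "real \<Rightarrow> real"
    unfolding locally_integrable_def set_integrable_def
    using borel_integrable_compact continuous_on_subset[OF that] by blast
  show "has_weak_deriv (\<lambda>z. 1 + \<epsilon> * z) (\<lambda>_. \<epsilon>)"
    unfolding has_weak_deriv_def
  proof (intro conjI allI impI)
    show "locally_integrable (\<lambda>z. 1 + \<epsilon> * z)" "locally_integrable (\<lambda>_. \<epsilon>)"
      by (intro li continuous_intros)+
    fix \<phi> assume \<phi>: "test_function \<phi>"
    have "((deriv ^^ 0) \<phi>) differentiable (at x)" "((deriv ^^ 1) \<phi>) differentiable (at x)" for x
      using \<phi> unfolding test_function_def by blast+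
    then have d: "(\<phi> has_real_derivative deriv \<phi> x) (at x)" and d2: "deriv \<phi> differentiable (at x)" for x
      by (auto simp: DERIV_deriv_iff_real_differentiable)
    have c\<phi>: "continuous_on S \<phi>" for S
      using d by (intro continuous_at_imp_continuous_on ballI DERIV_isCont)
    have c\<phi>': "continuous_on S (deriv \<phi>)" for S
      using d2 by (intro continuous_at_imp_continuous_on ballI differentiable_imp_continuous_within)
    obtain K where K: "compact K" "K \<subseteq> unit_ivl" "\<And>x. x \<notin> K \<Longrightarrow> \<phi> x = 0"
      using \<phi> unfolding test_function_def by blast
    have ends: "\<phi> 1 = 0" "\<phi> (-1) = 0" using K by force+
    have eq: "(LBINT x:unit_ivl. h x) = integral {-1..1} h" if "continuous_on {-1..1} h" for h :: "real \<Rightarrow> real"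
    proof -
      have "set_integrable lborel unit_ivl h"
        by (rule set_integrable_subset[OF borel_integrable_atLeastAtMost'[OF that]]) auto
      from set_borel_integral_eq_integral(2)[OF this] show ?thesis
        by (simp add: integral_open_interval_real)
    qed
    have "C1_on (-1) 1 (\<lambda>z. 1 + \<epsilon> * z) (\<lambda>_. \<epsilon>)"
      unfolding C1_on_def by (auto intro!: derivative_eq_intros continuous_intros)
    moreover have "C1_on (-1) 1 \<phi> (deriv \<phi>)"
      unfolding C1_on_def using c\<phi>' d has_field_derivative_at_within by blast
    ultimately have "integral {-1..1} (\<lambda>x. \<epsilon> * \<phi> x) = - integral {-1..1} (\<lambda>x. (1 + \<epsilon> * x) * deriv \<phi> x)"
      using C1_on_by_parts[of "-1" 1 "\<lambda>z. 1 + \<epsilon> * z" "\<lambda>_. \<epsilon>" \<phi> "deriv \<phi>"] ends by simp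
    moreover have "(LBINT x:unit_ivl. (1 + \<epsilon> * x) * deriv \<phi> x) = integral {-1..1} (\<lambda>x. (1 + \<epsilon> * x) * deriv \<phi> x)"
      by (intro eq continuous_intros c\<phi>')
    moreover have "(LBINT x:unit_ivl. \<epsilon> * \<phi> x) = integral {-1..1} (\<lambda>x. \<epsilon> * \<phi> x)"
      by (intro eq continuous_intros c\<phi>)
    ultimately show "(LBINT x:unit_ivl. (1 + \<epsilon> * x) * deriv \<phi> x) = - (LBINT x:unit_ivl. \<epsilon> * \<phi> x)" by simp
  qed
qed

lemma energy_affine:
  assumes n: "0 < n"
  shows "(Lq_norm n 2 (\<lambda>z. rho z * \<epsilon>))\<^sup>2 = n / (n + 1) * \<epsilon>\<^sup>2"
proof -
  have "AE z in nu n. (rho z * \<epsilon>)\<^sup>2 = \<epsilon>\<^sup>2 * (1 - z\<^sup>2)"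
  proof (rule AE_I2)
    fix z assume "z \<in> space (nu n)"
    then have "z \<in> {-1..1}" by (simp add: nu_def)
    then have "z\<^sup>2 \<le> 1" by (simp add: abs_square_le_1 abs_le_iff)
    then show "(rho z * \<epsilon>)\<^sup>2 = \<epsilon>\<^sup>2 * (1 - z\<^sup>2)" by (simp add: rho_def power_mult_distrib)
  qed
  then have "(\<integral>z. (rho z * \<epsilon>)\<^sup>2 \<partial>nu n) = (\<integral>z. \<epsilon>\<^sup>2 * (1 - z\<^sup>2) \<partial>nu n)"
    by (intro integral_cong_AE borel_measurable_nu) (unfold rho_def, measurable)
  moreover have "integrable (nu n) (\<lambda>z. z\<^sup>2)"
    by (rule nu_integrable_bounded[OF n borel_measurable_nu, of _ 1]) (auto simp: abs_square_le_1)
  ultimately have "(\<integral>z. (rho z * \<epsilon>)\<^sup>2 \<partial>nu n) = \<epsilon>\<^sup>2 * (1 - 1 / (n + 1))"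
    using prob_space_nu[OF n, of 1] nu_second_moment[OF n] by simp
  also have "1 - 1 / (n + 1) = n / (n + 1)" using n by (simp add: field_simps)
  finally show ?thesis unfolding Lq_norm_2_square by simp
qed

section \<open>Second-order expansions around the constant function 1\<close>

lemma taylor_2_bound:
  fixes h h' h'' h''' :: "real \<Rightarrow> real"
  assumes d: "\<And>t. \<bar>t\<bar> \<le> 1 / 2 \<Longrightarrow> (h has_real_derivative h' t) (at t)"
    "\<And>t. \<bar>t\<bar> \<le> 1 / 2 \<Longrightarrow> (h' has_real_derivative h'' t) (at t)"
    "\<And>t. \<bar>t\<bar> \<le> 1 / 2 \<Longrightarrow> (h'' has_real_derivative h''' t) (at t)"
    and K: "\<And>t. \<bar>t\<bar> \<le> 1 / 2 \<Longrightarrow> \<bar>h''' t\<bar> \<le> K" and x: "\<bar>x\<bar> \<le> 1 / 2"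
  shows "\<bar>h x - (h 0 + h' 0 * x + h'' 0 / 2 * x\<^sup>2)\<bar> \<le> K * \<bar>x\<bar> ^ 3"
proof (cases "x = 0")
  case False
  define D where "D m = (if m = 0 then h else if m = 1 then h' else if m = 2 then h'' else h''')" for m :: nat
  have "\<exists>t. (if x < 0 then x < t \<and> t < 0 else 0 < t \<and> t < x) \<and>
      h x = (\<Sum>m<3. D m 0 / fact m * (x - 0) ^ m) + D 3 t / fact 3 * (x - 0) ^ 3"
  proof (rule Taylor[where a = "- 1 / 2" and b = "1 / 2"])
    show "\<forall>m t. m < 3 \<and> - 1 / 2 \<le> t \<and> t \<le> 1 / 2 \<longrightarrow> (D m has_real_derivative D (Suc m) t) (at t)"
    proof (intro allI impI)
      fix m :: nat and t :: real assume t: "m < 3 \<and> - 1 / 2 \<le> t \<and> t \<le> 1 / 2"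
      then have "\<bar>t\<bar> \<le> 1 / 2" by auto
      moreover have "m = 0 \<or> m = 1 \<or> m = 2" using t by auto
      ultimately show "(D m has_real_derivative D (Suc m) t) (at t)" using d by (auto simp: D_def)
    qed
  qed (use x False in \<open>auto simp: D_def\<close>)
  then obtain t where t: "if x < 0 then x < t \<and> t < 0 else 0 < t \<and> t < x"
    "h x = (\<Sum>m<3. D m 0 / fact m * (x - 0) ^ m) + D 3 t / fact 3 * (x - 0) ^ 3" by blast
  have eq: "h x - (h 0 + h' 0 * x + h'' 0 / 2 * x\<^sup>2) = h''' t / 6 * x ^ 3"
    using t(2) by (simp add: D_def numeral_3_eq_3 numeral_2_eq_2 lessThan_Suc fact_numeral)
  have "\<bar>h x - (h 0 + h' 0 * x + h'' 0 / 2 * x\<^sup>2)\<bar> = \<bar>h''' t\<bar> / 6 * \<bar>x\<bar> ^ 3"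
    unfolding eq by (simp add: abs_mult power_abs)
  also have "\<dots> \<le> K * \<bar>x\<bar> ^ 3"
  proof (rule mult_right_mono)
    have "\<bar>t\<bar> \<le> 1 / 2" using t(1) x by (auto split: if_splits)
    then have "\<bar>h''' t\<bar> \<le> K" by (rule K)
    then show "\<bar>h''' t\<bar> / 6 \<le> K" using abs_ge_zero[of "h''' t"] by linarith
  qed simp
  finally show ?thesis .
qed (use K[of 0] in simp)

text \<open>The linear term integrates to 0 by symmetry, the quadratic one contributes the second
  moment 1 / (n + 1), and the remainder is cubic in \<epsilon> uniformly in z because z stays in
  [-1, 1].\<close>

lemma second_order_moment_tendsto:
  fixes h :: "real \<Rightarrow> real"
  assumes n: "0 < n" and hm: "h \<in> borel_measurable borel"
    and T: "\<And>x. \<bar>x\<bar> \<le> 1 / 2 \<Longrightarrow> \<bar>h x - (c0 + c1 * x + c2 * x\<^sup>2)\<bar> \<le> K * \<bar>x\<bar> ^ 3"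
  shows "((\<lambda>\<epsilon>. ((\<integral>z. h (\<epsilon> * z) \<partial>nu n) - c0) / \<epsilon>\<^sup>2) \<longlongrightarrow> c2 / (n + 1)) (at_right 0)"
    "\<And>\<epsilon>. \<bar>\<epsilon>\<bar> \<le> 1 / 2 \<Longrightarrow> integrable (nu n) (\<lambda>z. h (\<epsilon> * z))"
proof -
  have [measurable]: "h \<in> borel_measurable borel" by (rule hm)
  have sm: "\<bar>\<epsilon> * z\<bar> \<le> \<bar>\<epsilon>\<bar>" if "z \<in> {-1..1}" for \<epsilon> z :: real
  proof -
    have "\<bar>\<epsilon> * z\<bar> \<le> \<bar>\<epsilon>\<bar> * 1" unfolding abs_mult using that by (intro mult_left_mono) auto
    then show ?thesis by simp
  qed
  have K0: "0 \<le> K" using order_trans[OF abs_ge_zero T[of "1 / 2"]] by (simp add: power_divide)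
  have iz: "integrable (nu n) (\<lambda>z. z)" "integrable (nu n) (\<lambda>z. z\<^sup>2)"
    by (rule nu_integrable_bounded[OF n borel_measurable_nu, of _ 1]; auto simp: abs_square_le_1)+
  have rem: "\<bar>h (\<epsilon> * z) - (c0 + c1 * (\<epsilon> * z) + c2 * (\<epsilon> * z)\<^sup>2)\<bar> \<le> K * \<bar>\<epsilon>\<bar> ^ 3"
    if e: "\<bar>\<epsilon>\<bar> \<le> 1 / 2" and z: "z \<in> {-1..1}" for \<epsilon> z
  proof -
    have "\<bar>\<epsilon> * z\<bar> \<le> 1 / 2" using sm[OF z, of \<epsilon>] e by linarith
    from T[OF this]
    have "\<bar>h (\<epsilon> * z) - (c0 + c1 * (\<epsilon> * z) + c2 * (\<epsilon> * z)\<^sup>2)\<bar> \<le> K * \<bar>\<epsilon> * z\<bar> ^ 3" .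
    also have "\<dots> \<le> K * \<bar>\<epsilon>\<bar> ^ 3" using sm[OF z, of \<epsilon>] K0 by (intro mult_left_mono power_mono) auto
    finally show ?thesis .
  qed
  have ir: "integrable (nu n) (\<lambda>z. h (\<epsilon> * z) - (c0 + c1 * (\<epsilon> * z) + c2 * (\<epsilon> * z)\<^sup>2))" if e: "\<bar>\<epsilon>\<bar> \<le> 1 / 2" for \<epsilon>
    by (rule nu_integrable_bounded[OF n borel_measurable_nu rem[OF e]]) measurable
  have ip: "integrable (nu n) (\<lambda>z. c0 + c1 * (\<epsilon> * z) + c2 * (\<epsilon> * z)\<^sup>2)" for \<epsilon>
    using iz prob_space_nu(1)[OF n, of c0] by (simp add: power_mult_distrib)
  show ih: "integrable (nu n) (\<lambda>z. h (\<epsilon> * z))" if e: "\<bar>\<epsilon>\<bar> \<le> 1 / 2" for \<epsilon>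
    using Bochner_Integration.integrable_add[OF ir[OF e] ip[of \<epsilon>]] by simp
  have poly: "(\<integral>z. c0 + c1 * (\<epsilon> * z) + c2 * (\<epsilon> * z)\<^sup>2 \<partial>nu n) = c0 + c2 * \<epsilon>\<^sup>2 / (n + 1)" for \<epsilon>
    using iz prob_space_nu[OF n, of c0] nu_first_moment[OF n] nu_second_moment[OF n]
    by (simp add: power_mult_distrib)
  have est: "\<bar>((\<integral>z. h (\<epsilon> * z) \<partial>nu n) - c0) / \<epsilon>\<^sup>2 - c2 / (n + 1)\<bar> \<le> K * \<epsilon>" if e: "0 < \<epsilon>" "\<epsilon> < 1 / 2" for \<epsilon>
  proof -
    have e': "\<bar>\<epsilon>\<bar> \<le> 1 / 2" using e by simp
    have "\<bar>(\<integral>z. h (\<epsilon> * z) - (c0 + c1 * (\<epsilon> * z) + c2 * (\<epsilon> * z)\<^sup>2) \<partial>nu n)\<bar>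
        \<le> (\<integral>z. \<bar>h (\<epsilon> * z) - (c0 + c1 * (\<epsilon> * z) + c2 * (\<epsilon> * z)\<^sup>2)\<bar> \<partial>nu n)"
      by (rule integral_abs_bound)
    also have "\<dots> \<le> (\<integral>z. K * \<bar>\<epsilon>\<bar> ^ 3 \<partial>nu n)"
      by (intro integral_mono integrable_abs ir[OF e'] prob_space_nu(1)[OF n] rem[OF e']) (simp add: nu_def)
    also have "\<dots> = K * \<epsilon> ^ 3" unfolding prob_space_nu(2)[OF n] using e by simp
    finally have "\<bar>(\<integral>z. h (\<epsilon> * z) \<partial>nu n) - (c0 + c2 * \<epsilon>\<^sup>2 / (n + 1))\<bar> \<le> K * \<epsilon> ^ 3"
      unfolding Bochner_Integration.integral_diff[OF ih[OF e'] ip] poly .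
    then have "\<bar>(\<integral>z. h (\<epsilon> * z) \<partial>nu n) - (c0 + c2 * \<epsilon>\<^sup>2 / (n + 1))\<bar> / \<epsilon>\<^sup>2 \<le> K * \<epsilon> ^ 3 / \<epsilon>\<^sup>2"
      by (rule divide_right_mono) simp
    moreover have "K * \<epsilon> ^ 3 / \<epsilon>\<^sup>2 = K * \<epsilon>" using e by (simp add: power2_eq_square power3_eq_cube)
    moreover have "\<bar>(\<integral>z. h (\<epsilon> * z) \<partial>nu n) - (c0 + c2 * \<epsilon>\<^sup>2 / (n + 1))\<bar> / \<epsilon>\<^sup>2
        = \<bar>((\<integral>z. h (\<epsilon> * z) \<partial>nu n) - (c0 + c2 * \<epsilon>\<^sup>2 / (n + 1))) / \<epsilon>\<^sup>2\<bar>" by simp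
    moreover have "((\<integral>z. h (\<epsilon> * z) \<partial>nu n) - (c0 + c2 * \<epsilon>\<^sup>2 / (n + 1))) / \<epsilon>\<^sup>2
        = ((\<integral>z. h (\<epsilon> * z) \<partial>nu n) - c0) / \<epsilon>\<^sup>2 - c2 / (n + 1)"
      using e by (simp add: diff_divide_distrib add_divide_distrib)
    ultimately show ?thesis by simp
  qed
  have "((\<lambda>\<epsilon>. ((\<integral>z. h (\<epsilon> * z) \<partial>nu n) - c0) / \<epsilon>\<^sup>2 - c2 / (n + 1)) \<longlongrightarrow> 0) (at_right 0)"
  proof (rule Lim_null_comparison)
    have "\<forall>\<^sub>F \<epsilon> in at_right (0::real). \<epsilon> \<in> {0<..<1 / 2}" by (rule eventually_at_right_real) simp
    then show "\<forall>\<^sub>F \<epsilon> in at_right 0. norm (((\<integral>z. h (\<epsilon> * z) \<partial>nu n) - c0) / \<epsilon>\<^sup>2 - c2 / (n + 1)) \<le> K * \<epsilon>"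
      by eventually_elim (use est in auto)
    have "((\<lambda>\<epsilon>. K * \<epsilon>) \<longlongrightarrow> K * 0) (at_right 0)" by (intro tendsto_intros)
    then show "((\<lambda>\<epsilon>. K * \<epsilon>) \<longlongrightarrow> 0) (at_right 0)" by simp
  qed
  then show "((\<lambda>\<epsilon>. ((\<integral>z. h (\<epsilon> * z) \<partial>nu n) - c0) / \<epsilon>\<^sup>2) \<longlongrightarrow> c2 / (n + 1)) (at_right 0)"
    by (simp add: LIM_zero_iff)
qed

text \<open>A chain rule at second order in \<epsilon>. The Caratheodory form of the derivative
  avoids a division by \<open>V \<epsilon> - 1\<close>, which may vanish.\<close>

lemma second_order_compose:
  fixes V \<phi> :: "real \<Rightarrow> real"
  assumes V: "((\<lambda>\<epsilon>. (V \<epsilon> - 1) / \<epsilon>\<^sup>2) \<longlongrightarrow> a) (at_right 0)" and \<phi>: "(\<phi> has_real_derivative l) (at 1)"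
  shows "((\<lambda>\<epsilon>. (\<phi> (V \<epsilon>) - \<phi> 1) / \<epsilon>\<^sup>2) \<longlongrightarrow> l * a) (at_right 0)"
proof -
  obtain g where g: "\<And>z. \<phi> z - \<phi> 1 = g z * (z - 1)" "isCont g 1" "g 1 = l"
    using \<phi> unfolding CARAT_DERIV by blast
  have "((\<lambda>\<epsilon>. (V \<epsilon> - 1) / \<epsilon>\<^sup>2 * \<epsilon>\<^sup>2 + 1) \<longlongrightarrow> a * 0\<^sup>2 + 1) (at_right 0)"
    by (intro tendsto_add tendsto_mult V tendsto_power tendsto_ident_at tendsto_const)
  moreover have "\<forall>\<^sub>F \<epsilon> in at_right 0. (V \<epsilon> - 1) / \<epsilon>\<^sup>2 * \<epsilon>\<^sup>2 + 1 = V \<epsilon>"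
    by (simp add: eventually_at_filter)
  ultimately have "(V \<longlongrightarrow> a * 0\<^sup>2 + 1) (at_right 0)" by (rule Lim_transform_eventually)
  then have "(V \<longlongrightarrow> 1) (at_right 0)" by simp
  then have "((\<lambda>\<epsilon>. g (V \<epsilon>)) \<longlongrightarrow> l) (at_right 0)" using g(2,3) isCont_tendsto_compose by metis
  then have "((\<lambda>\<epsilon>. g (V \<epsilon>) * ((V \<epsilon> - 1) / \<epsilon>\<^sup>2)) \<longlongrightarrow> l * a) (at_right 0)" by (intro tendsto_mult V)
  then show ?thesis unfolding g(1) by simp
qed

lemma one_plus_powr_bound:
  fixes t q :: real
  assumes "\<bar>t\<bar> \<le> 1 / 2"
  shows "(1 + t) powr q \<le> 2 powr \<bar>q\<bar>"
proof -
  have t: "1 / 2 \<le> 1 + t" "1 + t \<le> 2" using assms by auto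
  show ?thesis
  proof (cases "0 \<le> q")
    case True
    then have "(1 + t) powr q \<le> 2 powr q" using t by (intro powr_mono2) auto
    then show ?thesis using True by simp
  next
    case False
    then have "(1 + t) powr q \<le> (1 / 2) powr q" using t by (intro powr_mono2') auto
    also have "\<dots> = 2 powr (- q)" by (simp add: powr_divide powr_minus inverse_eq_divide)
    finally show ?thesis using False by simp
  qed
qed

lemma abs_one_plus:
  fixes \<epsilon> z :: real
  assumes "\<bar>\<epsilon>\<bar> \<le> 1 / 2" "z \<in> {-1..1}"
  shows "1 / 2 \<le> 1 + \<epsilon> * z"
proof -
  have "\<bar>\<epsilon> * z\<bar> \<le> (1 / 2) * 1" unfolding abs_mult using assms by (intro mult_mono) auto
  then show ?thesis by (simp add: abs_le_iff)
qed

text \<open>The p-integral has the second-order coefficient p (p - 1) / 2 times the second moment,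
  and the outer power has derivative 2 / p at 1; their product leaves p - 1.\<close>

lemma Lq_norm_affine_tendsto:
  assumes n: "0 < n" and p: "1 \<le> p"
  shows "((\<lambda>\<epsilon>. ((Lq_norm n p (\<lambda>z. 1 + \<epsilon> * z))\<^sup>2 - 1) / \<epsilon>\<^sup>2) \<longlongrightarrow> (p - 1) / (n + 1)) (at_right 0)"
    "\<bar>\<epsilon>\<bar> \<le> 1 / 2 \<Longrightarrow> in_Lq n p (\<lambda>z. 1 + \<epsilon> * z)"
proof -
  define h where "h x = (1 + x) powr p" for x :: real
  have hm: "h \<in> borel_measurable borel" unfolding h_def[abs_def] by measurable
  have D: "((\<lambda>x. (1 + x) powr q) has_real_derivative q * (1 + t) powr (q - 1)) (at t)" if "\<bar>t\<bar> \<le> 1 / 2" for t q :: real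
  proof -
    have "((\<lambda>x. 1 + x) has_real_derivative 1) (at t)" by (auto intro!: derivative_eq_intros)
    from DERIV_fun_powr[OF this, of q] that show ?thesis by simp
  qed
  \<comment> \<open>The coefficient of the third derivative times a bound for (1 + t)^(p - 3) on |t|
    \<le> 1/2.\<close>
  define K where "K = \<bar>p * ((p - 1) * (p - 2))\<bar> * 2 powr \<bar>p - 3\<bar>"
  have T: "\<bar>h x - (1 + p * x + (p * (p - 1) / 2) * x\<^sup>2)\<bar> \<le> K * \<bar>x\<bar> ^ 3" if x: "\<bar>x\<bar> \<le> 1 / 2" for x
  proof -
    have "\<bar>h x - (h 0 + (p * (1 + 0) powr (p - 1)) * x + (p * ((p - 1) * (1 + 0) powr (p - 2))) / 2 * x\<^sup>2)\<bar> \<le> K * \<bar>x\<bar> ^ 3"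
    proof (rule taylor_2_bound[where h = h and h' = "\<lambda>x. p * (1 + x) powr (p - 1)"
          and h'' = "\<lambda>x. p * ((p - 1) * (1 + x) powr (p - 2))" and h''' = "\<lambda>x. p * ((p - 1) * ((p - 2) * (1 + x) powr (p - 3)))", OF _ _ _ _ x])
      fix t :: real assume t: "\<bar>t\<bar> \<le> 1 / 2"
      show "(h has_real_derivative p * (1 + t) powr (p - 1)) (at t)"
        unfolding h_def[abs_def] by (rule D[OF t])
      show "((\<lambda>x. p * (1 + x) powr (p - 1)) has_real_derivative p * ((p - 1) * (1 + t) powr (p - 2))) (at t)"
        using DERIV_cmult[OF D[OF t, of "p - 1"], of p] by simp
      show "((\<lambda>x. p * ((p - 1) * (1 + x) powr (p - 2))) has_real_derivative p * ((p - 1) * ((p - 2) * (1 + t) powr (p - 3)))) (at t)"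
        using DERIV_cmult[OF DERIV_cmult[OF D[OF t, of "p - 2"], of "p - 1"], of p] by simp
      have "\<bar>p * ((p - 1) * ((p - 2) * (1 + t) powr (p - 3)))\<bar> = \<bar>p * ((p - 1) * (p - 2))\<bar> * (1 + t) powr (p - 3)"
        by (simp add: abs_mult)
      also have "\<dots> \<le> K" unfolding K_def using one_plus_powr_bound[OF t] by (intro mult_left_mono) auto
      finally show "\<bar>p * ((p - 1) * ((p - 2) * (1 + t) powr (p - 3)))\<bar> \<le> K" .
    qed
    moreover have "h 0 + (p * (1 + 0) powr (p - 1)) * x + (p * ((p - 1) * (1 + 0) powr (p - 2))) / 2 * x\<^sup>2
        = 1 + p * x + (p * (p - 1) / 2) * x\<^sup>2" unfolding h_def by simp
    ultimately show ?thesis by simp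
  qed
  have eq: "\<bar>1 + \<epsilon> * z\<bar> powr p = h (\<epsilon> * z)" if "\<bar>\<epsilon>\<bar> \<le> 1 / 2" "z \<in> space (nu n)" for \<epsilon> z
    using abs_one_plus[of \<epsilon> z] that unfolding h_def by (simp add: nu_def)
  have N: "(Lq_norm n p (\<lambda>z. 1 + \<epsilon> * z))\<^sup>2 = (\<integral>z. h (\<epsilon> * z) \<partial>nu n) powr (2 / p)" if "\<bar>\<epsilon>\<bar> \<le> 1 / 2" for \<epsilon>
    unfolding Lq_norm_square using eq[OF that] by (simp cong: Bochner_Integration.integral_cong)
  have "((\<lambda>y. y powr (2 / p)) has_real_derivative (2 / p) * 1 powr (2 / p - 1)) (at 1)"
    by (rule has_real_derivative_powr) simp
  from second_order_compose[OF second_order_moment_tendsto(1)[OF n hm T] this]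
  have "((\<lambda>\<epsilon>. ((\<integral>z. h (\<epsilon> * z) \<partial>nu n) powr (2 / p) - 1) / \<epsilon>\<^sup>2) \<longlongrightarrow>
      (2 / p) * 1 powr (2 / p - 1) * (p * (p - 1) / 2 / (n + 1))) (at_right 0)" by simp
  moreover have "(2 / p) * 1 powr (2 / p - 1) * (p * (p - 1) / 2 / (n + 1)) = (p - 1) / (n + 1)"
  proof -
    have "(2 / p) * (p * (p - 1) / 2) = p - 1" using p by (simp add: divide_simps)
    then show ?thesis by (metis mult_1_right powr_one_eq_one times_divide_eq_right)
  qed
  ultimately have "((\<lambda>\<epsilon>. ((\<integral>z. h (\<epsilon> * z) \<partial>nu n) powr (2 / p) - 1) / \<epsilon>\<^sup>2) \<longlongrightarrow> (p - 1) / (n + 1)) (at_right 0)" by simp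
  moreover have "\<forall>\<^sub>F \<epsilon> in at_right 0. ((\<integral>z. h (\<epsilon> * z) \<partial>nu n) powr (2 / p) - 1) / \<epsilon>\<^sup>2 = ((Lq_norm n p (\<lambda>z. 1 + \<epsilon> * z))\<^sup>2 - 1) / \<epsilon>\<^sup>2"
  proof -
    have "\<forall>\<^sub>F \<epsilon> in at_right (0::real). \<epsilon> \<in> {0<..<1 / 2}" by (rule eventually_at_right_real) simp
    then show ?thesis by eventually_elim (simp add: N)
  qed
  ultimately show "((\<lambda>\<epsilon>. ((Lq_norm n p (\<lambda>z. 1 + \<epsilon> * z))\<^sup>2 - 1) / \<epsilon>\<^sup>2) \<longlongrightarrow> (p - 1) / (n + 1)) (at_right 0)"
    by (rule Lim_transform_eventually)
  assume e: "\<bar>\<epsilon>\<bar> \<le> 1 / 2"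
  have "integrable (nu n) (\<lambda>z. \<bar>1 + \<epsilon> * z\<bar> powr p)"
    using second_order_moment_tendsto(2)[OF n hm T e] by (subst Bochner_Integration.integrable_cong[OF refl eq[OF e]])
  then show "in_Lq n p (\<lambda>z. 1 + \<epsilon> * z)"
    unfolding in_Lq_def by (intro conjI borel_measurable_nu) auto
qed

text \<open>At order \<epsilon>^2 the difference of the squared norms is (p - 2) / (n + 1), so p - 2
  cancels whatever its sign. The comparison becomes n / (n + 1) against C / (n + 1).\<close>

lemma interpolation_constant_sharp:
  assumes n: "0 < n" and p: "1 \<le> p" "p \<noteq> 2" and C: "n < C"
  shows "\<exists>f f'. in_H1 n f f' \<and> in_Lq n p f \<and>
    (Lq_norm n 2 (\<lambda>z. rho z * f' z))\<^sup>2 < C / (p - 2) * ((Lq_norm n p f)\<^sup>2 - (Lq_norm n 2 f)\<^sup>2)"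
proof -
  let ?f = "\<lambda>\<epsilon> z. 1 + \<epsilon> * z :: real"
  have "((\<lambda>\<epsilon>. C / (p - 2) * (((Lq_norm n p (?f \<epsilon>))\<^sup>2 - 1) / \<epsilon>\<^sup>2 - ((Lq_norm n 2 (?f \<epsilon>))\<^sup>2 - 1) / \<epsilon>\<^sup>2)) \<longlongrightarrow>
      C / (p - 2) * ((p - 1) / (n + 1) - (2 - 1) / (n + 1))) (at_right 0)"
    by (intro tendsto_mult tendsto_const tendsto_diff Lq_norm_affine_tendsto n p) simp
  moreover have "C / (p - 2) * ((p - 1) / (n + 1) - (2 - 1) / (n + 1)) = C / (n + 1)"
    using p n by (simp add: diff_divide_distrib[symmetric])
  moreover have "n / (n + 1) < C / (n + 1)" using n C by (intro divide_strict_right_mono) auto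
  ultimately have "\<forall>\<^sub>F \<epsilon> in at_right 0. n / (n + 1) <
      C / (p - 2) * (((Lq_norm n p (?f \<epsilon>))\<^sup>2 - 1) / \<epsilon>\<^sup>2 - ((Lq_norm n 2 (?f \<epsilon>))\<^sup>2 - 1) / \<epsilon>\<^sup>2)"
    by (auto dest: order_tendstoD(1))
  moreover have "\<forall>\<^sub>F \<epsilon> in at_right (0::real). \<epsilon> \<in> {0<..<1 / 2}" by (rule eventually_at_right_real) simp
  ultimately have "\<forall>\<^sub>F \<epsilon> in at_right 0. \<epsilon> \<in> {0<..<1 / 2} \<and> n / (n + 1) <
      C / (p - 2) * (((Lq_norm n p (?f \<epsilon>))\<^sup>2 - 1) / \<epsilon>\<^sup>2 - ((Lq_norm n 2 (?f \<epsilon>))\<^sup>2 - 1) / \<epsilon>\<^sup>2)"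
    by eventually_elim simp
  from eventually_happens'[OF trivial_limit_at_right_real this] obtain \<epsilon>
    where e0: "\<epsilon> \<in> {0<..<1 / 2}" and lt: "n / (n + 1) <
      C / (p - 2) * (((Lq_norm n p (?f \<epsilon>))\<^sup>2 - 1) / \<epsilon>\<^sup>2 - ((Lq_norm n 2 (?f \<epsilon>))\<^sup>2 - 1) / \<epsilon>\<^sup>2)" by blast
  then have e: "0 < \<epsilon>" "\<epsilon> < 1 / 2" by simp_all
  have "n / (n + 1) * \<epsilon>\<^sup>2 <
      C / (p - 2) * (((Lq_norm n p (?f \<epsilon>))\<^sup>2 - 1) / \<epsilon>\<^sup>2 - ((Lq_norm n 2 (?f \<epsilon>))\<^sup>2 - 1) / \<epsilon>\<^sup>2) * \<epsilon>\<^sup>2"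
    using lt e by (intro mult_strict_right_mono) auto
  also have "\<dots> = C / (p - 2) * ((Lq_norm n p (?f \<epsilon>))\<^sup>2 - (Lq_norm n 2 (?f \<epsilon>))\<^sup>2)"
    using e by (simp add: diff_divide_distrib[symmetric])
  finally have "(Lq_norm n 2 (\<lambda>z. rho z * \<epsilon>))\<^sup>2 < C / (p - 2) * ((Lq_norm n p (?f \<epsilon>))\<^sup>2 - (Lq_norm n 2 (?f \<epsilon>))\<^sup>2)"
    unfolding energy_affine[OF n] .
  then show ?thesis
    using in_H1_affine[OF n, of \<epsilon>] Lq_norm_affine_tendsto(2)[OF n p(1), of \<epsilon>] e
    by (intro exI[of _ "?f \<epsilon>"] exI[of _ "\<lambda>_. \<epsilon>"]) simp
qed

text \<open>The function h is (1 + x)^2 ln ((1 + x)^2), with expansion 2 x + 3 x^2. Normalization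
  subtracts B ln B, which is of order \<epsilon>^2 / (n + 1); the entropy is therefore 2
  \<epsilon>^2 / (n + 1) to leading order, against the energy n \<epsilon>^2 / (n + 1).\<close>

lemma log_sobolev_constant_sharp:
  assumes n: "0 < n" and C: "n / 2 < C"
  shows "\<exists>f f'. in_H1 n f f' \<and> integrable (nu n) (entropy_integrand n f) \<and>
    (Lq_norm n 2 (\<lambda>z. rho z * f' z))\<^sup>2 < C * (\<integral>z. entropy_integrand n f z \<partial>(nu n))"
proof -
  let ?f = "\<lambda>\<epsilon> z. 1 + \<epsilon> * z :: real"
  define h where "h x = 2 * ((1 + x)\<^sup>2 * ln (1 + x))" for x :: real
  have hm: "h \<in> borel_measurable borel" unfolding h_def[abs_def] by measurable
  \<comment> \<open>The third derivative of h is 4 / (1 + t), at most 8 for t \<ge> - 1/2.\<close>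
  have T: "\<bar>h x - (0 + 2 * x + 3 * x\<^sup>2)\<bar> \<le> 8 * \<bar>x\<bar> ^ 3" if x: "\<bar>x\<bar> \<le> 1 / 2" for x
  proof -
    have "\<bar>h x - (h 0 + (4 * ((1 + 0) * ln (1 + 0)) + 2 * (1 + 0)) * x + (4 * ln (1 + 0) + 6) / 2 * x\<^sup>2)\<bar> \<le> 8 * \<bar>x\<bar> ^ 3"
    proof (rule taylor_2_bound[where h = h and h' = "\<lambda>x. 4 * ((1 + x) * ln (1 + x)) + 2 * (1 + x)"
          and h'' = "\<lambda>x. 4 * ln (1 + x) + 6" and h''' = "\<lambda>x. 4 / (1 + x)", OF _ _ _ _ x])
      fix t :: real assume t: "\<bar>t\<bar> \<le> 1 / 2"
      then have pos: "0 < 1 + t" "1 / 2 \<le> 1 + t" by auto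
      show "(h has_real_derivative 4 * ((1 + t) * ln (1 + t)) + 2 * (1 + t)) (at t)"
      proof -
        have a: "((\<lambda>x. 1 + x) has_real_derivative 1) (at t)" by (auto intro!: derivative_eq_intros)
        have b: "((\<lambda>x. (1 + x) * ln (1 + x)) has_real_derivative ln (1 + t) + 1) (at t)"
          using pos by (auto intro!: derivative_eq_intros)
        have "h = (\<lambda>x. 2 * ((1 + x) * ((1 + x) * ln (1 + x))))"
          unfolding h_def[abs_def] by (simp add: power2_eq_square mult.assoc)
        then show ?thesis
          using DERIV_cmult[OF DERIV_mult'[OF a b], of 2] by (simp add: algebra_simps)
      qed
      show "((\<lambda>x. 4 * ((1 + x) * ln (1 + x)) + 2 * (1 + x)) has_real_derivative 4 * ln (1 + t) + 6) (at t)"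
        using pos by (auto intro!: derivative_eq_intros)
      show "((\<lambda>x. 4 * ln (1 + x) + 6) has_real_derivative 4 / (1 + t)) (at t)"
        using pos by (auto intro!: derivative_eq_intros)
      show "\<bar>4 / (1 + t)\<bar> \<le> 8" using pos by (simp add: field_simps)
    qed
    then show ?thesis by (simp add: h_def)
  qed
  define B where "B \<epsilon> = (Lq_norm n 2 (?f \<epsilon>))\<^sup>2" for \<epsilon>
  have iz: "integrable (nu n) (\<lambda>z. z)" "integrable (nu n) (\<lambda>z. z\<^sup>2)"
    by (rule nu_integrable_bounded[OF n borel_measurable_nu, of _ 1]; auto simp: abs_square_le_1)+
  have sq: "(1 + \<epsilon> * z)\<^sup>2 = 1 + 2 * \<epsilon> * z + \<epsilon>\<^sup>2 * z\<^sup>2" for \<epsilon> z :: real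
    by (simp add: power2_eq_square algebra_simps)
  have isq: "integrable (nu n) (\<lambda>z. (1 + \<epsilon> * z)\<^sup>2)" for \<epsilon>
    unfolding sq using iz prob_space_nu(1)[OF n, of 1] by simp
  have B: "B \<epsilon> = 1 + \<epsilon>\<^sup>2 / (n + 1)" for \<epsilon>
    unfolding B_def Lq_norm_2_square sq
    using iz prob_space_nu[OF n, of 1] nu_first_moment[OF n] nu_second_moment[OF n] by simp
  have Bpos: "0 < B \<epsilon>" for \<epsilon> unfolding B using n by (intro add_pos_nonneg) auto
  define H where "H \<epsilon> = (\<integral>z. h (\<epsilon> * z) \<partial>nu n)" for \<epsilon>
  have ent: "integrable (nu n) (entropy_integrand n (?f \<epsilon>))"
    "(\<integral>z. entropy_integrand n (?f \<epsilon>) z \<partial>nu n) = H \<epsilon> - B \<epsilon> * ln (B \<epsilon>)" if e: "\<bar>\<epsilon>\<bar> \<le> 1 / 2" for \<epsilon>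
  proof -
    have eq: "entropy_integrand n (?f \<epsilon>) z = h (\<epsilon> * z) - ln (B \<epsilon>) * (1 + \<epsilon> * z)\<^sup>2" if "z \<in> space (nu n)" for z
    proof -
      have p: "0 < 1 + \<epsilon> * z" using abs_one_plus[OF e, of z] that by (simp add: nu_def)
      have l: "ln ((1 + \<epsilon> * z)\<^sup>2 / B \<epsilon>) = 2 * ln (1 + \<epsilon> * z) - ln (B \<epsilon>)"
        using p Bpos[of \<epsilon>] by (simp add: ln_div ln_realpow)
      show ?thesis unfolding entropy_integrand_def B_def[symmetric] l h_def by (simp add: algebra_simps)
    qed
    have ih: "integrable (nu n) (\<lambda>z. h (\<epsilon> * z))" by (rule second_order_moment_tendsto(2)[OF n hm T e])
    have i: "integrable (nu n) (\<lambda>z. h (\<epsilon> * z) - ln (B \<epsilon>) * (1 + \<epsilon> * z)\<^sup>2)"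
      by (intro Bochner_Integration.integrable_diff ih integrable_mult_right isq)
    then show "integrable (nu n) (entropy_integrand n (?f \<epsilon>))"
      by (subst Bochner_Integration.integrable_cong[OF refl eq])
    have "(\<integral>z. entropy_integrand n (?f \<epsilon>) z \<partial>nu n) = (\<integral>z. h (\<epsilon> * z) - ln (B \<epsilon>) * (1 + \<epsilon> * z)\<^sup>2 \<partial>nu n)"
      by (rule Bochner_Integration.integral_cong[OF refl eq])
    also have "\<dots> = H \<epsilon> - ln (B \<epsilon>) * (\<integral>z. (1 + \<epsilon> * z)\<^sup>2 \<partial>nu n)"
      unfolding H_def using ih isq by simp
    finally show "(\<integral>z. entropy_integrand n (?f \<epsilon>) z \<partial>nu n) = H \<epsilon> - B \<epsilon> * ln (B \<epsilon>)"
      unfolding B_def Lq_norm_2_square by (simp add: mult.commute)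
  qed
  have "((\<lambda>y::real. y * ln y) has_real_derivative 1) (at 1)" by (auto intro!: derivative_eq_intros)
  moreover have "((\<lambda>\<epsilon>. (B \<epsilon> - 1) / \<epsilon>\<^sup>2) \<longlongrightarrow> (2 - 1) / (n + 1)) (at_right 0)"
    unfolding B_def by (rule Lq_norm_affine_tendsto(1)[OF n]) simp
  ultimately have BL: "((\<lambda>\<epsilon>. B \<epsilon> * ln (B \<epsilon>) / \<epsilon>\<^sup>2) \<longlongrightarrow> 1 / (n + 1)) (at_right 0)"
    using second_order_compose[of B "1 / (n + 1)" "\<lambda>y. y * ln y" 1] by simp
  have HL: "((\<lambda>\<epsilon>. H \<epsilon> / \<epsilon>\<^sup>2) \<longlongrightarrow> 3 / (n + 1)) (at_right 0)"
    using second_order_moment_tendsto(1)[OF n hm T] unfolding H_def by simp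
  have "((\<lambda>\<epsilon>. C * (H \<epsilon> / \<epsilon>\<^sup>2 - B \<epsilon> * ln (B \<epsilon>) / \<epsilon>\<^sup>2)) \<longlongrightarrow> C * (3 / (n + 1) - 1 / (n + 1))) (at_right 0)"
    by (intro tendsto_mult tendsto_const tendsto_diff HL BL)
  moreover have "n / (n + 1) < C * (3 / (n + 1) - 1 / (n + 1))"
    unfolding diff_divide_distrib[symmetric] times_divide_eq_right using n C by (intro divide_strict_right_mono) auto
  ultimately have "\<forall>\<^sub>F \<epsilon> in at_right 0. n / (n + 1) < C * (H \<epsilon> / \<epsilon>\<^sup>2 - B \<epsilon> * ln (B \<epsilon>) / \<epsilon>\<^sup>2)"
    by (rule order_tendstoD(1))
  moreover have "\<forall>\<^sub>F \<epsilon> in at_right (0::real). \<epsilon> \<in> {0<..<1 / 2}" by (rule eventually_at_right_real) simp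
  ultimately have "\<forall>\<^sub>F \<epsilon> in at_right 0. \<epsilon> \<in> {0<..<1 / 2} \<and> n / (n + 1) < C * (H \<epsilon> / \<epsilon>\<^sup>2 - B \<epsilon> * ln (B \<epsilon>) / \<epsilon>\<^sup>2)"
    by eventually_elim simp
  from eventually_happens'[OF trivial_limit_at_right_real this] obtain \<epsilon>
    where e0: "\<epsilon> \<in> {0<..<1 / 2}" and lt: "n / (n + 1) < C * (H \<epsilon> / \<epsilon>\<^sup>2 - B \<epsilon> * ln (B \<epsilon>) / \<epsilon>\<^sup>2)" by blast
  then have e: "0 < \<epsilon>" "\<epsilon> < 1 / 2" by simp_all
  have e': "\<bar>\<epsilon>\<bar> \<le> 1 / 2" using e by simp
  have "n / (n + 1) * \<epsilon>\<^sup>2 < C * (H \<epsilon> / \<epsilon>\<^sup>2 - B \<epsilon> * ln (B \<epsilon>) / \<epsilon>\<^sup>2) * \<epsilon>\<^sup>2"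
    using lt e by (intro mult_strict_right_mono) auto
  also have "\<dots> = C * (H \<epsilon> - B \<epsilon> * ln (B \<epsilon>))"
    using e by (simp add: diff_divide_distrib[symmetric])
  finally have "(Lq_norm n 2 (\<lambda>z. rho z * \<epsilon>))\<^sup>2 < C * (\<integral>z. entropy_integrand n (?f \<epsilon>) z \<partial>nu n)"
    unfolding energy_affine[OF n] ent(2)[OF e'] .
  then show ?thesis
    using in_H1_affine[OF n, of \<epsilon>] ent(1)[OF e'] by (intro exI[of _ "?f \<epsilon>"] exI[of _ "\<lambda>_. \<epsilon>"]) simp
qed

theorem theorem1:
  fixes n :: real
  assumes "n > 0"
  shows
   "(\<forall>p. p \<in> (if n \<le> 2 then {1..<2} \<union> {2<..} else {1..<2} \<union> {2<..2 * n / (n - 2)}) \<longrightarrow>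
      (\<forall>f f'. in_H1 n f f' \<longrightarrow>
         in_Lq n p f \<and>
         (Lq_norm n 2 (\<lambda>z. rho z * f' z))\<^sup>2
           \<ge> n / (p - 2) * ((Lq_norm n p f)\<^sup>2 - (Lq_norm n 2 f)\<^sup>2)) \<and>
      (\<forall>C>n. \<exists>f f'. in_H1 n f f' \<and> in_Lq n p f \<and>
         (Lq_norm n 2 (\<lambda>z. rho z * f' z))\<^sup>2
           < C / (p - 2) * ((Lq_norm n p f)\<^sup>2 - (Lq_norm n 2 f)\<^sup>2))) \<and>
    (\<forall>f f'. in_H1 n f f' \<longrightarrow>
       integrable (nu n) (entropy_integrand n f) \<and>
       (Lq_norm n 2 (\<lambda>z. rho z * f' z))\<^sup>2
         \<ge> n / 2 * (\<integral>z. entropy_integrand n f z \<partial>(nu n))) \<and>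
    (\<forall>C > n / 2. \<exists>f f'. in_H1 n f f' \<and>
       integrable (nu n) (entropy_integrand n f) \<and>
       (Lq_norm n 2 (\<lambda>z. rho z * f' z))\<^sup>2
         < C * (\<integral>z. entropy_integrand n f z \<partial>(nu n)))"
proof -
  have main: "in_Lq n p f \<and> n / (p - 2) * ((Lq_norm n p f)\<^sup>2 - (Lq_norm n 2 f)\<^sup>2) \<le> (Lq_norm n 2 (\<lambda>z. rho z * f' z))\<^sup>2"
    if p: "p \<in> (if n \<le> 2 then {1..<2} \<union> {2<..} else {1..<2} \<union> {2<..2 * n / (n - 2)})" and H: "in_H1 n f f'" for p f f'
  proof (cases "p = 1")
    case True
    then show ?thesis using poincare_inequality[OF assms H] by simp
  next
    case False
    then have p1: "1 < p" "p \<noteq> 2" using p by (auto split: if_splits)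
    \<comment> \<open>The range of p in product form: for n > 2 it is p \<le> 2 n / (n - 2)
      multiplied by n - 2, and for n \<le> 2 the left side is not positive.\<close>
    have "(n - 2) * (p - 1) \<le> n + 2"
    proof (cases "n \<le> 2")
      case True
      then have "(n - 2) * (p - 1) \<le> 0" using p1 by (intro mult_nonpos_nonneg) auto
      then show ?thesis using assms by simp
    next
      case n2: False
      have "2 \<le> 2 * n / (n - 2)" using n2 by (simp add: field_simps)
      then have "p \<le> 2 * n / (n - 2)" using p n2 by auto
      then have "(n - 2) * p \<le> (n - 2) * (2 * n / (n - 2))" using n2 by (intro mult_left_mono) auto
      also have "\<dots> = 2 * n" using n2 by simp
      finally show ?thesis by (simp add: algebra_simps)
    qed
    then show ?thesis using interpolation_inequality[OF assms p1 _ H] by blast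
  qed
  have "1 \<le> p \<and> p \<noteq> 2" if "p \<in> (if n \<le> 2 then {1..<2} \<union> {2<..} else {1..<2} \<union> {2<..2 * n / (n - 2)})" for p
    using that by (auto split: if_splits)
  then show ?thesis
    using main interpolation_constant_sharp[OF assms] log_sobolev_inequality[OF assms] log_sobolev_constant_sharp[OF assms]
    by blast
qed

end
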